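(* Let $u_0\in H^1(S^1)$, let $(\rho,\rho_t)$ be the global solution (defined for all $t\ge 0$, with $\int_0^1\rho(t,x)^2dx=1$) of the Cauchy problem described in the context, and let $$\eta(t,x)=\int_0^x \rho(t,y)^2\,dy+t\,u_0(0)-\int_0^t\int_0^\tau H(s,0)\,ds\,d\tau$$ be the Lagrangian flow of the corresponding weak solution $u$ of the Camassa–Holm equation (so that $u(t,\eta(t,x))=G(t,x)$). Then for every $t\ge0$ the map $x\mapsto \eta(t,x)$ is absolutely continuous. Furthermore, if $k\ge1$ and $u_0\in C^k(S^1)$, then $x\mapsto\eta(t,x)$ is of class $C^k$ for all $t\ge 0$.
   Context: $S^1=\mathbb{R}/\mathbb{Z}$; functions on $S^1$ are $1$-periodic functions on $[0,1]$. Let $u_0\in H^1(S^1)$ and $\mu=\int_0^1u_0\,dx$. For $\rho,\sigma\in L^2(S^1)$ define $$G(\rho,\sigma)(x)=\int_0^x 2\rho\sigma\,dy+\mu-\int_0^1\Big(\int_0^y 2\rho\sigma\,dz\Big)\rho(y)^2\,dy,$$ $$F(\rho,\sigma)(x)=\int_0^1\frac{\cosh\big(\big|\int_y^x\rho(z)^2dz\big|-\tfrac12\big)}{2\sinh(1/2)}\big(\rho(y)^2G(y)^2+2\sigma(y)^2\big)\,dy,\qquad f(\rho,\sigma)=\tfrac12\rho\,(G^2-F),$$ with $G=G(\rho,\sigma)$. The Cauchy problem is the ODE on $L^2(S^1)\times L^2(S^1)$: $\frac{d\rho}{dt}=\rho_t$, $\frac{d\rho_t}{dt}=f(\rho,\rho_t)$,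 $\rho(0)=1$ (constant function), $\rho_t(0)=\tfrac12u_0'$. Along the solution write $G(t,x)=G(\rho(t),\rho_t(t))(x)$ and $$H(t,x)=\int_0^x\frac{\sinh\big(\int_y^x\rho^2dz-\tfrac12\big)}{2\sinh(1/2)}(\rho^2G^2+2\rho_t^2)(y)\,dy+\int_x^1\frac{\sinh\big(-\int_y^x\rho^2dz-\tfrac12\big)}{2\sinh(1/2)}(\rho^2G^2+2\rho_t^2)(y)\,dy.$$ *)

theory Defs
  imports "HOL-Analysis.Analysis"
begin

text \<open>Functions on S^1 = R/Z are represented as 1-periodic functions on R.\<close>

definition periodic1 :: "(real \<Rightarrow> real) \<Rightarrow> bool" where
  "periodic1 g \<longleftrightarrow> (\<forall>x. g (x + 1) = g x)"

definition L2_01 :: "(real \<Rightarrow> real) \<Rightarrow> bool" where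
  "L2_01 g \<longleftrightarrow> set_borel_measurable lborel {0..1} g \<and>
               set_integrable lborel {0..1} (\<lambda>x. (g x)^2)"

definition L2dist01 :: "(real \<Rightarrow> real) \<Rightarrow> (real \<Rightarrow> real) \<Rightarrow> real" where
  "L2dist01 g h = sqrt (LINT x:{0..1}|lborel. (g x - h x)^2)"

definition L2_deriv_at :: "(real \<Rightarrow> real \<Rightarrow> real) \<Rightarrow> (real \<Rightarrow> real) \<Rightarrow> real \<Rightarrow> bool" where
  "L2_deriv_at X X' t \<longleftrightarrow>
     ((\<lambda>s. L2dist01 (\<lambda>x. X s x - X t x - (s - t) * X' x) (\<lambda>_. 0) / \<bar>s - t\<bar>) \<longlongrightarrow> 0)
       (at t within {0..})"

definition H1_S1 :: "(real \<Rightarrow> real) \<Rightarrow> (real \<Rightarrow> real) \<Rightarrow> bool" where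
  "H1_S1 u ud \<longleftrightarrow> periodic1 u \<and> periodic1 ud \<and> L2_01 ud \<and>
     (\<forall>x. u x = u 0 + (LBINT y=0..x. ud y))"

definition G_op :: "real \<Rightarrow> (real \<Rightarrow> real) \<Rightarrow> (real \<Rightarrow> real) \<Rightarrow> real \<Rightarrow> real" where
  "G_op \<mu> \<rho> \<sigma> x =
     (LBINT y=0..x. 2 * \<rho> y * \<sigma> y) + \<mu>
     - (LBINT y=0..1. (LBINT z=0..y. 2 * \<rho> z * \<sigma> z) * (\<rho> y)^2)"

definition F_op :: "real \<Rightarrow> (real \<Rightarrow> real) \<Rightarrow> (real \<Rightarrow> real) \<Rightarrow> real \<Rightarrow> real" where
  "F_op \<mu> \<rho> \<sigma> x =
     (LBINT y=0..1. cosh (\<bar>LBINT z=y..x. (\<rho> z)^2\<bar> - 1/2) / (2 * sinh (1/2))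
        * ((\<rho> y)^2 * (G_op \<mu> \<rho> \<sigma> y)^2 + 2 * (\<sigma> y)^2))"

definition f_op :: "real \<Rightarrow> (real \<Rightarrow> real) \<Rightarrow> (real \<Rightarrow> real) \<Rightarrow> real \<Rightarrow> real" where
  "f_op \<mu> \<rho> \<sigma> x = 1/2 * \<rho> x * ((G_op \<mu> \<rho> \<sigma> x)^2 - F_op \<mu> \<rho> \<sigma> x)"

definition H_op :: "real \<Rightarrow> (real \<Rightarrow> real) \<Rightarrow> (real \<Rightarrow> real) \<Rightarrow> real \<Rightarrow> real" where
  "H_op \<mu> \<rho> \<sigma> x =
     (LBINT y=0..x. sinh ((LBINT z=y..x. (\<rho> z)^2) - 1/2) / (2 * sinh (1/2))
        * ((\<rho> y)^2 * (G_op \<mu> \<rho> \<sigma> y)^2 + 2 * (\<sigma> y)^2))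
   + (LBINT y=x..1. sinh (- (LBINT z=y..x. (\<rho> z)^2) - 1/2) / (2 * sinh (1/2))
        * ((\<rho> y)^2 * (G_op \<mu> \<rho> \<sigma> y)^2 + 2 * (\<sigma> y)^2))"

definition is_global_solution ::
  "(real \<Rightarrow> real) \<Rightarrow> (real \<Rightarrow> real) \<Rightarrow> (real \<Rightarrow> real \<Rightarrow> real) \<Rightarrow> (real \<Rightarrow> real \<Rightarrow> real) \<Rightarrow> bool" where
  "is_global_solution u0 u0d \<rho> \<rho>t \<longleftrightarrow>
     (\<forall>t\<ge>0. periodic1 (\<rho> t) \<and> periodic1 (\<rho>t t) \<and> L2_01 (\<rho> t) \<and> L2_01 (\<rho>t t)
        \<and> L2_deriv_at \<rho> (\<rho>t t) t
        \<and> L2_deriv_at \<rho>t (f_op (LBINT x=0..1. u0 x) (\<rho> t) (\<rho>t t)) t)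
   \<and> L2dist01 (\<rho> 0) (\<lambda>_. 1) = 0
   \<and> L2dist01 (\<rho>t 0) (\<lambda>x. u0d x / 2) = 0"

definition eta :: "(real \<Rightarrow> real) \<Rightarrow> (real \<Rightarrow> real \<Rightarrow> real) \<Rightarrow> (real \<Rightarrow> real \<Rightarrow> real) \<Rightarrow> real \<Rightarrow> real \<Rightarrow> real" where
  "eta u0 \<rho> \<rho>t t x =
     (LBINT y=0..x. (\<rho> t y)^2) + t * u0 0
     - (LBINT \<tau>=0..t. (LBINT s=0..\<tau>. H_op (LBINT x=0..1. u0 x) (\<rho> s) (\<rho>t s) 0))"

definition abs_continuous_on :: "real set \<Rightarrow> (real \<Rightarrow> real) \<Rightarrow> bool" where
  "abs_continuous_on S g \<longleftrightarrow>
     (\<forall>\<epsilon>>0. \<exists>\<delta>>0. \<forall>(n::nat) (a::nat\<Rightarrow>real) b.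
        (\<forall>i<n. a i \<le> b i \<and> {a i..b i} \<subseteq> S) \<and>
        (\<forall>i<n. \<forall>j<n. i \<noteq> j \<longrightarrow> {a i<..<b i} \<inter> {a j<..<b j} = {}) \<and>
        (\<Sum>i<n. b i - a i) < \<delta>
        \<longrightarrow> (\<Sum>i<n. \<bar>g (b i) - g (a i)\<bar>) < \<epsilon>)"

definition Ck :: "nat \<Rightarrow> (real \<Rightarrow> real) \<Rightarrow> bool" where
  "Ck k g \<longleftrightarrow> (\<exists>D :: nat \<Rightarrow> real \<Rightarrow> real. D 0 = g \<and>
      (\<forall>j<k. \<forall>x. (D j has_real_derivative D (Suc j) x) (at x)) \<and> continuous_on UNIV (D k))"

end

theory Submission
  imports Defs
begin

text \<open>
  On \<open>[0, 1]\<close> the equation reads \<open>\<rho>\<^sub>t\<^sub>t = q \<rho>\<close> with \<open>q = (G\<^sup>2 - F) / 2\<close>, and \<open>q\<close> depends on the solution only through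
  iterated primitives in \<open>x\<close> of \<open>\<rho>\<^sup>2\<close>, \<open>\<rho> \<rho>\<^sub>t\<close> and \<open>\<rho>\<^sub>t\<^sup>2\<close>. Continuity of the solution in time with values
  in \<open>L\<^sup>2\<close> therefore makes \<open>q\<close> jointly continuous, and the scalar equations \<open>z'' = q(\<cdot>, x) z\<close> with
  \<open>z(0) = 1\<close>, \<open>z'(0) = u\<^sub>0'(x) / 2\<close> have a jointly continuous solution, which by a Gronwall estimate
  in \<open>L\<^sup>2\<close> agrees with \<open>\<rho>\<close> almost everywhere. The primitives gain one \<open>x\<close>-derivative and the linear
  equation preserves it, so the regularity of \<open>z\<close> climbs up to that of \<open>u\<^sub>0'\<close>; finally \<open>\<eta>\<close> is a
  primitive of \<open>\<rho>\<^sup>2\<close> plus a function of time alone. The normalisation \<open>\<integral>\<rho>\<^sup>2 = 1\<close>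
  and its time derivative \<open>\<integral>\<rho> \<rho>\<^sub>t = 0\<close> make \<open>q\<close> periodic in \<open>x\<close>.
\<close>

text \<open>A solution is a curve in \<open>L\<^sup>2\<close>, so for fixed \<open>x\<close> the
  values \<open>\<rho> t x\<close> carry no information and no pointwise equation can be read off
  from them. The way out is to freeze the coefficient: \<open>q\<close>, computed once from the
  solution, is treated as a given function, and the equation for \<open>z\<close> becomes linear.
  Linearity gives existence on all of \<open>{0..}\<close>, a comparison of \<open>z\<close> with
  \<open>\<rho>\<close> that needs no Lipschitz bound on the nonlinear \<open>f_op\<close>, and a
  variational equation of the same linear type for the \<open>x\<close>-derivative. The bootstrap is
  not circular, because \<open>j\<close> derivatives of \<open>z\<close> already produce
  \<open>j + 1\<close> derivatives of \<open>q\<close>. Periodicity of \<open>q\<close> matters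
  because the identity of \<open>f_op\<close> with \<open>q\<close> times \<open>\<rho>\<close> is
  available only on \<open>{0..1}\<close>. The two functions are therefore compared there, and
  periodicity of both carries the equality to the line; otherwise smoothness of the flow across the
  integers would be out of reach. Absolute continuity is a separate argument, by truncating the
  density \<open>\<rho>\<close> squared at a large height.\<close>

definition loc_integrable :: "(real \<Rightarrow> real) \<Rightarrow> bool" where
  "loc_integrable p \<longleftrightarrow> (\<forall>a b. set_integrable lborel {a..b} p)"

text \<open>The oriented integral yields one function on the whole line, negative \<open>x\<close>
  included, so differences of values need no case split on the order of the endpoints.\<close>

definition primitive :: "(real \<Rightarrow> real) \<Rightarrow> real \<Rightarrow> real" where
  "primitive p x = (LBINT y=0..x. p y)"

section \<open>Calculus of primitives of locally integrable functions\<close>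

lemma loc_integrableD: "loc_integrable p \<Longrightarrow> set_integrable lborel {a..b} p"
  by (simp add: loc_integrable_def)

lemma loc_integrable_interval:
  assumes "loc_integrable p" shows "interval_lebesgue_integrable lborel (ereal a) (ereal b) p"
proof -
  have "set_integrable lborel {a<..<b} p" for a b
    by (rule set_integrable_subset[OF loc_integrableD[OF assms, of a b]]) auto
  then show ?thesis by (auto simp: interval_lebesgue_integrable_def)
qed

lemma primitive_diff:
  assumes "loc_integrable p" shows "primitive p b - primitive p a = (LBINT y=a..b. p y)"
proof -
  have "(LBINT x=ereal 0..ereal a. p x) + (LBINT x=ereal a..ereal b. p x) = (LBINT x=ereal 0..ereal b. p x)"
    by (rule interval_integral_sum) (simp only: ereal_min[symmetric] ereal_max[symmetric] loc_integrable_interval[OF assms])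
  then show ?thesis by (simp add: primitive_def zero_ereal_def)
qed

lemma primitive_diff_Icc:
  assumes "loc_integrable p" "a \<le> b" shows "primitive p b - primitive p a = (LINT y:{a..b}|lborel. p y)"
  using assms by (simp add: primitive_diff interval_integral_Icc)

lemma primitive_0 [simp]: "primitive p 0 = 0"
  by (simp add: primitive_def flip: zero_ereal_def)

lemma primitive_1: "primitive p 1 = (LINT y:{0..1}|lborel. p y)"
  unfolding primitive_def using interval_integral_Icc[of 0 1 p] by (simp add: zero_ereal_def one_ereal_def)

lemma loc_integrable_add: "loc_integrable p \<Longrightarrow> loc_integrable q \<Longrightarrow> loc_integrable (\<lambda>x. p x + q x)"
  by (auto simp: loc_integrable_def)
lemma loc_integrable_diff: "loc_integrable p \<Longrightarrow> loc_integrable q \<Longrightarrow> loc_integrable (\<lambda>x. p x - q x)"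
  by (auto simp: loc_integrable_def)
lemma loc_integrable_abs: "loc_integrable p \<Longrightarrow> loc_integrable (\<lambda>x. \<bar>p x\<bar>)"
  by (auto simp: loc_integrable_def intro: set_integrable_abs)
lemma loc_integrable_cmult: "loc_integrable p \<Longrightarrow> loc_integrable (\<lambda>x. c * p x)"
  by (auto simp: loc_integrable_def)

lemma loc_integrable_continuous: "continuous_on UNIV f \<Longrightarrow> loc_integrable f"
  by (auto simp: loc_integrable_def intro!: borel_integrable_atLeastAtMost' intro: continuous_on_subset)

lemma loc_integrable_mult:
  assumes f: "continuous_on UNIV f" and p: "loc_integrable p"
  shows "loc_integrable (\<lambda>x. f x * p x)"
  unfolding loc_integrable_def
proof (intro allI)
  fix a b :: real
  have "compact (f ` {a..b})"
    using f by (auto intro!: compact_continuous_image intro: continuous_on_subset)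
  then obtain C where C: "\<And>x. x \<in> {a..b} \<Longrightarrow> norm (f x) \<le> C"
    using bounded_iff compact_imp_bounded by (metis imageI)
  have p': "set_integrable lborel {a..b} p" using p by (rule loc_integrableD)
  show "set_integrable lborel {a..b} (\<lambda>x. f x * p x)"
  proof (rule set_integrable_bound)
    show "set_integrable lborel {a..b} (\<lambda>x. C * p x)" using p' by simp
    have [measurable]: "f \<in> borel_measurable borel"
      using f by (rule borel_measurable_continuous_onI)
    \<comment> \<open>Integrability on an interval gives measurability of the truncated function
      only, so the product is measured in truncated form.\<close>
    have [measurable]: "(\<lambda>x. indicator {a..b} x *\<^sub>R p x) \<in> borel_measurable lborel"
      using p' unfolding set_integrable_def by (rule borel_measurable_integrable)
    have "(\<lambda>x. f x * (indicator {a..b} x *\<^sub>R p x)) \<in> borel_measurable lborel" by measurable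
    then show "set_borel_measurable lborel {a..b} (\<lambda>x. f x * p x)"
      unfolding set_borel_measurable_def by (simp add: mult.left_commute)
    show "AE x in lborel. x \<in> {a..b} \<longrightarrow> norm (f x * p x) \<le> norm (C * p x)"
    proof (intro AE_I2 impI)
      fix x assume "x \<in> {a..b}"
      from C[OF this] show "norm (f x * p x) \<le> norm (C * p x)"
        by (simp add: abs_mult mult_right_mono)
    qed
  qed
qed

lemma primitive_cmult [simp]: "primitive (\<lambda>x. c * p x) x = c * primitive p x"
  by (simp add: primitive_def)

lemma primitive_add:
  assumes "loc_integrable p" "loc_integrable q" shows "primitive (\<lambda>x. p x + q x) x = primitive p x + primitive q x"
  unfolding primitive_def zero_ereal_def using assms by (simp add: loc_integrable_interval)

lemma primitive_sub:
  assumes "loc_integrable p" "loc_integrable q" shows "primitive (\<lambda>x. p x - q x) x = primitive p x - primitive q x"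
  unfolding primitive_def zero_ereal_def using assms by (simp add: loc_integrable_interval)

lemma primitive_cong_AE:
  assumes "loc_integrable p" "loc_integrable q" "AE x in lborel. p x = q x"
  shows "primitive p x = primitive q x"
proof -
  have *: "(LINT y:{a..b}|lborel. p y) = (LINT y:{a..b}|lborel. q y)" for a b
    unfolding set_lebesgue_integral_def
    using assms(3) loc_integrableD[OF assms(1), of a b] loc_integrableD[OF assms(2), of a b]
    by (intro integral_cong_AE) (auto simp: set_integrable_def elim: eventually_mono)
  have "primitive p x = primitive p x - primitive p 0" "primitive q x = primitive q x - primitive q 0" by simp_all
  then show ?thesis
    using primitive_diff_Icc[OF assms(1), of 0 x] primitive_diff_Icc[OF assms(1), of x 0]
      primitive_diff_Icc[OF assms(2), of 0 x] primitive_diff_Icc[OF assms(2), of x 0] *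
    by (smt (verit))
qed

text \<open>Enlarging the domain to a fixed window \<open>{a..b}\<close> makes the bound uniform in
  both points, whatever their order. This is how an \<open>L\<^sup>1\<close> distance of densities
  controls the sup distance of their primitives.\<close>

lemma primitive_diff_le:
  assumes p: "loc_integrable p" and q: "loc_integrable q" and "\<And>x. \<bar>p x\<bar> \<le> q x" "a \<le> x" "x \<le> b" "a \<le> y" "y \<le> b"
  shows "\<bar>primitive p y - primitive p x\<bar> \<le> (LINT y:{a..b}|lborel. q y)"
proof -
  have q0: "q x \<ge> 0" for x using assms(3)[of x] by simp
  have *: "\<bar>primitive p y - primitive p x\<bar> \<le> (LINT y:{a..b}|lborel. q y)" if "a \<le> x" "x \<le> y" "y \<le> b" for x y
  proof -
    have "\<bar>primitive p y - primitive p x\<bar> = \<bar>LINT z:{x..y}|lborel. p z\<bar>"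
      using primitive_diff_Icc[OF p] that by simp
    also have "\<dots> \<le> (LINT z:{x..y}|lborel. \<bar>p z\<bar>)"
      using set_integral_norm_bound[OF loc_integrableD[OF p]] by simp
    also have "\<dots> \<le> (LINT z:{x..y}|lborel. q z)"
      by (intro set_integral_mono set_integrable_abs loc_integrableD assms)
    also have "\<dots> \<le> (LINT z:{a..b}|lborel. q z)"
      unfolding set_lebesgue_integral_def
      using that q0 loc_integrableD[OF q] by (intro integral_mono) (auto simp: set_integrable_def split: split_indicator)
    finally show ?thesis .
  qed
  show ?thesis using *[of x y] *[of y x] assms by (cases "x \<le> y") (auto simp: abs_minus_commute)
qed

lemma primitive_DERIV:
  assumes "continuous_on UNIV p"
  shows "(primitive p has_real_derivative p x) (at x)"
proof -
  \<comment> \<open>The margin 1 puts \<open>x\<close> in the interior, so that the derivative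
    within the interval is the two-sided one.\<close>
  let ?a = "min 0 x - 1" and ?b = "max 0 x + 1"
  have "((\<lambda>u. LBINT y=ereal 0..u. p y) has_vector_derivative p x) (at x within {?a..?b})"
    by (rule interval_integral_FTC2) (auto intro: continuous_on_subset[OF assms])
  moreover have "at x within {?a..?b} = at x" by (rule at_within_interior) auto
  moreover have "(\<lambda>u. LBINT y=ereal 0..u. p y) = primitive p" by (simp add: primitive_def fun_eq_iff zero_ereal_def)
  ultimately show ?thesis by (simp add: has_real_derivative_iff_has_vector_derivative)
qed

lemma loc_integrable_HK: "loc_integrable p \<Longrightarrow> a \<le> b \<Longrightarrow> primitive p b - primitive p a = integral {a..b} p"
  by (simp add: primitive_diff_Icc set_borel_integral_eq_integral(2) loc_integrableD)

lemma loc_integrable_primitive_continuous: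
  assumes "loc_integrable p" shows "continuous_on UNIV (primitive p)"
proof -
  have "isCont (primitive p) x" for x
  proof -
    have "continuous_on {x-1..x+1} (\<lambda>y. integral {x-1..y} p)"
      by (intro indefinite_integral_continuous_1 set_borel_integral_eq_integral(1) loc_integrableD assms)
    then have "continuous_on {x-1..x+1} (\<lambda>y. primitive p (x-1) + integral {x-1..y} p)"
      by (intro continuous_intros)
    then have "continuous_on {x-1..x+1} (primitive p)"
      by (rule continuous_on_eq) (use loc_integrable_HK[OF assms, of "x-1"] in \<open>auto simp flip: loc_integrable_HK[OF assms]\<close>)
    then show ?thesis by (rule continuous_on_interior) auto
  qed
  then show ?thesis by (simp add: continuous_on_eq_continuous_at)
qed

section \<open>Families of functions depending continuously on time\<close>

definition jointly_cont :: "(real \<Rightarrow> real \<Rightarrow> real) \<Rightarrow> bool" where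
  "jointly_cont f \<longleftrightarrow> continuous_on ({0..} \<times> UNIV) (\<lambda>(t, x). f t x)"

text \<open>The densities in question are products of two \<open>L\<^sup>2\<close> functions, hence
  \<open>L\<^sup>1\<close> is the natural topology. The filter within \<open>{0..}\<close> makes
  continuity at time 0 one-sided.\<close>

definition L1_cont :: "(real \<Rightarrow> real \<Rightarrow> real) \<Rightarrow> bool" where
  "L1_cont p \<longleftrightarrow> (\<forall>t\<ge>0. loc_integrable (p t)) \<and>
     (\<forall>t\<ge>0. \<forall>a b. ((\<lambda>s. LINT x:{a..b}|lborel. \<bar>p s x - p t x\<bar>) \<longlongrightarrow> 0) (at t within {0..}))"

lemma jointly_cont_slice: "jointly_cont f \<Longrightarrow> t \<ge> 0 \<Longrightarrow> continuous_on UNIV (f t)"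
  unfolding jointly_cont_def
  by (rule continuous_on_compose2[of "{0..} \<times> UNIV" "\<lambda>(t, x). f t x" UNIV "\<lambda>x. (t, x)", simplified])
     (auto intro!: continuous_intros)

lemma jointly_cont_time: "jointly_cont f \<Longrightarrow> continuous_on {0..} (\<lambda>t. f t x)"
  unfolding jointly_cont_def
  by (rule continuous_on_compose2[of "{0..} \<times> UNIV" "\<lambda>(t, x). f t x" "{0..}" "\<lambda>t. (t, x)", simplified])
     (auto intro!: continuous_intros)

lemma jointly_cont_add: "jointly_cont f \<Longrightarrow> jointly_cont g \<Longrightarrow> jointly_cont (\<lambda>t x. f t x + g t x)"
  by (auto simp: jointly_cont_def case_prod_beta intro!: continuous_intros)
lemma jointly_cont_mult: "jointly_cont f \<Longrightarrow> jointly_cont g \<Longrightarrow> jointly_cont (\<lambda>t x. f t x * g t x)"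
  by (auto simp: jointly_cont_def case_prod_beta intro!: continuous_intros)
lemma jointly_cont_sinh: "jointly_cont f \<Longrightarrow> jointly_cont (\<lambda>t x. sinh (f t x))"
  by (auto simp: jointly_cont_def case_prod_beta sinh_def intro!: continuous_intros)
lemma jointly_cont_cosh: "jointly_cont f \<Longrightarrow> jointly_cont (\<lambda>t x. cosh (f t x))"
  by (auto simp: jointly_cont_def case_prod_beta cosh_def intro!: continuous_intros)
lemma jointly_cont_const: "continuous_on {0..} c \<Longrightarrow> jointly_cont (\<lambda>t x. c t)"
  unfolding jointly_cont_def case_prod_beta
  by (rule continuous_on_compose2[of "{0..}" c]) (auto intro!: continuous_intros)
lemma jointly_cont_of_space: "continuous_on UNIV a \<Longrightarrow> jointly_cont (\<lambda>t x. a x)"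
  unfolding jointly_cont_def case_prod_beta
  by (rule continuous_on_compose2[of UNIV a]) (auto intro!: continuous_intros)

text \<open>Heine-Cantor on a compact rectangle, put into coordinates.\<close>

lemma jointly_cont_uniform:
  assumes "jointly_cont f" "e > 0"
  obtains d where "d > 0" "\<And>s t x y. s \<in> {0..T} \<Longrightarrow> t \<in> {0..T} \<Longrightarrow> x \<in> {a..b} \<Longrightarrow> y \<in> {a..b} \<Longrightarrow>
    \<bar>s - t\<bar> < d \<Longrightarrow> \<bar>x - y\<bar> < d \<Longrightarrow> \<bar>f s x - f t y\<bar> < e"
proof -
  have "uniformly_continuous_on ({0..T} \<times> {a..b}) (\<lambda>(t, x). f t x)"
    using assms(1) by (intro compact_uniformly_continuous compact_Times) (auto simp: jointly_cont_def elim: continuous_on_subset)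
  then obtain d where d: "d > 0"
    "\<And>p q. p \<in> {0..T} \<times> {a..b} \<Longrightarrow> q \<in> {0..T} \<times> {a..b} \<Longrightarrow> dist q p < d \<Longrightarrow>
      dist ((\<lambda>(t, x). f t x) q) ((\<lambda>(t, x). f t x) p) < e"
    using \<open>e > 0\<close> unfolding uniformly_continuous_on_def by meson
  show thesis
  proof
    \<comment> \<open>Halved because the product distance is estimated by the sum of the two
      coordinate distances.\<close>
    show "d / 2 > 0" using d by simp
    fix s t x y assume h: "s \<in> {0..T}" "t \<in> {0..T}" "x \<in> {a..b}" "y \<in> {a..b}"
      "\<bar>s - t\<bar> < d / 2" "\<bar>x - y\<bar> < d / 2"
    have "dist (s, x) (t, y) \<le> \<bar>s - t\<bar> + \<bar>x - y\<bar>"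
      by (simp add: dist_Pair_Pair dist_real_def sqrt_sum_squares_le_sum_abs)
    with h have "dist (s, x) (t, y) < d" by linarith
    from d(2)[OF _ _ this] h show "\<bar>f s x - f t y\<bar> < e" by (simp add: dist_real_def)
  qed
qed

lemma jointly_cont_bound:
  assumes "jointly_cont f"
  obtains C where "C > 0" "\<And>t x. t \<in> {0..T} \<Longrightarrow> x \<in> {a..b} \<Longrightarrow> \<bar>f t x\<bar> \<le> C"
proof -
  have "compact ((\<lambda>(t, x). f t x) ` ({0..T} \<times> {a..b}))"
    using assms by (intro compact_continuous_image compact_Times) (auto simp: jointly_cont_def elim: continuous_on_subset)
  then obtain C where C: "C > 0" "\<forall>y\<in>(\<lambda>(t, x). f t x) ` ({0..T} \<times> {a..b}). norm y \<le> C"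
    using compact_imp_bounded bounded_pos by blast
  show thesis by (rule that[of C]) (use C in auto)
qed

lemma jointly_cont_time_uniform:
  assumes "jointly_cont f" "t \<ge> 0" "e > 0"
  shows "\<forall>\<^sub>F s in at t within {0..}. \<forall>x\<in>{a..b}. \<bar>f s x - f t x\<bar> < e"
proof -
  obtain d where d: "d > 0" "\<And>s t' x y. s \<in> {0..t+1} \<Longrightarrow> t' \<in> {0..t+1} \<Longrightarrow> x \<in> {a..b} \<Longrightarrow> y \<in> {a..b} \<Longrightarrow>
    \<bar>s - t'\<bar> < d \<Longrightarrow> \<bar>x - y\<bar> < d \<Longrightarrow> \<bar>f s x - f t' y\<bar> < e"
    using jointly_cont_uniform[OF assms(1,3)] by metis
  show ?thesis unfolding eventually_at
    \<comment> \<open>The cap 1 keeps \<open>s\<close> in \<open>{0..t+1}\<close>, the time range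
      for which \<open>d\<close> was chosen.\<close>
    by (rule exI[of _ "min d 1"]) (use d assms in \<open>auto simp: dist_real_def\<close>)
qed

lemma L1_cont_loc_integrable: "L1_cont p \<Longrightarrow> t \<ge> 0 \<Longrightarrow> loc_integrable (p t)"
  by (simp add: L1_cont_def)

lemma L1_contD: "L1_cont p \<Longrightarrow> t \<ge> 0 \<Longrightarrow> ((\<lambda>s. LINT x:{a..b}|lborel. \<bar>p s x - p t x\<bar>) \<longlongrightarrow> 0) (at t within {0..})"
  by (simp add: L1_cont_def)

lemma eventually_within_ge: "\<forall>\<^sub>F s in at t within {0..}. s \<ge> (0::real)"
  by (auto simp: eventually_at intro: exI[of _ 1])

lemma loc_integrable_LINT_mono:
  assumes "loc_integrable p" "loc_integrable q" "\<And>x. x \<in> {a..b} \<Longrightarrow> p x \<le> q x"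
  shows "(LINT x:{a..b}|lborel. p x) \<le> (LINT x:{a..b}|lborel. q x)"
  using assms by (intro set_integral_mono loc_integrableD) auto

lemma loc_integrable_LINT_nonneg:
  assumes "\<And>x. x \<in> {a..b} \<Longrightarrow> 0 \<le> p x"
  shows "0 \<le> (LINT x:{a..b}|lborel. p x :: real)"
  unfolding set_lebesgue_integral_def using assms
  by (intro Bochner_Integration.integral_nonneg) (auto split: split_indicator)

lemma L1_cont_add:
  assumes "L1_cont p" "L1_cont q" shows "L1_cont (\<lambda>t x. p t x + q t x)"
  unfolding L1_cont_def
proof (intro conjI allI impI)
  fix t :: real assume t: "t \<ge> 0"
  show "loc_integrable (\<lambda>x. p t x + q t x)" by (intro loc_integrable_add L1_cont_loc_integrable assms t)
  fix a b :: real
  show "((\<lambda>s. LINT x:{a..b}|lborel. \<bar>p s x + q s x - (p t x + q t x)\<bar>) \<longlongrightarrow> 0) (at t within {0..})"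
  proof (rule real_tendsto_sandwich[OF _ _ tendsto_const])
    show "((\<lambda>s. (LINT x:{a..b}|lborel. \<bar>p s x - p t x\<bar>) + (LINT x:{a..b}|lborel. \<bar>q s x - q t x\<bar>)) \<longlongrightarrow> 0) (at t within {0..})"
      using tendsto_add[OF L1_contD[OF assms(1) t] L1_contD[OF assms(2) t]] by simp
    show "\<forall>\<^sub>F s in at t within {0..}. 0 \<le> (LINT x:{a..b}|lborel. \<bar>p s x + q s x - (p t x + q t x)\<bar>)"
      by (intro always_eventually allI loc_integrable_LINT_nonneg) auto
    show "\<forall>\<^sub>F s in at t within {0..}. (LINT x:{a..b}|lborel. \<bar>p s x + q s x - (p t x + q t x)\<bar>)
      \<le> (LINT x:{a..b}|lborel. \<bar>p s x - p t x\<bar>) + (LINT x:{a..b}|lborel. \<bar>q s x - q t x\<bar>)"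
      using eventually_within_ge
    proof eventually_elim
      case (elim s)
      have l: "loc_integrable (\<lambda>x. \<bar>p s x - p t x\<bar>)" "loc_integrable (\<lambda>x. \<bar>q s x - q t x\<bar>)"
        using t elim by (auto intro!: loc_integrable_abs loc_integrable_diff L1_cont_loc_integrable[OF assms(1)] L1_cont_loc_integrable[OF assms(2)])
      have "(LINT x:{a..b}|lborel. \<bar>p s x + q s x - (p t x + q t x)\<bar>) \<le>
        (LINT x:{a..b}|lborel. \<bar>p s x - p t x\<bar> + \<bar>q s x - q t x\<bar>)"
        using t elim l
        by (intro loc_integrable_LINT_mono) (auto intro!: loc_integrable_abs loc_integrable_diff loc_integrable_add L1_cont_loc_integrable[OF assms(1)] L1_cont_loc_integrable[OF assms(2)])
      also have "\<dots> = (LINT x:{a..b}|lborel. \<bar>p s x - p t x\<bar>) + (LINT x:{a..b}|lborel. \<bar>q s x - q t x\<bar>)"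
        by (intro set_integral_add loc_integrableD l)
      finally show ?case .
    qed
  qed
qed

text \<open>Split the difference as
  \<open>f s x * (p s x - p t x) + (f s x - f t x) * p t x\<close>: the first factor
  \<open>f\<close> is bounded on a rectangle, and in the second term \<open>f\<close> converges
  uniformly on \<open>{a..b}\<close>.\<close>

lemma L1_cont_mult:
  assumes f: "jointly_cont f" and p: "L1_cont p" shows "L1_cont (\<lambda>t x. f t x * p t x)"
  unfolding L1_cont_def
proof (intro conjI allI impI)
  fix t :: real assume t: "t \<ge> 0"
  have l: "loc_integrable (\<lambda>x. f t x * p s x)" if "t \<ge> 0" "s \<ge> 0" for s t
    using that by (intro loc_integrable_mult jointly_cont_slice[OF f] L1_cont_loc_integrable[OF p])
  show "loc_integrable (\<lambda>x. f t x * p t x)" using l t by simp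
  fix a b :: real
  obtain C where C: "C > 0" "\<And>s x. s \<in> {0..t+1} \<Longrightarrow> x \<in> {a..b} \<Longrightarrow> \<bar>f s x\<bar> \<le> C"
    using jointly_cont_bound[OF f] by metis
  define P where "P = (LINT x:{a..b}|lborel. \<bar>p t x\<bar>)"
  have P: "P \<ge> 0" unfolding P_def by (intro loc_integrable_LINT_nonneg) auto
  show "((\<lambda>s. LINT x:{a..b}|lborel. \<bar>f s x * p s x - f t x * p t x\<bar>) \<longlongrightarrow> 0) (at t within {0..})"
    unfolding tendsto_iff
  proof (intro allI impI)
    fix e :: real assume e: "e > 0"
    \<comment> \<open>The summand 1 covers the case \<open>P = 0\<close> and makes
      \<open>e' * P < e / 2\<close> strict.\<close>
    define e' where "e' = e / (2 * (P + 1))"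
    have e': "e' > 0" "e' * P < e / 2" using e P by (auto simp: e'_def field_simps)
    have "\<forall>\<^sub>F s in at t within {0..}. \<forall>x\<in>{a..b}. \<bar>f s x - f t x\<bar> < e'"
      by (rule jointly_cont_time_uniform[OF f t e'(1)])
    moreover have "\<forall>\<^sub>F s in at t within {0..}. dist (LINT x:{a..b}|lborel. \<bar>p s x - p t x\<bar>) 0 < e / (2 * C)"
      using L1_contD[OF p t] e C(1) by (intro tendstoD) auto
    moreover have "\<forall>\<^sub>F s in at t within {0..}. s \<in> {0..t+1}"
      unfolding eventually_at by (rule exI[of _ 1]) (auto simp: dist_real_def)
    ultimately show "\<forall>\<^sub>F s in at t within {0..}. dist (LINT x:{a..b}|lborel. \<bar>f s x * p s x - f t x * p t x\<bar>) 0 < e"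
    proof eventually_elim
      case (elim s)
      have s: "s \<ge> 0" using elim by simp
      have l1: "loc_integrable (\<lambda>x. \<bar>p s x - p t x\<bar>)" "loc_integrable (\<lambda>x. \<bar>p t x\<bar>)"
        using s t by (auto intro!: loc_integrable_abs loc_integrable_diff L1_cont_loc_integrable[OF p])
      have "(LINT x:{a..b}|lborel. \<bar>f s x * p s x - f t x * p t x\<bar>)
        \<le> (LINT x:{a..b}|lborel. C * \<bar>p s x - p t x\<bar> + e' * \<bar>p t x\<bar>)"
      proof (rule loc_integrable_LINT_mono)
        show "loc_integrable (\<lambda>x. \<bar>f s x * p s x - f t x * p t x\<bar>)" "loc_integrable (\<lambda>x. C * \<bar>p s x - p t x\<bar> + e' * \<bar>p t x\<bar>)"
          using s t p l1 by (auto intro!: loc_integrable_abs loc_integrable_diff loc_integrable_add loc_integrable_cmult l)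
        fix x assume x: "x \<in> {a..b}"
        have "\<bar>f s x * p s x - f t x * p t x\<bar> = \<bar>f s x * (p s x - p t x) + (f s x - f t x) * p t x\<bar>"
          by (simp add: algebra_simps)
        also have "\<dots> \<le> \<bar>f s x\<bar> * \<bar>p s x - p t x\<bar> + \<bar>f s x - f t x\<bar> * \<bar>p t x\<bar>"
          by (rule order_trans[OF abs_triangle_ineq]) (simp add: abs_mult)
        also have "\<dots> \<le> C * \<bar>p s x - p t x\<bar> + e' * \<bar>p t x\<bar>"
          using elim x C(2)[of s x] by (intro add_mono mult_right_mono) (auto intro: less_imp_le)
        finally show "\<bar>f s x * p s x - f t x * p t x\<bar> \<le> C * \<bar>p s x - p t x\<bar> + e' * \<bar>p t x\<bar>" .
      qed
      also have "\<dots> = C * (LINT x:{a..b}|lborel. \<bar>p s x - p t x\<bar>) + e' * P"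
        unfolding P_def using loc_integrableD[OF l1(1)] loc_integrableD[OF l1(2)] by simp
      also have "\<dots> < e / 2 + e / 2"
        using elim(2) C(1) e' loc_integrable_LINT_nonneg[of a b "\<lambda>x. \<bar>p s x - p t x\<bar>"]
        by (intro add_strict_mono) (auto simp: field_simps)
      finally show ?case
        using loc_integrable_LINT_nonneg[of a b "\<lambda>x. \<bar>f s x * p s x - f t x * p t x\<bar>"] by (simp add: dist_real_def)
    qed
  qed
qed

text \<open>Moving from \<open>(t, x)\<close> to \<open>(s, y)\<close> costs the
  \<open>L\<^sup>1\<close> distance of \<open>p s\<close> and \<open>p t\<close> on a fixed window
  plus the change of the single continuous function \<open>primitive (p t)\<close>.\<close>

lemma L1_cont_primitive:
  assumes p: "L1_cont p" shows "jointly_cont (\<lambda>t x. primitive (p t) x)"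
  unfolding jointly_cont_def continuous_on_def
proof (intro ballI)
  fix z :: "real \<times> real" assume z: "z \<in> {0..} \<times> UNIV"
  obtain t x where tx: "z = (t, x)" "t \<ge> 0" using z by auto
  \<comment> \<open>The window \<open>{-N..N}\<close> contains 0, the base point of the primitive,
    and every \<open>y\<close> within distance 1 of \<open>x\<close>.\<close>
  define N where "N = \<bar>x\<bar> + 1"
  let ?F = "at z within {0..} \<times> UNIV"
  have l1: "((\<lambda>w. LINT x:{-N..N}|lborel. \<bar>p (fst w) x - p t x\<bar>) \<longlongrightarrow> 0) ?F"
    unfolding tendsto_iff
  proof (intro allI impI)
    fix e :: real assume "e > 0"
    then obtain d where d: "d > 0" "\<And>s. s \<ge> 0 \<Longrightarrow> s \<noteq> t \<Longrightarrow> dist s t < d \<Longrightarrow> dist (LINT x:{-N..N}|lborel. \<bar>p s x - p t x\<bar>) 0 < e"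
      using tendstoD[OF L1_contD[OF p tx(2), of "-N" N], of e] unfolding eventually_at by auto
    show "\<forall>\<^sub>F w in ?F. dist (LINT x:{-N..N}|lborel. \<bar>p (fst w) x - p t x\<bar>) 0 < e"
      unfolding eventually_at
    proof (intro exI[of _ d] conjI ballI impI)
      fix w assume w: "w \<in> {0..} \<times> (UNIV :: real set)" "w \<noteq> z \<and> dist w z < d"
      then have "dist (fst w) t < d" using dist_fst_le[of w z] tx by simp
      \<comment> \<open>The limit in time ignores \<open>s = t\<close>, but nearby points of the
        plane may share the time \<open>t\<close>; there the integral is 0.\<close>
      then show "dist (LINT x:{-N..N}|lborel. \<bar>p (fst w) x - p t x\<bar>) 0 < e"
        using d(2)[of "fst w"] w \<open>e > 0\<close> by (cases "fst w = t") auto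
    qed (rule d)
  qed
  have "(primitive (p t) \<longlongrightarrow> primitive (p t) x) (nhds x)"
    using loc_integrable_primitive_continuous[OF L1_cont_loc_integrable[OF p tx(2)]]
    by (simp add: continuous_on_eq_continuous_at continuous_at_imp_continuous_at_within isCont_def tendsto_nhds_iff)
  moreover have "filterlim snd (nhds x) ?F"
    using tendsto_snd[OF tendsto_ident_at[of z "{0..} \<times> UNIV"]] tx by simp
  ultimately have "((\<lambda>w. primitive (p t) (snd w)) \<longlongrightarrow> primitive (p t) x) ?F"
    by (rule filterlim_compose)
  then have "((\<lambda>w. primitive (p t) (snd w) - primitive (p t) x) \<longlongrightarrow> 0) ?F"
    using tx by (simp add: LIM_zero_iff)
  then have l2: "((\<lambda>w. \<bar>primitive (p t) (snd w) - primitive (p t) x\<bar>) \<longlongrightarrow> 0) ?F"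
    by (rule tendsto_rabs_zero)
  have ev: "\<forall>\<^sub>F w in ?F. \<bar>snd w\<bar> \<le> N \<and> fst w \<ge> 0"
    unfolding eventually_at
  proof (rule exI[of _ 1], safe)
    fix s y assume "dist (s, y) z < 1"
    then have "dist (snd (s, y)) (snd z) < 1" using dist_snd_le le_less_trans by blast
    then show "\<bar>snd (s, y)\<bar> \<le> N" using tx by (simp add: dist_real_def N_def)
  qed auto
  have "((\<lambda>w. primitive (p (fst w)) (snd w) - primitive (p t) x) \<longlongrightarrow> 0) ?F"
  proof (rule Lim_null_comparison)
    show "((\<lambda>w. (LINT x:{-N..N}|lborel. \<bar>p (fst w) x - p t x\<bar>) + \<bar>primitive (p t) (snd w) - primitive (p t) x\<bar>) \<longlongrightarrow> 0) ?F"
      using tendsto_add[OF l1 l2] by simp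
    show "\<forall>\<^sub>F w in ?F. norm (primitive (p (fst w)) (snd w) - primitive (p t) x) \<le>
      (LINT x:{-N..N}|lborel. \<bar>p (fst w) x - p t x\<bar>) + \<bar>primitive (p t) (snd w) - primitive (p t) x\<bar>"
      using ev
    proof eventually_elim
      case (elim w)
      have l: "loc_integrable (p (fst w))" "loc_integrable (p t)" using p tx elim by (auto intro: L1_cont_loc_integrable)
      have "\<bar>primitive (\<lambda>x. p (fst w) x - p t x) (snd w) - primitive (\<lambda>x. p (fst w) x - p t x) 0\<bar> \<le> (LINT x:{-N..N}|lborel. \<bar>p (fst w) x - p t x\<bar>)"
        by (rule primitive_diff_le) (use l elim in \<open>auto intro!: loc_integrable_diff loc_integrable_abs simp: N_def\<close>)
      then show ?case by (simp add: primitive_sub[OF l])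
    qed
  qed
  then show "((\<lambda>(t, x). primitive (p t) x) \<longlongrightarrow> (case z of (t, x) \<Rightarrow> primitive (p t) x)) ?F"
    using tx by (simp add: LIM_zero_iff split_def)
qed

text \<open>Only \<open>x\<close> is differentiated. Time enters through joint continuity, which
  makes moduli of continuity in \<open>x\<close> uniform over compact time ranges, as the estimates
  for the parametrised equation require.\<close>

primrec jointly_Ck :: "nat \<Rightarrow> (real \<Rightarrow> real \<Rightarrow> real) \<Rightarrow> bool" where
  "jointly_Ck 0 f \<longleftrightarrow> jointly_cont f"
| "jointly_Ck (Suc j) f \<longleftrightarrow> jointly_cont f \<and> (\<exists>f'. (\<forall>t\<ge>0. \<forall>x. (f t has_real_derivative f' t x) (at x)) \<and> jointly_Ck j f')"

text \<open>Families of densities whose primitives have \<open>j\<close> jointly continuous \<open>x\<close>-derivatives. At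
  level 0 the family need only be continuous in time in local \<open>L\<^sup>1\<close>; this shared index lets one
  argument serve both the start of the bootstrap, where \<open>\<rho>\<close> is merely in \<open>L\<^sup>2\<close>, and its later rounds.\<close>

primrec Ck_density :: "nat \<Rightarrow> (real \<Rightarrow> real \<Rightarrow> real) \<Rightarrow> bool" where
  "Ck_density 0 p \<longleftrightarrow> L1_cont p"
| "Ck_density (Suc j) p \<longleftrightarrow> (\<forall>t\<ge>0. loc_integrable (p t)) \<and> (\<exists>p'. jointly_Ck j p' \<and> (\<forall>t\<ge>0. AE x in lborel. p t x = p' t x))"

section \<open>Closure properties of the two smoothness scales\<close>

lemma jointly_Ck_jointly_cont: "jointly_Ck j f \<Longrightarrow> jointly_cont f" by (cases j) auto

lemma jointly_Ck_SucI: "jointly_cont f \<Longrightarrow> (\<And>t x. t \<ge> 0 \<Longrightarrow> (f t has_real_derivative f' t x) (at x)) \<Longrightarrow> jointly_Ck j f' \<Longrightarrow> jointly_Ck (Suc j) f"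
  by auto

lemma jointly_Ck_SucE:
  assumes "jointly_Ck (Suc j) f"
  obtains f' where "\<And>t x. t \<ge> 0 \<Longrightarrow> (f t has_real_derivative f' t x) (at x)" "jointly_Ck j f'"
  using assms by auto

lemma jointly_Ck_Suc_D: "jointly_Ck (Suc j) f \<Longrightarrow> jointly_Ck j f"
proof (induction j arbitrary: f)
  case (Suc j)
  obtain f' where "\<And>t x. t \<ge> 0 \<Longrightarrow> (f t has_real_derivative f' t x) (at x)" "jointly_Ck (Suc j) f'"
    using jointly_Ck_SucE[OF Suc.prems] by blast
  then show ?case using Suc by (intro jointly_Ck_SucI[of f f']) (auto intro: jointly_Ck_jointly_cont)
qed auto

lemma jointly_Ck_mono: "i \<le> j \<Longrightarrow> jointly_Ck j f \<Longrightarrow> jointly_Ck i f"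
  by (induction rule: inc_induct) (auto intro: jointly_Ck_Suc_D simp del: jointly_Ck.simps)

lemma jointly_cont_cong: "(\<And>t x. t \<ge> 0 \<Longrightarrow> f t x = g t x) \<Longrightarrow> jointly_cont f \<longleftrightarrow> jointly_cont g"
  unfolding jointly_cont_def by (rule continuous_on_cong) auto

lemma jointly_Ck_cong:
  assumes "\<And>t x. t \<ge> 0 \<Longrightarrow> f t x = g t x" shows "jointly_Ck j f \<longleftrightarrow> jointly_Ck j g"
proof -
  have "f t = g t" if "t \<ge> 0" for t using assms that by auto
  then show ?thesis using jointly_cont_cong[OF assms] by (cases j) auto
qed

lemma jointly_Ck_const:
  assumes "continuous_on {0..} c" shows "jointly_Ck j (\<lambda>t x. c t)"
  using assms
proof (induction j arbitrary: c)
  case (Suc j)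
  show ?case by (rule jointly_Ck_SucI[where f' = "\<lambda>t x. 0"]) (use Suc in \<open>auto intro: jointly_cont_const\<close>)
qed (simp add: jointly_cont_const)

text \<open>Needed for total integrals over one period: they are functions of time alone, hence
  smooth in \<open>x\<close> to any order \<open>i\<close>, unrelated to \<open>j\<close>.\<close>

lemma jointly_Ck_at: "jointly_Ck j f \<Longrightarrow> jointly_Ck i (\<lambda>t x. f t c)"
  by (intro jointly_Ck_const jointly_cont_time jointly_Ck_jointly_cont)

lemma jointly_Ck_add: "jointly_Ck j f \<Longrightarrow> jointly_Ck j g \<Longrightarrow> jointly_Ck j (\<lambda>t x. f t x + g t x)"
proof (induction j arbitrary: f g)
  case (Suc j)
  obtain f' where f': "\<And>t x. t \<ge> 0 \<Longrightarrow> (f t has_real_derivative f' t x) (at x)" "jointly_Ck j f'"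
    using jointly_Ck_SucE[OF Suc.prems(1)] by blast
  obtain g' where g': "\<And>t x. t \<ge> 0 \<Longrightarrow> (g t has_real_derivative g' t x) (at x)" "jointly_Ck j g'"
    using jointly_Ck_SucE[OF Suc.prems(2)] by blast
  note * = f' g'
  show ?case
    by (rule jointly_Ck_SucI[where f' = "\<lambda>t x. f' t x + g' t x"])
      (use * Suc in \<open>auto intro: jointly_cont_add jointly_Ck_jointly_cont intro!: derivative_intros simp del: jointly_Ck.simps\<close>)
qed (simp add: jointly_cont_add)

lemma jointly_Ck_mult: "jointly_Ck j f \<Longrightarrow> jointly_Ck j g \<Longrightarrow> jointly_Ck j (\<lambda>t x. f t x * g t x)"
proof (induction j arbitrary: f g)
  case (Suc j)
  obtain f' where f': "\<And>t x. t \<ge> 0 \<Longrightarrow> (f t has_real_derivative f' t x) (at x)" "jointly_Ck j f'"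
    using jointly_Ck_SucE[OF Suc.prems(1)] by blast
  obtain g' where g': "\<And>t x. t \<ge> 0 \<Longrightarrow> (g t has_real_derivative g' t x) (at x)" "jointly_Ck j g'"
    using jointly_Ck_SucE[OF Suc.prems(2)] by blast
  note * = f' g'
  have "jointly_Ck j (\<lambda>t x. f' t x * g t x + g' t x * f t x)"
    by (intro jointly_Ck_add Suc.IH * jointly_Ck_Suc_D[OF Suc.prems(1)] jointly_Ck_Suc_D[OF Suc.prems(2)])
  then show ?case
    by (rule jointly_Ck_SucI[where f' = "\<lambda>t x. f' t x * g t x + g' t x * f t x", rotated -1])
      (use * Suc.prems in \<open>auto intro: jointly_cont_mult jointly_Ck_jointly_cont intro!: DERIV_mult simp del: jointly_Ck.simps\<close>)
qed (simp add: jointly_cont_mult)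

lemma jointly_Ck_cmult: "jointly_Ck j f \<Longrightarrow> jointly_Ck j (\<lambda>t x. c * f t x)"
  by (rule jointly_Ck_mult[OF jointly_Ck_const]) auto

lemma jointly_Ck_diff:
  assumes "jointly_Ck j f" "jointly_Ck j g" shows "jointly_Ck j (\<lambda>t x. f t x - g t x)"
  using jointly_Ck_add[OF assms(1) jointly_Ck_cmult[OF assms(2), of "-1"]] by simp

text \<open>The two claims are proved together because each function is the derivative of the
  other.\<close>

lemma jointly_Ck_cosh_sinh: "jointly_Ck j f \<Longrightarrow> jointly_Ck j (\<lambda>t x. cosh (f t x)) \<and> jointly_Ck j (\<lambda>t x. sinh (f t x))"
proof (induction j arbitrary: f)
  case (Suc j)
  obtain f' where *: "\<And>t x. t \<ge> 0 \<Longrightarrow> (f t has_real_derivative f' t x) (at x)" "jointly_Ck j f'"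
    using jointly_Ck_SucE[OF Suc.prems] by blast
  have "jointly_Ck j (\<lambda>t x. cosh (f t x))" "jointly_Ck j (\<lambda>t x. sinh (f t x))"
    using Suc.IH[OF jointly_Ck_Suc_D[OF Suc.prems]] by auto
  then have **: "jointly_Ck j (\<lambda>t x. cosh (f t x) * f' t x)" "jointly_Ck j (\<lambda>t x. sinh (f t x) * f' t x)"
    using *(2) by (auto intro: jointly_Ck_mult)
  show ?case
    by (intro conjI jointly_Ck_SucI[OF jointly_cont_cosh _ **(2)] jointly_Ck_SucI[OF jointly_cont_sinh _ **(1)] jointly_Ck_jointly_cont[OF Suc.prems])
      (use * in \<open>auto intro!: derivative_eq_intros simp del: jointly_Ck.simps\<close>)
qed (simp add: jointly_cont_cosh jointly_cont_sinh)

lemmas jointly_Ck_cosh = jointly_Ck_cosh_sinh[THEN conjunct1] and jointly_Ck_sinh = jointly_Ck_cosh_sinh[THEN conjunct2]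

lemma Ck_density_loc_integrable: "Ck_density j p \<Longrightarrow> t \<ge> 0 \<Longrightarrow> loc_integrable (p t)"
  by (cases j) (auto intro: L1_cont_loc_integrable)

text \<open>At a positive level the a.e. representative of \<open>p\<close> has one order less than
  \<open>f\<close>. Lowering \<open>f\<close> by one order loses nothing, since the level counts
  derivatives of the primitive.\<close>

lemma Ck_density_mult: "jointly_Ck j f \<Longrightarrow> Ck_density j p \<Longrightarrow> Ck_density j (\<lambda>t x. f t x * p t x)"
proof (cases j)
  case (Suc i)
  assume f: "jointly_Ck j f" and p: "Ck_density j p"
  then obtain p' where p': "jointly_Ck i p'" "\<And>t. t \<ge> 0 \<Longrightarrow> AE x in lborel. p t x = p' t x" using Suc by auto
  have "jointly_Ck i (\<lambda>t x. f t x * p' t x)" using f Suc p' by (auto intro: jointly_Ck_mult jointly_Ck_Suc_D simp del: jointly_Ck.simps)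
  moreover have "AE x in lborel. f t x * p t x = f t x * p' t x" if "t \<ge> 0" for t
    using p'(2)[OF that] by eventually_elim simp
  moreover have "loc_integrable (\<lambda>x. f t x * p t x)" if "t \<ge> 0" for t
    using that f p by (intro loc_integrable_mult jointly_cont_slice jointly_Ck_jointly_cont Ck_density_loc_integrable)
  ultimately show ?thesis using Suc by auto
qed (auto intro: L1_cont_mult)

lemma Ck_density_cmult: "Ck_density j p \<Longrightarrow> Ck_density j (\<lambda>t x. c * p t x)"
  by (rule Ck_density_mult[OF jointly_Ck_const]) auto

lemma Ck_density_add: "Ck_density j p \<Longrightarrow> Ck_density j q \<Longrightarrow> Ck_density j (\<lambda>t x. p t x + q t x)"
proof (cases j)
  case (Suc i)
  assume p: "Ck_density j p" and q: "Ck_density j q"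
  then obtain p' q' where p': "jointly_Ck i p'" "\<And>t. t \<ge> 0 \<Longrightarrow> AE x in lborel. p t x = p' t x" 
    and q': "jointly_Ck i q'" "\<And>t. t \<ge> 0 \<Longrightarrow> AE x in lborel. q t x = q' t x" using Suc by auto
  have "jointly_Ck i (\<lambda>t x. p' t x + q' t x)" using p' q' by (auto intro: jointly_Ck_add)
  moreover have "AE x in lborel. p t x + q t x = p' t x + q' t x" if "t \<ge> 0" for t
    using p'(2)[OF that] q'(2)[OF that] by eventually_elim simp
  moreover have "loc_integrable (\<lambda>x. p t x + q t x)" if "t \<ge> 0" for t
    using that p q by (intro loc_integrable_add Ck_density_loc_integrable)
  ultimately show ?thesis using Suc by auto
qed (auto intro: L1_cont_add)

lemma jointly_cont_L1_cont:
  assumes "jointly_cont f" shows "L1_cont f"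
proof -
  have "L1_cont (\<lambda>t x. 1)" by (auto simp: L1_cont_def intro: loc_integrable_continuous)
  from L1_cont_mult[OF assms this] show ?thesis by simp
qed

lemma jointly_Ck_primitive:
  assumes "jointly_Ck j f" shows "jointly_Ck (Suc j) (\<lambda>t x. primitive (f t) x)"
  by (rule jointly_Ck_SucI[OF L1_cont_primitive[OF jointly_cont_L1_cont[OF jointly_Ck_jointly_cont[OF assms]]] _ assms])
     (auto intro: primitive_DERIV jointly_cont_slice jointly_Ck_jointly_cont assms)

text \<open>A primitive does not see null sets, so above level 0 the smooth representative may be
  integrated instead, which supplies the missing order. Level 0 is the joint continuity of
  primitives.\<close>

lemma Ck_density_primitive: "Ck_density j p \<Longrightarrow> jointly_Ck j (\<lambda>t x. primitive (p t) x)"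
proof (cases j)
  case (Suc i)
  assume p: "Ck_density j p"
  then obtain p' where p': "jointly_Ck i p'" "\<And>t. t \<ge> 0 \<Longrightarrow> AE x in lborel. p t x = p' t x" using Suc by auto
  have "primitive (p t) x = primitive (p' t) x" if "t \<ge> 0" for t x
    by (rule primitive_cong_AE) (use that p p' in \<open>auto intro: Ck_density_loc_integrable loc_integrable_continuous jointly_cont_slice jointly_Ck_jointly_cont\<close>)
  then have "jointly_Ck j (\<lambda>t x. primitive (p t) x) \<longleftrightarrow> jointly_Ck j (\<lambda>t x. primitive (p' t) x)" by (rule jointly_Ck_cong)
  then show ?thesis using jointly_Ck_primitive[OF p'(1)] Suc by (simp del: jointly_Ck.simps)
qed (auto intro: L1_cont_primitive)

lemma jointly_Ck_Ck:
  assumes "jointly_Ck k f" "t \<ge> 0" shows "Ck k (f t)"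
proof -
  have "\<exists>D. D 0 = f t \<and> (\<forall>j<k. \<forall>x. (D j has_real_derivative D (Suc j) x) (at x)) \<and> continuous_on UNIV (D k)"
    using assms
  proof (induction k arbitrary: f)
    case 0
    then show ?case by (intro exI[of _ "\<lambda>_. f t"]) (auto intro: jointly_cont_slice)
  next
    case (Suc k)
    obtain f' where f': "\<And>t x. t \<ge> 0 \<Longrightarrow> (f t has_real_derivative f' t x) (at x)" "jointly_Ck k f'"
      using jointly_Ck_SucE[OF Suc.prems(1)] by blast
    then obtain D where D: "D 0 = f' t" "\<forall>j<k. \<forall>x. (D j has_real_derivative D (Suc j) x) (at x)" "continuous_on UNIV (D k)"
      using Suc.IH[of f'] Suc.prems by auto
    show ?case
      by (rule exI[of _ "\<lambda>n. case n of 0 \<Rightarrow> f t | Suc n \<Rightarrow> D n"])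
        (use D f' Suc.prems in \<open>auto simp: less_Suc_eq_0_disj\<close>)
  qed
  then show ?thesis by (simp add: Ck_def)
qed

text \<open>Turns a witness of \<open>Ck\<close> into time-independent families. The induction runs
  on the number \<open>m\<close> of derivatives still available after the \<open>i\<close>-th
  one.\<close>

lemma jointly_Ck_derivative_sequence:
  assumes "\<And>j. j < k \<Longrightarrow> \<forall>x. (D j has_real_derivative D (Suc j) x) (at x)" "continuous_on UNIV (D k)" "i + m = k"
  shows "jointly_Ck m (\<lambda>t. D i)"
  using assms(3)
proof (induction m arbitrary: i)
  case 0
  then show ?case using jointly_cont_of_space[OF assms(2)] by simp
next
  case (Suc m)
  then have "jointly_Ck m (\<lambda>t. D (Suc i))" by simp
  moreover have "continuous_on UNIV (D i)"
    using assms(1)[of i] Suc.prems by (intro DERIV_continuous_on) (auto intro: has_field_derivative_at_within)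
  ultimately show ?case using assms(1)[of i] Suc.prems by (intro jointly_Ck_SucI[of _ "\<lambda>t. D (Suc i)"] jointly_cont_of_space) auto
qed

section \<open>Linear second-order equations\<close>

text \<open>The function \<open>N s * exp (- K * s) - c * s\<close> decreases: its derivative is at
  most \<open>c * (exp (- K * s) - 1)\<close>, which is nonpositive because \<open>c\<close> and
  \<open>K\<close> are nonnegative.\<close>

lemma gronwall:
  fixes N :: "real \<Rightarrow> real"
  assumes N: "\<And>t. t \<in> {0..T} \<Longrightarrow> (N has_real_derivative N' t) (at t within {0..})"
    and le: "\<And>t. t \<in> {0..T} \<Longrightarrow> N' t \<le> K * N t + c"
    and "c \<ge> 0" "K \<ge> 0" "t \<in> {0..T}"
  shows "N t \<le> (N 0 + c * t) * exp (K * t)"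
proof (cases "t = 0")
  case False
  define \<phi> where "\<phi> s = N s * exp (- K * s) - c * s" for s
  have d: "(\<phi> has_real_derivative (N' s - K * N s) * exp (- K * s) - c) (at s within {0..})" if "s \<in> {0..T}" for s
  proof -
    have "(\<phi> has_real_derivative N' s * exp (- K * s) + (exp (- K * s) * - K) * N s - c) (at s within {0..})"
      unfolding \<phi>_def by (auto intro!: derivative_eq_intros N[OF that])
    then show ?thesis by (simp add: algebra_simps)
  qed
  have "\<phi> t \<le> \<phi> 0"
  proof (rule DERIV_nonpos_imp_decreasing_open[where f = \<phi> and a = 0 and b = t])
    show "0 \<le> t" using assms by simp
    show "continuous_on {0..t} \<phi>"
      by (rule DERIV_continuous_on, rule has_field_derivative_subset, rule d) (use assms in auto)
    fix s assume s: "0 < s" "s < t"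
    \<comment> \<open>Derivatives within \<open>{0..}\<close> are one-sided at 0 and ordinary
      elsewhere; the monotonicity criterion wants ordinary ones in the open interval and mere
      continuity at the ends.\<close>
    have "at s within {0..} = at s" using s by (intro at_within_interior) (simp add: interior_Ici[of 0 "-1"])
    then have "(\<phi> has_real_derivative (N' s - K * N s) * exp (- K * s) - c) (at s)"
      using d[of s] s assms by simp
    moreover have "(N' s - K * N s) * exp (- K * s) \<le> c * 1"
    proof (rule mult_mono)
      have "s \<in> {0..T}" using s assms by simp
      from le[OF this] show "N' s - K * N s \<le> c" by simp
    qed (use s assms in auto)
    ultimately show "\<exists>y. (\<phi> has_real_derivative y) (at s) \<and> y \<le> 0" by force
  qed
  then have "N t * exp (- K * t) \<le> N 0 + c * t" by (simp add: \<phi>_def)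
  then have "N t * exp (- K * t) * exp (K * t) \<le> (N 0 + c * t) * exp (K * t)" by (intro mult_right_mono) auto
  then show ?thesis by (simp add: mult.assoc flip: exp_add)
qed simp

text \<open>With \<open>N = e\<^sup>2 + v\<^sup>2\<close>, Young's inequality gives
  \<open>N' \<le> (2 + Q) * N + \<epsilon>\<^sup>2\<close> and the initial bounds give
  \<open>N 0 \<le> 2 * \<epsilon>\<^sup>2\<close>. Gronwall then produces this constant times
  \<open>\<epsilon>\<close>, after a square root.\<close>

definition stability_const :: "real \<Rightarrow> real \<Rightarrow> real" where
  "stability_const Q T = sqrt ((2 + T) * exp ((2 + Q) * T))"

text \<open>One energy estimate serves three purposes: continuity in a parameter, differentiability
  in a parameter (with \<open>\<epsilon>\<close> of the size of the remainder) and uniqueness (with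
  \<open>\<epsilon> = 0\<close>). A single \<open>\<epsilon>\<close> bounds both initial values and
  the forcing.\<close>

lemma linear_ode_stability:
  fixes e v q h :: "real \<Rightarrow> real"
  assumes e: "\<And>t. t \<ge> 0 \<Longrightarrow> (e has_real_derivative v t) (at t within {0..})"
    and v: "\<And>t. t \<ge> 0 \<Longrightarrow> (v has_real_derivative q t * e t + h t) (at t within {0..})"
    and Q: "\<And>t. t \<in> {0..T} \<Longrightarrow> \<bar>q t\<bar> \<le> Q" and h: "\<And>t. t \<in> {0..T} \<Longrightarrow> \<bar>h t\<bar> \<le> \<epsilon>"
    and "\<bar>e 0\<bar> \<le> \<epsilon>" "\<bar>v 0\<bar> \<le> \<epsilon>" "t \<in> {0..T}"
  shows "\<bar>e t\<bar> \<le> stability_const Q T * \<epsilon> \<and> \<bar>v t\<bar> \<le> stability_const Q T * \<epsilon>"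
proof -
  have T: "T \<ge> 0" and Q0: "Q \<ge> 0" and eps: "\<epsilon> \<ge> 0"
    using assms(7) Q[OF assms(7)] assms(5) by auto
  define N where "N t = (e t)\<^sup>2 + (v t)\<^sup>2" for t
  have "N t \<le> (N 0 + \<epsilon>\<^sup>2 * t) * exp ((2 + Q) * t)"
  proof (rule gronwall)
    fix s assume s: "s \<in> {0..T}"
    show "(N has_real_derivative 2 * e s * v s + 2 * v s * (q s * e s + h s)) (at s within {0..})"
      unfolding N_def using s
      by (auto intro!: derivative_eq_intros e v)
    have 1: "2 * \<bar>e s * v s\<bar> \<le> N s"
      unfolding N_def using sum_squares_bound[of "\<bar>e s\<bar>" "\<bar>v s\<bar>"] by (simp add: abs_mult)
    have "2 * v s * (q s * e s) \<le> \<bar>q s\<bar> * (2 * \<bar>e s * v s\<bar>)"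
      using abs_ge_self[of "2 * v s * (q s * e s)"] by (simp add: abs_mult mult.commute mult.left_commute)
    also have "\<dots> \<le> Q * N s" using 1 Q[OF s] by (intro mult_mono) auto
    finally have 2: "2 * v s * (q s * e s) \<le> Q * N s" .
    have "2 * v s * h s \<le> (v s)\<^sup>2 + (h s)\<^sup>2" by (rule sum_squares_bound)
    also have "\<dots> \<le> N s + \<epsilon>\<^sup>2"
      using power_mono[OF h[OF s], of 2] by (intro add_mono) (auto simp: N_def)
    finally have 3: "2 * v s * h s \<le> N s + \<epsilon>\<^sup>2" .
    show "2 * e s * v s + 2 * v s * (q s * e s + h s) \<le> (2 + Q) * N s + \<epsilon>\<^sup>2"
      using 1 2 3 abs_ge_self[of "e s * v s"] by (simp add: algebra_simps)
  qed (use assms Q0 in auto)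
  also have "\<dots> \<le> (2 * \<epsilon>\<^sup>2 + \<epsilon>\<^sup>2 * T) * exp ((2 + Q) * T)"
  proof (rule mult_mono)
    have "(e 0)\<^sup>2 \<le> \<epsilon>\<^sup>2" "(v 0)\<^sup>2 \<le> \<epsilon>\<^sup>2" using power_mono[OF assms(5), of 2] power_mono[OF assms(6), of 2] by auto
    then show "N 0 + \<epsilon>\<^sup>2 * t \<le> 2 * \<epsilon>\<^sup>2 + \<epsilon>\<^sup>2 * T"
      unfolding N_def using assms(7) mult_left_mono[of t T "\<epsilon>\<^sup>2"] by auto
  qed (use assms(7) Q0 T in \<open>auto intro!: mult_left_mono\<close>)
  also have "\<dots> = (stability_const Q T * \<epsilon>)\<^sup>2"
    using T by (simp add: stability_const_def power_mult_distrib algebra_simps)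
  finally have N: "N t \<le> (stability_const Q T * \<epsilon>)\<^sup>2" .
  have C: "stability_const Q T * \<epsilon> \<ge> 0" using T eps by (simp add: stability_const_def)
  have "(e t)\<^sup>2 \<le> (stability_const Q T * \<epsilon>)\<^sup>2" "(v t)\<^sup>2 \<le> (stability_const Q T * \<epsilon>)\<^sup>2"
    using N by (auto simp: N_def intro: order_trans[rotated])
  then show ?thesis
    using C by (auto simp: abs_le_square_iff[symmetric])
qed

lemma stability_const_nonneg: "T \<ge> 0 \<Longrightarrow> stability_const Q T \<ge> 0" by (simp add: stability_const_def)

section \<open>Global solvability by Picard iteration\<close>

definition integral_from_0 :: "(real \<Rightarrow> real) \<Rightarrow> real \<Rightarrow> real" where "integral_from_0 f t = integral {0..t} f"

lemma integral_from_0_DERIV: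
  assumes "continuous_on {0..} f" "t \<ge> 0"
  shows "(integral_from_0 f has_real_derivative f t) (at t within {0..})"
proof -
  have "((\<lambda>x. integral {0..x} f) has_real_derivative f t) (at t within {0..t+1})"
    using assms by (intro integral_has_real_derivative continuous_on_subset[OF assms(1)]) auto
  moreover have "at t within {0..t+1} = at t within {0..}"
    by (rule at_within_nhd[of _ "{..<t+1}"]) auto
  moreover have "integral_from_0 f = (\<lambda>x. integral {0..x} f)" by (simp add: integral_from_0_def fun_eq_iff)
  ultimately show ?thesis by simp
qed

lemma integral_from_0_cont: "continuous_on {0..} f \<Longrightarrow> continuous_on {0..} (integral_from_0 f)"
  by (rule DERIV_continuous_on) (use integral_from_0_DERIV in auto)

lemma integral_from_0_add:
  assumes "continuous_on {0..} f" "continuous_on {0..} g"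
  shows "integral_from_0 (\<lambda>t. f t + g t) t = integral_from_0 f t + integral_from_0 g t"
  unfolding integral_from_0_def
  by (intro integral_add integrable_continuous_interval continuous_on_subset[OF assms(1)] continuous_on_subset[OF assms(2)]) auto

lemma integral_from_0_diff:
  assumes "continuous_on {0..} f" "continuous_on {0..} g"
  shows "integral_from_0 (\<lambda>t. f t - g t) t = integral_from_0 f t - integral_from_0 g t"
  unfolding integral_from_0_def
  by (intro integral_diff integrable_continuous_interval continuous_on_subset[OF assms(1)] continuous_on_subset[OF assms(2)]) auto

text \<open>Integration gains a factor \<open>1 / L\<close> when growth is measured against the
  weight \<open>exp (L * t)\<close>; this replaces a smallness condition on the time
  interval.\<close>

lemma integral_from_0_bound:
  assumes f: "continuous_on {0..} f" and b: "\<And>s. s \<in> {0..t} \<Longrightarrow> \<bar>f s\<bar> \<le> c * exp (L * s)"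
    and "L > 0" "t \<ge> 0"
  shows "\<bar>integral_from_0 f t\<bar> \<le> c / L * exp (L * t)"
proof -
  have "((\<lambda>s. c * exp (L * s)) has_integral (c / L * exp (L * t) - c / L * exp (L * 0))) {0..t}"
    using assms by (intro fundamental_theorem_of_calculus) 
      (auto intro!: derivative_eq_intros simp flip: has_real_derivative_iff_has_vector_derivative)
  then have I: "(\<lambda>s. c * exp (L * s)) integrable_on {0..t}" "integral {0..t} (\<lambda>s. c * exp (L * s)) = c / L * exp (L * t) - c / L"
    by (auto simp: has_integral_iff)
  have "norm (integral {0..t} f) \<le> integral {0..t} (\<lambda>s. c * exp (L * s))"
    by (intro integral_norm_bound_integral integrable_continuous_interval continuous_on_subset[OF f] I)
      (use b in auto)
  moreover have "c \<ge> 0" using b[of 0] assms by auto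
  then have "c / L \<ge> 0" using assms by simp
  ultimately show ?thesis unfolding I(2) integral_from_0_def real_norm_def by linarith
qed

context
  fixes q z0 :: "real \<Rightarrow> real"
  assumes q: "continuous_on {0..} q" and z0: "continuous_on {0..} z0"
begin

text \<open>These are the terms of the Neumann series of
  \<open>z = z0 + (double integral of q z)\<close>, not the successive approximations, which are
  their partial sums.\<close>

fun picard :: "nat \<Rightarrow> real \<Rightarrow> real" where
  "picard 0 = z0"
| "picard (Suc n) = integral_from_0 (integral_from_0 (\<lambda>s. q s * picard n s))"

lemma picard_cont: "continuous_on {0..} (picard n)"
  by (induction n) (auto intro!: z0 q integral_from_0_cont continuous_intros)

lemma picard_sum: "(\<Sum>i<Suc n. picard i t) = z0 t + integral_from_0 (integral_from_0 (\<lambda>s. q s * (\<Sum>i<n. picard i s))) t"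
proof (induction n)
  case 0
  have "integral_from_0 (\<lambda>s. 0) = (\<lambda>t. 0)" by (simp add: integral_from_0_def fun_eq_iff)
  then show ?case by simp
next
  case (Suc n)
  have 1: "(\<lambda>s. q s * (\<Sum>i<Suc n. picard i s)) = (\<lambda>s. q s * (\<Sum>i<n. picard i s) + q s * picard n s)"
    by (simp add: algebra_simps)
  have c: "continuous_on {0..} (\<lambda>s. q s * (\<Sum>i<n. picard i s))" "continuous_on {0..} (\<lambda>s. q s * picard n s)"
    by (intro continuous_intros q picard_cont)+
  have "integral_from_0 (\<lambda>s. q s * (\<Sum>i<Suc n. picard i s)) = (\<lambda>s. integral_from_0 (\<lambda>s. q s * (\<Sum>i<n. picard i s)) s + integral_from_0 (\<lambda>s. q s * picard n s) s)"
    unfolding 1 by (rule ext) (rule integral_from_0_add[OF c])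
  then have "integral_from_0 (integral_from_0 (\<lambda>s. q s * (\<Sum>i<Suc n. picard i s))) t
    = integral_from_0 (integral_from_0 (\<lambda>s. q s * (\<Sum>i<n. picard i s))) t + picard (Suc n) t"
    by (simp add: integral_from_0_add[OF integral_from_0_cont[OF c(1)] integral_from_0_cont[OF c(2)]])
  then show ?case using Suc by simp
qed

text \<open>With \<open>L = 2*Q+1\<close> two integrations gain \<open>Q / (L * L)\<close>, at most
  1/2 since \<open>2*Q \<le> L \<le> L * L\<close>. The summand 1 keeps \<open>L\<close> positive
  when \<open>Q = 0\<close>. So the integral operator halves weighted bounds on every
  \<open>{0..T}\<close>, however long.\<close>

lemma integral_from_0_twice_bound:
  assumes f: "continuous_on {0..} f" and Q: "\<And>t. t \<in> {0..T} \<Longrightarrow> \<bar>q t\<bar> \<le> Q" "Q \<ge> 0" 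
    and b: "\<And>s. s \<in> {0..T} \<Longrightarrow> \<bar>f s\<bar> \<le> c * exp ((2*Q+1) * s)" and "t \<in> {0..T}"
  shows "\<bar>integral_from_0 (integral_from_0 (\<lambda>s. q s * f s)) t\<bar> \<le> c / 2 * exp ((2*Q+1) * t)"
proof -
  let ?L = "2*Q+1"
  have L: "?L > 0" using Q by simp
  have c0: "c \<ge> 0" using b[of 0] assms(5) by auto
  have c: "continuous_on {0..} (\<lambda>s. q s * f s)" by (intro continuous_intros q f)
  have "\<bar>integral_from_0 (\<lambda>s. q s * f s) s\<bar> \<le> Q * c / ?L * exp (?L * s)" if s: "s \<in> {0..t}" for s
  proof (rule integral_from_0_bound[OF c])
    fix r assume "r \<in> {0..s}"
    then have r: "r \<in> {0..T}" using s assms(5) by auto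
    have "\<bar>q r\<bar> * \<bar>f r\<bar> \<le> Q * (c * exp (?L * r))" by (intro mult_mono b[OF r] Q r) auto
    then show "\<bar>q r * f r\<bar> \<le> Q * c * exp (?L * r)" unfolding abs_mult mult.assoc .
  qed (use L s in auto)
  then have "\<bar>integral_from_0 (integral_from_0 (\<lambda>s. q s * f s)) t\<bar> \<le> Q * c / ?L / ?L * exp (?L * t)"
    using assms(5) L by (intro integral_from_0_bound[OF integral_from_0_cont[OF c]]) auto
  also have "\<dots> \<le> c / 2 * exp (?L * t)"
  proof (rule mult_right_mono)
    have "c * (2 * Q) \<le> c * (?L * ?L)"
      using c0 Q by (intro mult_left_mono) (auto simp: algebra_simps)
    then have "2 * (Q * c) \<le> c * (?L * ?L)" by (simp add: mult_ac)
    then show "Q * c / ?L / ?L \<le> c / 2"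
      using L by (simp add: divide_le_eq pos_divide_le_eq mult_ac)
  qed simp
  finally show ?thesis .
qed

text \<open>Halving at each step gives the majorant \<open>M / 2^n * exp ((2*Q+1) * T)\<close>, a
  geometric series.\<close>

lemma picard_uniform:
  "uniform_limit {0..T} (\<lambda>n t. \<Sum>i<n. picard i t) (\<lambda>t. \<Sum>i. picard i t) sequentially"
proof -
  have "compact (q ` {0..T})" "compact (z0 ` {0..T})"
    by (auto intro!: compact_continuous_image continuous_on_subset[OF q] continuous_on_subset[OF z0])
  then obtain Q M where Q: "Q > 0" "\<And>t. t \<in> {0..T} \<Longrightarrow> \<bar>q t\<bar> \<le> Q"
    and M: "M > 0" "\<And>t. t \<in> {0..T} \<Longrightarrow> \<bar>z0 t\<bar> \<le> M"
    by (metis bounded_pos compact_imp_bounded imageI real_norm_def)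
  let ?L = "2*Q+1"
  have b: "\<bar>picard n t\<bar> \<le> M / 2^n * exp (?L * t)" if "t \<in> {0..T}" for n t
    using that
  proof (induction n arbitrary: t)
    case 0
    then have "1 \<le> exp (?L * t)" using Q by simp
    from mult_left_mono[OF this, of M] M(1) have "M \<le> M * exp (?L * t)" by simp
    with M(2)[OF 0] have "\<bar>z0 t\<bar> \<le> M * exp (?L * t)" by (rule order_trans)
    then show ?case by simp
  next
    case (Suc n)
    have "\<bar>integral_from_0 (integral_from_0 (\<lambda>s. q s * picard n s)) t\<bar> \<le> M / 2^n / 2 * exp (?L * t)"
      by (rule integral_from_0_twice_bound[OF picard_cont Q(2) _ Suc.IH Suc.prems]) (use Q in auto)
    then show ?case by (simp add: mult_ac)
  qed
  show ?thesis
  proof (rule Weierstrass_m_test)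
    show "norm (picard n t) \<le> M * exp (?L * T) * (1/2)^n" if "t \<in> {0..T}" for n t
    proof -
      have "M / 2^n * exp (?L * t) \<le> M / 2^n * exp (?L * T)"
        using that Q M by (intro mult_left_mono) auto
      then show ?thesis using b[OF that, of n] by (simp add: power_one_over field_simps)
    qed
  qed (auto intro: summable_mult)
qed

lemma picard_fixpoint:
  obtains z where "continuous_on {0..} z" "\<And>t. t \<ge> 0 \<Longrightarrow> z t = z0 t + integral_from_0 (integral_from_0 (\<lambda>s. q s * z s)) t"
proof
  define z where "z t = (\<Sum>i. picard i t)" for t
  have u: "uniform_limit {0..T} (\<lambda>n t. \<Sum>i<n. picard i t) z sequentially" for T
    using picard_uniform unfolding z_def .
  show zc: "continuous_on {0..} z"
  proof -
    have "continuous_on {0..T} z" for T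
      by (rule uniform_limit_theorem[OF _ u])
        (auto intro!: always_eventually continuous_intros continuous_on_subset[OF picard_cont])
    then have "continuous (at t within {0..t+1}) z" if "t \<ge> 0" for t
      using that by (simp add: continuous_on_eq_continuous_within)
    moreover have "at t within {0..t+1} = at t within {0..}" for t :: real
      by (rule at_within_nhd[of _ "{..<t+1}"]) auto
    ultimately show ?thesis by (simp add: continuous_on_eq_continuous_within)
  qed
  fix t :: real assume t: "t \<ge> 0"
  have "compact (q ` {0..t})" by (auto intro!: compact_continuous_image continuous_on_subset[OF q])
  then obtain Q where Q: "Q > 0" "\<And>s. s \<in> {0..t} \<Longrightarrow> \<bar>q s\<bar> \<le> Q"
    by (metis bounded_pos compact_imp_bounded imageI real_norm_def)
  define S where "S n s = (\<Sum>i<n. picard i s)" for n s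
  have Sc: "continuous_on {0..} (S n)" for n
    unfolding S_def by (intro continuous_intros picard_cont)
  have "(\<lambda>n. integral_from_0 (integral_from_0 (\<lambda>s. q s * S n s)) t) \<longlonglongrightarrow> integral_from_0 (integral_from_0 (\<lambda>s. q s * z s)) t"
    unfolding tendsto_iff
  proof (intro allI impI)
    fix e :: real assume e: "e > 0"
    \<comment> \<open>Chosen so that the weight at time \<open>t\<close> cancels; the factor 1/2 of
      the operator then leaves \<open>e / 2\<close>, strictly below \<open>e\<close>.\<close>
    define d where "d = e / exp ((2*Q+1) * t)"
    have d: "d > 0" using e by (simp add: d_def)
    have "\<forall>\<^sub>F n in sequentially. \<forall>s\<in>{0..t}. dist (S n s) (z s) < d"
      using uniform_limitD[OF u d] unfolding S_def .
    then show "\<forall>\<^sub>F n in sequentially. dist (integral_from_0 (integral_from_0 (\<lambda>s. q s * S n s)) t) (integral_from_0 (integral_from_0 (\<lambda>s. q s * z s)) t) < e"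
    proof eventually_elim
      case (elim n)
      have c: "continuous_on {0..} (\<lambda>s. q s * S n s)" "continuous_on {0..} (\<lambda>s. q s * z s)"
        by (intro continuous_intros q Sc zc)+
      have "integral_from_0 (\<lambda>s. q s * (S n s - z s)) = (\<lambda>s. integral_from_0 (\<lambda>s. q s * S n s) s - integral_from_0 (\<lambda>s. q s * z s) s)"
        by (rule ext) (simp add: integral_from_0_diff[OF c] right_diff_distrib)
      then have "integral_from_0 (integral_from_0 (\<lambda>s. q s * S n s)) t - integral_from_0 (integral_from_0 (\<lambda>s. q s * z s)) t = integral_from_0 (integral_from_0 (\<lambda>s. q s * (S n s - z s))) t"
        by (simp add: integral_from_0_diff[OF integral_from_0_cont[OF c(1)] integral_from_0_cont[OF c(2)]])
      moreover have "\<bar>integral_from_0 (integral_from_0 (\<lambda>s. q s * (S n s - z s))) t\<bar> \<le> d / 2 * exp ((2*Q+1) * t)"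
      proof (rule integral_from_0_twice_bound)
        show "continuous_on {0..} (\<lambda>s. S n s - z s)" by (intro continuous_intros Sc zc)
        fix s assume s: "s \<in> {0..t}"
        have "\<bar>S n s - z s\<bar> \<le> d" using elim s by (auto simp: dist_real_def intro: less_imp_le)
        also have "d \<le> d * exp ((2*Q+1) * s)" using d s Q by simp
        finally show "\<bar>S n s - z s\<bar> \<le> d * exp ((2*Q+1) * s)" .
      qed (use t Q in auto)
      moreover have "d / 2 * exp ((2*Q+1) * t) = e / 2" by (simp add: d_def)
      ultimately show ?case using e by (simp add: dist_real_def)
    qed
  qed
  then have "(\<lambda>n. z0 t + integral_from_0 (integral_from_0 (\<lambda>s. q s * S n s)) t) \<longlonglongrightarrow> z0 t + integral_from_0 (integral_from_0 (\<lambda>s. q s * z s)) t"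
    by (intro tendsto_intros)
  then have "(\<lambda>n. S (Suc n) t) \<longlonglongrightarrow> z0 t + integral_from_0 (integral_from_0 (\<lambda>s. q s * z s)) t"
    using picard_sum unfolding S_def by simp
  moreover have "(\<lambda>n. S n t) \<longlonglongrightarrow> z t"
    using tendsto_uniform_limitI[OF u[of t], of t] t unfolding S_def by simp
  ultimately show "z t = z0 t + integral_from_0 (integral_from_0 (\<lambda>s. q s * z s)) t"
    using LIMSEQ_unique LIMSEQ_Suc by blast
qed

end

lemma linear_ode_exists:
  assumes q: "continuous_on {0..} q" and g: "continuous_on {0..} g"
  obtains z v where "z 0 = a" "v 0 = b"
    "\<And>t. t \<ge> 0 \<Longrightarrow> (z has_real_derivative v t) (at t within {0..})"
    "\<And>t. t \<ge> 0 \<Longrightarrow> (v has_real_derivative q t * z t + g t) (at t within {0..})"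
proof -
  \<comment> \<open>This is the solution for \<open>q = 0\<close>; the coefficient is added by the
    fixpoint equation.\<close>
  define z0 where "z0 t = a + b * t + integral_from_0 (integral_from_0 g) t" for t
  have "continuous_on {0..} z0" unfolding z0_def by (intro continuous_intros integral_from_0_cont g)
  from picard_fixpoint[OF q this] obtain z where
    z: "continuous_on {0..} z" "\<And>t. t \<ge> 0 \<Longrightarrow> z t = z0 t + integral_from_0 (integral_from_0 (\<lambda>s. q s * z s)) t" by blast
  have qz: "continuous_on {0..} (\<lambda>s. q s * z s)" by (intro continuous_intros q z)
  have i0: "integral_from_0 f 0 = 0" for f by (simp add: integral_from_0_def)
  define v where "v t = b + integral_from_0 g t + integral_from_0 (\<lambda>s. q s * z s) t" for t
  show thesis
  proof
    show "z 0 = a" "v 0 = b" using z(2)[of 0] by (simp_all add: z0_def i0 v_def)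
    fix t :: real assume t: "t \<ge> 0"
    show "(v has_real_derivative q t * z t + g t) (at t within {0..})"
      unfolding v_def by (auto intro!: derivative_eq_intros integral_from_0_DERIV g qz t)
    have "((\<lambda>t. z0 t + integral_from_0 (integral_from_0 (\<lambda>s. q s * z s)) t) has_real_derivative v t) (at t within {0..})"
      unfolding v_def z0_def by (auto intro!: derivative_eq_intros integral_from_0_DERIV integral_from_0_cont g qz t)
    then show "(z has_real_derivative v t) (at t within {0..})"
      by (rule has_field_derivative_transform_within[of _ _ _ _ 1]) (use t z(2) in auto)
  qed
qed

section \<open>Dependence on a parameter\<close>

text \<open>Initial data are left out, and read off as \<open>z 0\<close> and \<open>v 0\<close>, so
  that their regularity in \<open>x\<close> can be assumed separately.\<close>

definition linear_ode where
  "linear_ode q g z v \<longleftrightarrow> (\<forall>t\<ge>0. \<forall>x::real. ((\<lambda>t. z t x) has_real_derivative v t x) (at t within {0..})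
     \<and> ((\<lambda>t. v t x) has_real_derivative q t x * z t x + g t x) (at t within {0..}))"

lemma linear_odeD:
  assumes "linear_ode q g z v" "t \<ge> 0"
  shows "((\<lambda>t. z t x) has_real_derivative v t x) (at t within {0..})"
    "((\<lambda>t. v t x) has_real_derivative q t x * z t x + g t x) (at t within {0..})"
  using assms by (auto simp: linear_ode_def)

lemma linear_ode_time_cont:
  assumes "linear_ode q g z v"
  shows "continuous_on {0..} (\<lambda>t. z t x)" "continuous_on {0..} (\<lambda>t. v t x)"
  by (rule DERIV_continuous_on, rule linear_odeD[OF assms], simp)+

lemma time_bound:
  fixes f :: "real \<Rightarrow> real"
  assumes "continuous_on {0..} f"
  obtains C where "C > 0" "\<And>t. t \<in> {0..T} \<Longrightarrow> \<bar>f t\<bar> \<le> C"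
proof -
  have "compact (f ` {0..T})" by (auto intro!: compact_continuous_image continuous_on_subset[OF assms])
  then show thesis using that by (metis bounded_pos compact_imp_bounded imageI real_norm_def)
qed

text \<open>The difference of the solutions at \<open>x\<close> and \<open>x0\<close> solves the
  equation with the coefficient at \<open>x\<close> and forcing
  \<open>(q t x - q t x0) * z t x0 + (g t x - g t x0)\<close>. Only the solution at the fixed
  \<open>x0\<close> enters the forcing, and it is bounded by continuity in time; no bound near
  \<open>x0\<close> is presupposed.\<close>

lemma linear_ode_equicont:
  assumes ode: "linear_ode q g z v" and q: "jointly_cont q" and g: "jointly_cont g"
    and z0: "continuous_on UNIV (z 0)" and v0: "continuous_on UNIV (v 0)"
    and e: "\<epsilon> > 0" and T: "T \<ge> 0"
  obtains d where "d > 0" "\<And>t x. t \<in> {0..T} \<Longrightarrow> \<bar>x - x0\<bar> < d \<Longrightarrow> \<bar>z t x - z t x0\<bar> < \<epsilon> \<and> \<bar>v t x - v t x0\<bar> < \<epsilon>"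
proof -
  obtain Q where Q: "Q > 0" "\<And>t x. t \<in> {0..T} \<Longrightarrow> x \<in> {x0-1..x0+1} \<Longrightarrow> \<bar>q t x\<bar> \<le> Q"
    using jointly_cont_bound[OF q] by metis
  obtain Z where Z: "Z > 0" "\<And>t. t \<in> {0..T} \<Longrightarrow> \<bar>z t x0\<bar> \<le> Z"
    using time_bound[OF linear_ode_time_cont(1)[OF ode]] by metis
  define C where "C = stability_const Q T"
  have C: "C \<ge> 0" using T by (simp add: C_def stability_const_nonneg)
  \<comment> \<open>The summand 1 turns the final bound \<open>C * \<eta>\<close> into a strict
    one.\<close>
  define \<eta> where "\<eta> = \<epsilon> / (C + 1)"
  have eta: "\<eta> > 0" "C * \<eta> < \<epsilon>" using C e by (auto simp: \<eta>_def field_simps)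
  obtain d1 where d1: "d1 > 0" "\<And>s t x y. s \<in> {0..T} \<Longrightarrow> t \<in> {0..T} \<Longrightarrow> x \<in> {x0-1..x0+1} \<Longrightarrow> y \<in> {x0-1..x0+1} \<Longrightarrow>
    \<bar>s - t\<bar> < d1 \<Longrightarrow> \<bar>x - y\<bar> < d1 \<Longrightarrow> \<bar>q s x - q t y\<bar> < \<eta> / (2 * Z)"
    using jointly_cont_uniform[OF q, of "\<eta> / (2 * Z)"] eta Z by (metis divide_pos_pos mult_pos_pos zero_less_numeral)
  obtain d2 where d2: "d2 > 0" "\<And>s t x y. s \<in> {0..T} \<Longrightarrow> t \<in> {0..T} \<Longrightarrow> x \<in> {x0-1..x0+1} \<Longrightarrow> y \<in> {x0-1..x0+1} \<Longrightarrow>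
    \<bar>s - t\<bar> < d2 \<Longrightarrow> \<bar>x - y\<bar> < d2 \<Longrightarrow> \<bar>g s x - g t y\<bar> < \<eta> / 2"
    using jointly_cont_uniform[OF g, of "\<eta> / 2"] eta by (metis half_gt_zero)
  obtain d3 where d3: "d3 > 0" "\<And>x. \<bar>x - x0\<bar> < d3 \<Longrightarrow> \<bar>z 0 x - z 0 x0\<bar> < \<eta>"
    using z0 eta(1) unfolding continuous_on_iff dist_real_def by (metis UNIV_I)
  obtain d4 where d4: "d4 > 0" "\<And>x. \<bar>x - x0\<bar> < d4 \<Longrightarrow> \<bar>v 0 x - v 0 x0\<bar> < \<eta>"
    using v0 eta(1) unfolding continuous_on_iff dist_real_def by (metis UNIV_I)
  show thesis
  proof
    show "min (min d1 d2) (min (min d3 d4) 1) > 0" using d1 d2 d3 d4 by simp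
    fix t x assume t: "t \<in> {0..T}" and x: "\<bar>x - x0\<bar> < min (min d1 d2) (min (min d3 d4) 1)"
    have x1: "x \<in> {x0-1..x0+1}" "x0 \<in> {x0-1..x0+1}" using x by auto
    define h where "h t = (q t x - q t x0) * z t x0 + (g t x - g t x0)" for t
    have "\<bar>z t x - z t x0\<bar> \<le> stability_const Q T * \<eta> \<and> \<bar>v t x - v t x0\<bar> \<le> stability_const Q T * \<eta>"
    proof (rule linear_ode_stability[where e = "\<lambda>t. z t x - z t x0" and v = "\<lambda>t. v t x - v t x0" and q = "\<lambda>t. q t x" and h = h])
      fix s :: real
      show "((\<lambda>t. z t x - z t x0) has_real_derivative v s x - v s x0) (at s within {0..})" if "s \<ge> 0"
        using that by (intro derivative_intros linear_odeD[OF ode])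
      show "((\<lambda>t. v t x - v t x0) has_real_derivative q s x * (z s x - z s x0) + h s) (at s within {0..})"
        if s: "s \<ge> 0"
        by (rule DERIV_cong[OF DERIV_diff[OF linear_odeD(2)[OF ode s, of x] linear_odeD(2)[OF ode s, of x0]]])
          (simp add: h_def algebra_simps)
      show "\<bar>q s x\<bar> \<le> Q" if s: "s \<in> {0..T}" using Q s x1 by auto
      show "\<bar>h s\<bar> \<le> \<eta>" if s: "s \<in> {0..T}"
      proof -
      have 1: "\<bar>q s x - q s x0\<bar> < \<eta> / (2 * Z)" "\<bar>g s x - g s x0\<bar> < \<eta> / 2"
        using d1 d2 s x1 x by auto
      have "\<bar>h s\<bar> \<le> \<bar>q s x - q s x0\<bar> * \<bar>z s x0\<bar> + \<bar>g s x - g s x0\<bar>"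
        unfolding h_def by (rule order_trans[OF abs_triangle_ineq]) (simp add: abs_mult)
      also have "\<dots> \<le> \<eta> / (2 * Z) * Z + \<eta> / 2"
        using 1 Z(1) Z(2)[OF s] by (intro add_mono mult_mono) auto
      also have "\<dots> = \<eta>" using Z(1) by simp
      finally show ?thesis .
      qed
    qed (use d3(2)[of x] d4(2)[of x] x t in auto)
    then show "\<bar>z t x - z t x0\<bar> < \<epsilon> \<and> \<bar>v t x - v t x0\<bar> < \<epsilon>"
      using eta(2) unfolding C_def by auto
  qed
qed

text \<open>Go from \<open>(t, x)\<close> to \<open>(t0, x0)\<close> through \<open>(t, x0)\<close>;
  the first move is uniform in \<open>t\<close>.\<close>

lemma jointly_contI:
  assumes time: "\<And>x. continuous_on {0..} (\<lambda>t. f t x)"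
    and equi: "\<And>T x0 e. T \<ge> 0 \<Longrightarrow> e > 0 \<Longrightarrow> \<exists>d>0. \<forall>t\<in>{0..T}. \<forall>x. \<bar>x - x0\<bar> < d \<longrightarrow> \<bar>f t x - f t x0\<bar> < e"
  shows "jointly_cont f"
  unfolding jointly_cont_def continuous_on_iff
proof (intro ballI allI impI)
  fix w :: "real \<times> real" and e :: real assume "w \<in> {0..} \<times> UNIV" and e: "e > 0"
  then obtain t0 x0 where w: "w = (t0, x0)" "t0 \<ge> 0" by auto
  obtain d1 where d1: "d1 > 0" "\<And>t x. t \<in> {0..t0+1} \<Longrightarrow> \<bar>x - x0\<bar> < d1 \<Longrightarrow> \<bar>f t x - f t x0\<bar> < e / 2"
    using equi[of "t0+1" "e/2" x0] w e by auto
  obtain d2 where d2: "d2 > 0" "\<And>t. t \<ge> 0 \<Longrightarrow> \<bar>t - t0\<bar> < d2 \<Longrightarrow> \<bar>f t x0 - f t0 x0\<bar> < e / 2"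
    using time[of x0] w e unfolding continuous_on_iff dist_real_def by (metis atLeast_iff half_gt_zero)
  show "\<exists>d>0. \<forall>w'\<in>{0..} \<times> UNIV. dist w' w < d \<longrightarrow>
    dist (case w' of (t, x) \<Rightarrow> f t x) (case w of (t, x) \<Rightarrow> f t x) < e"
  proof (intro exI[of _ "min (min d1 d2) 1"] conjI ballI impI)
    fix w' :: "real \<times> real" assume w': "w' \<in> {0..} \<times> UNIV" "dist w' w < min (min d1 d2) 1"
    obtain t x where tx: "w' = (t, x)" "t \<ge> 0" using w' by auto
    have "\<bar>t - t0\<bar> < min (min d1 d2) 1" "\<bar>x - x0\<bar> < min (min d1 d2) 1"
      using dist_fst_le[of w' w] dist_snd_le[of w' w] w'(2) w tx by (auto simp: dist_real_def)
    then have "\<bar>f t x - f t x0\<bar> < e / 2" "\<bar>f t x0 - f t0 x0\<bar> < e / 2" using d1(2)[of t x] d2(2)[of t] tx by auto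
    then show "dist (case w' of (t, x) \<Rightarrow> f t x) (case w of (t, x) \<Rightarrow> f t x) < e"
      unfolding w tx dist_real_def prod.case by linarith
  qed (use d1 d2 in auto)
qed

lemma linear_ode_jointly_cont:
  assumes "linear_ode q g z v" "jointly_cont q" "jointly_cont g" "continuous_on UNIV (z 0)" "continuous_on UNIV (v 0)"
  shows "jointly_cont z" "jointly_cont v"
proof -
  have *: "\<exists>d>0. \<forall>t\<in>{0..T}. \<forall>x. \<bar>x - x0\<bar> < d \<longrightarrow> \<bar>z t x - z t x0\<bar> < e \<and> \<bar>v t x - v t x0\<bar> < e"
    if "T \<ge> 0" "e > 0" for T x0 e
    using linear_ode_equicont[OF assms that(2,1), of x0] by metis
  show "jointly_cont z" "jointly_cont v"
    by (rule jointly_contI; use linear_ode_time_cont[OF assms(1)] * in meson)+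
qed

text \<open>By the mean value theorem the first-order remainder is \<open>(x - x0)\<close> times an
  increment of \<open>f'\<close>, and uniform continuity of \<open>f'\<close> makes it small
  simultaneously for all times up to \<open>T\<close>.\<close>

lemma jointly_cont_deriv_uniform:
  assumes f: "\<And>t x. t \<ge> 0 \<Longrightarrow> (f t has_real_derivative f' t x) (at x)" and "jointly_cont f'" and "\<epsilon> > 0"
  obtains d where "d > 0" "\<And>t x. t \<in> {0..T} \<Longrightarrow> \<bar>x - x0\<bar> < d \<Longrightarrow> \<bar>f t x - f t x0 - (x - x0) * f' t x0\<bar> \<le> \<epsilon> * \<bar>x - x0\<bar>"
proof -
  obtain d where d: "d > 0" "\<And>s t x y. s \<in> {0..T} \<Longrightarrow> t \<in> {0..T} \<Longrightarrow> x \<in> {x0-1..x0+1} \<Longrightarrow> y \<in> {x0-1..x0+1} \<Longrightarrow>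
    \<bar>s - t\<bar> < d \<Longrightarrow> \<bar>x - y\<bar> < d \<Longrightarrow> \<bar>f' s x - f' t y\<bar> < \<epsilon>"
    using jointly_cont_uniform[OF assms(2,3)] by metis
  show thesis
  proof
    show "min d 1 > 0" using d by simp
    fix t x assume t: "t \<in> {0..T}" and x: "\<bar>x - x0\<bar> < min d 1"
    obtain \<xi> where \<xi>: "\<bar>\<xi> - x0\<bar> \<le> \<bar>x - x0\<bar>" "f t x - f t x0 = (x - x0) * f' t \<xi>"
    proof (cases x x0 rule: linorder_cases)
      case less
      then obtain z where "z > x" "z < x0" "f t x0 - f t x = (x0 - x) * f' t z"
        using MVT2[of x x0 "f t" "f' t"] f t by auto
      then show ?thesis by (intro that[of z]) (auto simp: algebra_simps)
    next
      case greater
      then obtain z where "z < x" "z > x0" "f t x - f t x0 = (x - x0) * f' t z"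
        using MVT2[of x0 x "f t" "f' t"] f t by auto
      then show ?thesis by (intro that[of z]) auto
    qed (use that[of x] in auto)
    have "\<bar>\<xi> - x0\<bar> < 1" using \<xi>(1) x by linarith
    then have "\<xi> \<in> {x0-1..x0+1}" by (simp add: abs_less_iff)
    then have "\<bar>f' t \<xi> - f' t x0\<bar> \<le> \<epsilon>" using d(2)[of t t \<xi> x0] \<xi>(1) x t d(1) by auto
    then have "\<bar>x - x0\<bar> * \<bar>f' t \<xi> - f' t x0\<bar> \<le> \<epsilon> * \<bar>x - x0\<bar>"
      by (subst mult.commute) (rule mult_right_mono, simp_all)
    moreover have "f t x - f t x0 - (x - x0) * f' t x0 = (x - x0) * (f' t \<xi> - f' t x0)"
      using \<xi>(2) by (simp add: algebra_simps)
    ultimately show "\<bar>f t x - f t x0 - (x - x0) * f' t x0\<bar> \<le> \<epsilon> * \<bar>x - x0\<bar>" by (simp add: abs_mult)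
  qed
qed

lemma DERIV_epsI:
  assumes "\<And>e. e > 0 \<Longrightarrow> \<exists>d>0. \<forall>x. \<bar>x - x0\<bar> < d \<longrightarrow> \<bar>f x - f x0 - (x - x0) * D\<bar> \<le> e * \<bar>x - x0\<bar>"
  shows "(f has_real_derivative D) (at x0)"
  unfolding has_field_derivative_def has_derivative_at_alt
  using assms by (auto simp: bounded_linear_mult_right mult.commute)

text \<open>The pair \<open>w\<close>, \<open>u\<close> solves the formally differentiated equation.
  The remainder \<open>z t x - z t x0 - (x - x0) * w t x0\<close> again solves the linear equation,
  with a forcing that is small compared with \<open>\<bar>x - x0\<bar>\<close> uniformly in time, so
  the stability estimate applies.\<close>

lemma linear_ode_DERIV:
  assumes ode: "linear_ode q g z v" and z0: "continuous_on UNIV (z 0)" 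
    and q: "jointly_cont q" "\<And>t x. t \<ge> 0 \<Longrightarrow> (q t has_real_derivative q' t x) (at x)" "jointly_cont q'"
    and g: "\<And>t x. t \<ge> 0 \<Longrightarrow> (g t has_real_derivative g' t x) (at x)" "jointly_cont g'"
    and ode': "linear_ode q (\<lambda>t x. q' t x * z t x + g' t x) w u"
    and z: "\<And>x. (z 0 has_real_derivative w 0 x) (at x)" "continuous_on UNIV (w 0)"
    and v: "\<And>x. (v 0 has_real_derivative u 0 x) (at x)" "continuous_on UNIV (u 0)"
    and T: "T \<ge> 0"
  shows "(z T has_real_derivative w T x0) (at x0)" "(v T has_real_derivative u T x0) (at x0)"
proof -
  have main: "\<exists>d>0. \<forall>x. \<bar>x - x0\<bar> < d \<longrightarrow> \<bar>z T x - z T x0 - (x - x0) * w T x0\<bar> \<le> \<epsilon> * \<bar>x - x0\<bar>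
      \<and> \<bar>v T x - v T x0 - (x - x0) * u T x0\<bar> \<le> \<epsilon> * \<bar>x - x0\<bar>" if \<epsilon>: "\<epsilon> > 0" for \<epsilon>
  proof -
    obtain Q where Q: "Q > 0" "\<And>t x. t \<in> {0..T} \<Longrightarrow> x \<in> {x0-1..x0+1} \<Longrightarrow> \<bar>q t x\<bar> \<le> Q"
      using jointly_cont_bound[OF q(1)] by metis
    obtain Z where Z: "Z > 0" "\<And>t. t \<in> {0..T} \<Longrightarrow> \<bar>z t x0\<bar> \<le> Z"
      using time_bound[OF linear_ode_time_cont(1)[OF ode]] by metis
    obtain W where W: "W > 0" "\<And>t. t \<in> {0..T} \<Longrightarrow> \<bar>w t x0\<bar> \<le> W"
      using time_bound[OF linear_ode_time_cont(1)[OF ode']] by metis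
    define C where "C = stability_const Q T"
    have C: "C \<ge> 0" using T by (simp add: C_def stability_const_nonneg)
    define \<eta> where "\<eta> = \<epsilon> / (C + 1)"
    have eta: "\<eta> > 0" "C * \<eta> \<le> \<epsilon>" using C \<epsilon> by (auto simp: \<eta>_def field_simps)
    \<comment> \<open>One third for each summand of the forcing \<open>h\<close> below, divided by
      the bound of the solution factor that multiplies it.\<close>
    have "\<eta> / (3 * W) > 0" "\<eta> / (3 * Z) > 0" "\<eta> / 3 > 0" using eta W Z by auto
    note pos = this
    obtain d0 where d0: "d0 > 0" "\<And>s t x y. s \<in> {0..T} \<Longrightarrow> t \<in> {0..T} \<Longrightarrow> x \<in> {x0-1..x0+1} \<Longrightarrow> y \<in> {x0-1..x0+1} \<Longrightarrow>
      \<bar>s - t\<bar> < d0 \<Longrightarrow> \<bar>x - y\<bar> < d0 \<Longrightarrow> \<bar>q s x - q t y\<bar> < \<eta> / (3 * W)"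
      using jointly_cont_uniform[OF q(1) pos(1)] by metis
    obtain d1 where d1: "d1 > 0" "\<And>t x. t \<in> {0..T} \<Longrightarrow> \<bar>x - x0\<bar> < d1 \<Longrightarrow> \<bar>q t x - q t x0 - (x - x0) * q' t x0\<bar> \<le> \<eta> / (3 * Z) * \<bar>x - x0\<bar>"
      using jointly_cont_deriv_uniform[OF q(2,3) pos(2)] by metis
    obtain d2 where d2: "d2 > 0" "\<And>t x. t \<in> {0..T} \<Longrightarrow> \<bar>x - x0\<bar> < d2 \<Longrightarrow> \<bar>g t x - g t x0 - (x - x0) * g' t x0\<bar> \<le> \<eta> / 3 * \<bar>x - x0\<bar>"
      using jointly_cont_deriv_uniform[OF g pos(3)] by metis
    \<comment> \<open>The initial values are treated as time-independent families, for which the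
      time bound 0 suffices.\<close>
    obtain d3 where d3: "d3 > 0" "\<And>x. \<bar>x - x0\<bar> < d3 \<Longrightarrow> \<bar>z 0 x - z 0 x0 - (x - x0) * w 0 x0\<bar> \<le> \<eta> * \<bar>x - x0\<bar>"
      by (rule jointly_cont_deriv_uniform[of "\<lambda>_. z 0" "\<lambda>_. w 0" \<eta> 0 x0]) (use z jointly_cont_of_space[OF z(2)] eta(1) in auto)
    obtain d4 where d4: "d4 > 0" "\<And>x. \<bar>x - x0\<bar> < d4 \<Longrightarrow> \<bar>v 0 x - v 0 x0 - (x - x0) * u 0 x0\<bar> \<le> \<eta> * \<bar>x - x0\<bar>"
      by (rule jointly_cont_deriv_uniform[of "\<lambda>_. v 0" "\<lambda>_. u 0" \<eta> 0 x0]) (use v jointly_cont_of_space[OF v(2)] eta(1) in auto)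
    show ?thesis
    proof (intro exI[of _ "min (min (min d0 d1) d2) (min (min d3 d4) 1)"] conjI allI impI)
      fix x assume x: "\<bar>x - x0\<bar> < min (min (min d0 d1) d2) (min (min d3 d4) 1)"
      have x1: "x \<in> {x0-1..x0+1}" "x0 \<in> {x0-1..x0+1}" using x by auto
      let ?\<delta> = "\<bar>x - x0\<bar>"
      define h where "h t = (q t x - q t x0 - (x - x0) * q' t x0) * z t x0
        + (x - x0) * (q t x - q t x0) * w t x0 + (g t x - g t x0 - (x - x0) * g' t x0)" for t
      have "\<bar>z T x - z T x0 - (x - x0) * w T x0\<bar> \<le> stability_const Q T * (\<eta> * ?\<delta>) \<and>
        \<bar>v T x - v T x0 - (x - x0) * u T x0\<bar> \<le> stability_const Q T * (\<eta> * ?\<delta>)"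
      proof (rule linear_ode_stability[where e = "\<lambda>t. z t x - z t x0 - (x - x0) * w t x0" and 
            v = "\<lambda>t. v t x - v t x0 - (x - x0) * u t x0" and q = "\<lambda>t. q t x" and h = h])
        fix s :: real
        show "((\<lambda>t. z t x - z t x0 - (x - x0) * w t x0) has_real_derivative v s x - v s x0 - (x - x0) * u s x0) (at s within {0..})" 
          if "s \<ge> 0"
          using that by (auto intro!: derivative_eq_intros linear_odeD[OF ode] linear_odeD[OF ode'])
        show "((\<lambda>t. v t x - v t x0 - (x - x0) * u t x0) has_real_derivative q s x * (z s x - z s x0 - (x - x0) * w s x0) + h s) (at s within {0..})"
          if s: "s \<ge> 0"
          by (rule DERIV_cong[OF DERIV_diff[OF DERIV_diff[OF linear_odeD(2)[OF ode s, of x] linear_odeD(2)[OF ode s, of x0]]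
             DERIV_cmult[OF linear_odeD(2)[OF ode' s, of x0]]]])
            (simp add: h_def algebra_simps)
        show "\<bar>q s x\<bar> \<le> Q" if s: "s \<in> {0..T}" using Q s x1 by auto
        show "\<bar>h s\<bar> \<le> \<eta> * ?\<delta>" if s: "s \<in> {0..T}"
        proof -
          have 1: "\<bar>q s x - q s x0\<bar> \<le> \<eta> / (3 * W)" "\<bar>g s x - g s x0 - (x - x0) * g' s x0\<bar> \<le> \<eta> / 3 * ?\<delta>"
              "\<bar>q s x - q s x0 - (x - x0) * q' s x0\<bar> \<le> \<eta> / (3 * Z) * ?\<delta>"
            using d0(1) d0(2)[OF s s x1] d1(2)[OF s] d2(2)[OF s] x by auto
          have "\<bar>h s\<bar> \<le> \<bar>q s x - q s x0 - (x - x0) * q' s x0\<bar> * \<bar>z s x0\<bar> + ?\<delta> * \<bar>q s x - q s x0\<bar> * \<bar>w s x0\<bar>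
            + \<bar>g s x - g s x0 - (x - x0) * g' s x0\<bar>"
            unfolding h_def abs_mult[symmetric] by linarith
          also have "\<dots> \<le> \<eta> / (3 * Z) * ?\<delta> * Z + ?\<delta> * (\<eta> / (3 * W)) * W + \<eta> / 3 * ?\<delta>"
            using 1 Z(1) Z(2)[OF s] W(1) W(2)[OF s] pos by (intro add_mono mult_mono) auto
          also have "\<dots> = \<eta> * ?\<delta>" using Z(1) W(1) by (simp add: field_simps)
          finally show ?thesis .
        qed
      qed (use d3(2)[of x] d4(2)[of x] x T in auto)
      moreover have "stability_const Q T * (\<eta> * ?\<delta>) \<le> \<epsilon> * ?\<delta>"
        using mult_right_mono[OF eta(2), of ?\<delta>] by (simp add: C_def mult.assoc)
      ultimately show "\<bar>z T x - z T x0 - (x - x0) * w T x0\<bar> \<le> \<epsilon> * ?\<delta>"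
        "\<bar>v T x - v T x0 - (x - x0) * u T x0\<bar> \<le> \<epsilon> * ?\<delta>" by linarith+
    qed (use d0 d1 d2 d3 d4 in auto)
  qed
  show "(z T has_real_derivative w T x0) (at x0)" "(v T has_real_derivative u T x0) (at x0)"
    by (rule DERIV_epsI, use main in meson)+
qed

text \<open>The solutions are chosen independently for each \<open>x\<close>; their regularity in
  \<open>x\<close> is recovered afterwards from the stability estimate.\<close>

lemma linear_ode_family_exists:
  assumes "jointly_cont q" "jointly_cont g"
  obtains z v where "linear_ode q g z v" "z 0 = a" "v 0 = b"
proof -
  have "\<exists>zv. fst zv 0 = a x \<and> snd zv 0 = b x \<and> (\<forall>t\<ge>0. (fst zv has_real_derivative snd zv t) (at t within {0..}))
    \<and> (\<forall>t\<ge>0. (snd zv has_real_derivative q t x * fst zv t + g t x) (at t within {0..}))" for x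
    using linear_ode_exists[OF jointly_cont_time[OF assms(1), of x] jointly_cont_time[OF assms(2), of x], of "a x" "b x"]
    by (metis fst_conv snd_conv)
  then obtain F where F: "\<And>x. fst (F x) 0 = a x \<and> snd (F x) 0 = b x \<and> (\<forall>t\<ge>0. (fst (F x) has_real_derivative snd (F x) t) (at t within {0..}))
    \<and> (\<forall>t\<ge>0. (snd (F x) has_real_derivative q t x * fst (F x) t + g t x) (at t within {0..}))"
    by metis
  show thesis
    by (rule that[of "\<lambda>t x. fst (F x) t" "\<lambda>t x. snd (F x) t"]) (use F in \<open>auto simp: linear_ode_def\<close>)
qed

text \<open>The \<open>x\<close>-derivative solves the same equation with forcing
  \<open>q' z + g'\<close>, hence the generalisation over \<open>g\<close>. The induction hypothesis
  is used twice: for \<open>z\<close>, so that this forcing is smooth enough, and then for the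
  derivative.\<close>

lemma linear_ode_jointly_Ck:
  assumes "jointly_Ck j q" "jointly_Ck j g" "jointly_Ck j (\<lambda>_. z 0)" "jointly_Ck j (\<lambda>_. v 0)" "linear_ode q g z v"
  shows "jointly_Ck j z \<and> jointly_Ck j v"
  using assms
proof (induction j arbitrary: g z v)
  case 0
  then show ?case using linear_ode_jointly_cont[of q g z v] jointly_cont_slice[of "\<lambda>_. z 0" 0] jointly_cont_slice[of "\<lambda>_. v 0" 0] by auto
next
  case (Suc j)
  note ode = Suc.prems(5)
  obtain q' where q': "\<And>t x. t \<ge> 0 \<Longrightarrow> (q t has_real_derivative q' t x) (at x)" "jointly_Ck j q'"
    using jointly_Ck_SucE[OF Suc.prems(1)] by blast
  obtain g' where g': "\<And>t x. t \<ge> 0 \<Longrightarrow> (g t has_real_derivative g' t x) (at x)" "jointly_Ck j g'"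
    using jointly_Ck_SucE[OF Suc.prems(2)] by blast
  obtain a where a: "\<And>t x. t \<ge> 0 \<Longrightarrow> (z 0 has_real_derivative a t x) (at x)" "jointly_Ck j a"
    using jointly_Ck_SucE[OF Suc.prems(3)] by blast
  obtain b where b: "\<And>t x. t \<ge> 0 \<Longrightarrow> (v 0 has_real_derivative b t x) (at x)" "jointly_Ck j b"
    using jointly_Ck_SucE[OF Suc.prems(4)] by blast
  \<comment> \<open>The derivative families of the initial data come with a spurious time argument,
    which uniqueness of derivatives removes.\<close>
  have const: "a t x = a 0 x" "b t x = b 0 x" if "t \<ge> 0" for t x
    using DERIV_unique[OF a(1)[OF that] a(1)[of 0]] DERIV_unique[OF b(1)[OF that] b(1)[of 0]] by auto
  have ab: "jointly_Ck j (\<lambda>_. a 0)" "jointly_Ck j (\<lambda>_. b 0)"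
    using jointly_Ck_cong[of a "\<lambda>_. a 0" j, OF const(1)] jointly_Ck_cong[of b "\<lambda>_. b 0" j, OF const(2)] a(2) b(2) by simp_all
  note lower = Suc.prems(1-4)[THEN jointly_Ck_Suc_D]
  have zv: "jointly_Ck j z" "jointly_Ck j v" using Suc.IH[OF lower ode] by simp_all
  obtain w u where wu: "linear_ode q (\<lambda>t x. q' t x * z t x + g' t x) w u" "w 0 = a 0" "u 0 = b 0"
    using linear_ode_family_exists[OF jointly_Ck_jointly_cont[OF Suc.prems(1)] jointly_Ck_jointly_cont[OF jointly_Ck_add[OF jointly_Ck_mult[OF q'(2) zv(1)] g'(2)]]]
    by blast
  have wu': "jointly_Ck j w \<and> jointly_Ck j u"
  proof (rule Suc.IH[OF lower(1) _ _ _ wu(1)])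
    show "jointly_Ck j (\<lambda>t x. q' t x * z t x + g' t x)" by (intro jointly_Ck_add jointly_Ck_mult q' g' zv)
  qed (use wu ab in auto)
  have c: "continuous_on UNIV (z 0)" "continuous_on UNIV (w 0)" "continuous_on UNIV (u 0)"
    using jointly_cont_slice[OF jointly_Ck_jointly_cont[OF Suc.prems(3)], of 0] jointly_cont_slice[OF jointly_Ck_jointly_cont[OF ab(1)], of 0] jointly_cont_slice[OF jointly_Ck_jointly_cont[OF ab(2)], of 0] wu
    by auto
  have "(z t has_real_derivative w t x) (at x)" "(v t has_real_derivative u t x) (at x)" if "t \<ge> 0" for t x
    using linear_ode_DERIV[OF ode c(1) jointly_Ck_jointly_cont[OF Suc.prems(1)] q'(1) jointly_Ck_jointly_cont[OF q'(2)] g'(1) jointly_Ck_jointly_cont[OF g'(2)] wu(1) _ c(2) _ c(3) that]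
      a(1)[of 0] b(1)[of 0] wu(2,3) by simp_all
  then show ?case using wu' zv by (metis jointly_Ck_SucI jointly_Ck_jointly_cont)
qed

section \<open>Integration of periodic functions\<close>

text \<open>A vanishing primitive means vanishing integrals over all intervals, hence over all Borel
  sets, as intervals generate them; a function with that property is zero a.e.\<close>

lemma loc_integrable_AE_0:
  assumes f: "loc_integrable f" and 0: "\<And>x. primitive f x = 0"
  shows "AE x in lborel. f x = 0"
proof -
  \<comment> \<open>Truncation makes the function integrable on the whole line, as the passage to
    complements requires.\<close>
  have "AE x in lborel. indicator {-real n..real n} x *\<^sub>R f x = 0" for n
  proof (rule sigma_finite_measure.density_zero[OF lborel.sigma_finite_measure_axioms])
    let ?f = "\<lambda>x. indicator {-real n..real n} x *\<^sub>R f x"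
    show i: "integrable lborel ?f" using loc_integrableD[OF f] unfolding set_integrable_def .
    have s: "set_integrable lborel A ?f" if "A \<in> sets borel" for A
      unfolding set_integrable_def using integrable_mult_indicator[OF _ i, of A] that by simp
    have I: "(LINT x:{a..b}|lborel. ?f x) = 0" for a b
    proof -
      have "(LINT x:{a..b}|lborel. ?f x) = (LINT x:{max a (-real n)..min b (real n)}|lborel. f x)"
        unfolding set_lebesgue_integral_def
        by (intro Bochner_Integration.integral_cong) (auto split: split_indicator)
      also have "\<dots> = 0"
        using primitive_diff_Icc[OF f, of "max a (-real n)" "min b (real n)"] 0
        by (cases "max a (-real n) \<le> min b (real n)") (auto simp: set_lebesgue_integral_def)
      finally show ?thesis .
    qed
    have U: "(LINT x:UNIV|lborel. ?f x) = 0"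
    proof -
      have "(LINT x:UNIV|lborel. ?f x) = (LINT x:{-real n..real n}|lborel. ?f x)"
        unfolding set_lebesgue_integral_def
        by (intro Bochner_Integration.integral_cong) (auto split: split_indicator)
      then show ?thesis using I by simp
    qed
    fix A :: "real set" assume "A \<in> sets lborel"
    then have "A \<in> sets borel" by simp
    then show "(LINT x:A|lborel. ?f x) = 0"
    proof (induction rule: borel_set_induct)
      case (compl A)
      have "(LINT x:A \<union> -A|lborel. ?f x) = (LINT x:A|lborel. ?f x) + (LINT x:-A|lborel. ?f x)"
        using compl by (intro set_integral_Un s) auto
      then show ?case using U compl by simp
    next
      case (union F)
      have "(LINT x:(\<Union>i. F i)|lborel. ?f x) = (\<Sum>i. (LINT x:F i|lborel. ?f x))"
        using union by (intro lebesgue_integral_countable_add s) (auto simp: disjoint_family_on_def)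
      then show ?case using union by simp
    qed (use I in \<open>auto simp: set_lebesgue_integral_def[of _ "{}"]\<close>)
  qed
  then have "AE x in lborel. \<forall>n. indicator {-real n..real n} x *\<^sub>R f x = 0"
    by (subst AE_all_countable) blast
  then show ?thesis
  proof eventually_elim
    case (elim x)
    obtain n where "\<bar>x\<bar> \<le> real n" using real_arch_simple by blast
    then show ?case using elim[rule_format, of n] by (simp add: abs_le_iff)
  qed
qed

lemma periodic_set_integrable_shift:
  assumes p: "periodic1 p" and i: "set_integrable lborel {a..b} p"
  shows "set_integrable lborel {a+1..b+1} p" "set_integrable lborel {a-1..b-1} p"
proof -
  have p1: "p (x - 1) = p x" "p (x + 1) = p x" for x 
    using p[unfolded periodic1_def, rule_format, of "x - 1"] p[unfolded periodic1_def, rule_format, of x] by auto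
  let ?f = "\<lambda>x. indicator {a..b} x *\<^sub>R p x"
  have int: "integrable lborel ?f" using i by (simp add: set_integrable_def)
  have "(\<lambda>x. ?f (-1 + 1 * x)) = (\<lambda>x. indicator {a+1..b+1} x *\<^sub>R p x)"
    using p1 by (auto simp: fun_eq_iff split: split_indicator)
  then show "set_integrable lborel {a+1..b+1} p"
    using lborel_integrable_real_affine[OF int, of 1 "-1"] by (simp add: set_integrable_def)
  have *: "(\<lambda>x. ?f (1 + 1 * x)) = (\<lambda>x. indicator {a-1..b-1} x *\<^sub>R p x)"
    using p1 by (auto simp: fun_eq_iff add.commute split: split_indicator)
  then show "set_integrable lborel {a-1..b-1} p"
    using lborel_integrable_real_affine[OF int, of 1 "1"] by (simp add: set_integrable_def)
qed

lemma LINT_shift: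
  fixes p :: "real \<Rightarrow> real"
  shows "(LINT x:{a+1..b+1}|lborel. p x) = (LINT x:{a..b}|lborel. p (x + 1))"
proof -
  have "(\<lambda>x. indicator {a+1..b+1} (1 + 1 * x) *\<^sub>R p (1 + 1 * x)) = (\<lambda>x. indicator {a..b} x *\<^sub>R p (x + 1))"
    by (auto simp: fun_eq_iff add.commute split: split_indicator)
  then show ?thesis
    using lborel_integral_real_affine[of 1 "\<lambda>x. indicator {a+1..b+1} x *\<^sub>R p x" 1]
    by (simp add: set_lebesgue_integral_def)
qed

text \<open>Stated for arbitrary \<open>p\<close> because it is later applied to densities weighted
  with \<open>cosh\<close> and \<open>sinh\<close> of the arc length, which are not
  periodic.\<close>

lemma primitive_shift:
  assumes p: "loc_integrable p" and p1: "loc_integrable (\<lambda>x. p (x + 1))"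
  shows "primitive p (x + 1) = primitive p 1 + primitive (\<lambda>x. p (x + 1)) x"
proof (cases "0 \<le> x")
  case True
  then show ?thesis
    using primitive_diff_Icc[OF p1, of 0 x] primitive_diff_Icc[OF p, of 1 "x+1"] LINT_shift[of 0 x p] by simp
next
  case False
  then show ?thesis
    using primitive_diff_Icc[OF p1, of x 0] primitive_diff_Icc[OF p, of "x+1" 1] LINT_shift[of x 0 p] by simp
qed

text \<open>Translates of the unit interval tile the line; each induction step from
  \<open>{-real n..real n}\<close> adds one cell at either end.\<close>

lemma periodic_loc_integrable:
  assumes p: "periodic1 p" and i: "set_integrable lborel {0..1} p"
  shows "loc_integrable p"
proof -
  have up: "set_integrable lborel {real n..real n+1} p" for n
  proof (induction n)
    case (Suc n)
    then show ?case using periodic_set_integrable_shift(1)[OF p Suc] by (simp add: add.commute)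
  qed (use i in simp)
  have down: "set_integrable lborel {-real n..1-real n} p" for n
  proof (induction n)
    case (Suc n)
    have eq: "-real (Suc n) = -real n - 1" "1 - real (Suc n) = 1 - real n - 1" by auto
    show ?case unfolding eq by (rule periodic_set_integrable_shift(2)[OF p Suc])
  qed (use i in simp)
  have sym: "set_integrable lborel {-real n..real n} p" for n
  proof (induction n)
    case (Suc n)
    have "{-real (Suc n)..real (Suc n)} = {-real (Suc n)..1-real (Suc n)} \<union> {-real n..real n} \<union> {real n..real n+1}"
      by auto
    then show ?case using up[of n] down[of "Suc n"] Suc by (simp only:) (intro set_integrable_Un; simp)
  qed (simp add: set_borel_integrable_singleton)
  show ?thesis unfolding loc_integrable_def
  proof (intro allI)
    fix a b :: real
    obtain n where "max \<bar>a\<bar> \<bar>b\<bar> \<le> real n" using real_arch_simple by blast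
    then show "set_integrable lborel {a..b} p"
      by (intro set_integrable_subset[OF sym[of n]]) auto
  qed
qed

lemma primitive_periodic:
  assumes p: "periodic1 p" and l: "loc_integrable p"
  shows "primitive p (x + 1) = primitive p x + primitive p 1"
proof -
  have "(\<lambda>x. p (x + 1)) = p" using p by (simp add: periodic1_def fun_eq_iff)
  then show ?thesis using primitive_shift[OF l, of x] l by simp
qed

lemma primitive_periodic_n:
  assumes p: "periodic1 p" and l: "loc_integrable p"
  shows "primitive p (real n) = real n * primitive p 1" "primitive p (- real n) = - real n * primitive p 1"
proof (induction n)
  case (Suc n)
  { case 1 then show ?case using Suc primitive_periodic[OF p l, of "real n"] by (simp add: algebra_simps) }
  { case 2 then show ?case using Suc primitive_periodic[OF p l, of "- real (Suc n)"] by (simp add: algebra_simps) }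
qed simp_all

lemma periodic_LINT_le:
  assumes p: "periodic1 p" and l: "loc_integrable p" and "\<And>x. p x \<ge> 0" "\<bar>a\<bar> \<le> real n" "\<bar>b\<bar> \<le> real n"
  shows "(LINT x:{a..b}|lborel. p x) \<le> 2 * real n * primitive p 1"
proof -
  have "(LINT x:{a..b}|lborel. p x) \<le> (LINT x:{-real n..real n}|lborel. p x)"
    unfolding set_lebesgue_integral_def
    using assms loc_integrableD[OF l] by (intro integral_mono) (auto simp: set_integrable_def split: split_indicator)
  also have "\<dots> = 2 * real n * primitive p 1"
    using primitive_diff_Icc[OF l, of "-real n" "real n"] primitive_periodic_n[OF p l, of n] by simp
  finally show ?thesis .
qed

text \<open>Vanishing over one period spreads to every window, so for nonnegative \<open>p\<close>
  the whole primitive is zero.\<close>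

lemma periodic_AE_0:
  assumes p: "periodic1 p" and l: "loc_integrable p" and pos: "\<And>x. p x \<ge> 0" and "primitive p 1 = 0"
  shows "AE x in lborel. p x = 0"
proof (rule loc_integrable_AE_0[OF l])
  fix x
  obtain n where n: "\<bar>x\<bar> \<le> real n" using real_arch_simple by blast
  have "\<bar>primitive p x - primitive p 0\<bar> \<le> (LINT y:{-real n..real n}|lborel. p y)"
    by (rule primitive_diff_le[OF l l]) (use n pos in auto)
  also have "\<dots> \<le> 0" using periodic_LINT_le[OF p l pos, of "-real n" n "real n"] assms(4) by simp
  finally show "primitive p x = 0" by simp
qed

text \<open>A bounded window is covered by \<open>2 * n\<close> periods, so one period controls
  it.\<close>

lemma periodic_L1_cont:
  assumes p: "\<And>t. t \<ge> 0 \<Longrightarrow> periodic1 (p t)" and i: "\<And>t. t \<ge> 0 \<Longrightarrow> set_integrable lborel {0..1} (p t)"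
    and lim: "\<And>t. t \<ge> 0 \<Longrightarrow> ((\<lambda>s. LINT x:{0..1}|lborel. \<bar>p s x - p t x\<bar>) \<longlongrightarrow> 0) (at t within {0..})"
  shows "L1_cont p"
  unfolding L1_cont_def
proof (intro conjI allI impI)
  fix t :: real assume t: "t \<ge> 0"
  show l: "loc_integrable (p t)" using p i t by (intro periodic_loc_integrable)
  fix a b :: real
  obtain n where n: "\<bar>a\<bar> \<le> real n" "\<bar>b\<bar> \<le> real n"
    using real_arch_simple[of "max \<bar>a\<bar> \<bar>b\<bar>"] by auto
  show "((\<lambda>s. LINT x:{a..b}|lborel. \<bar>p s x - p t x\<bar>) \<longlongrightarrow> 0) (at t within {0..})"
  proof (rule real_tendsto_sandwich[OF _ _ tendsto_const])
    show "((\<lambda>s. 2 * real n * (LINT x:{0..1}|lborel. \<bar>p s x - p t x\<bar>)) \<longlongrightarrow> 0) (at t within {0..})"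
      using tendsto_mult_left[OF lim[OF t], of "2 * real n"] by simp
    show "\<forall>\<^sub>F s in at t within {0..}. 0 \<le> (LINT x:{a..b}|lborel. \<bar>p s x - p t x\<bar>)"
      by (intro always_eventually allI loc_integrable_LINT_nonneg) auto
    show "\<forall>\<^sub>F s in at t within {0..}. (LINT x:{a..b}|lborel. \<bar>p s x - p t x\<bar>) \<le> 2 * real n * (LINT x:{0..1}|lborel. \<bar>p s x - p t x\<bar>)"
      using eventually_within_ge
    proof eventually_elim
      case (elim s)
      have "periodic1 (\<lambda>x. \<bar>p s x - p t x\<bar>)" using p[OF t] p[OF elim] by (simp add: periodic1_def)
      moreover have "loc_integrable (\<lambda>x. \<bar>p s x - p t x\<bar>)"
        using p i t elim by (intro loc_integrable_abs loc_integrable_diff periodic_loc_integrable)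
      ultimately show ?case using periodic_LINT_le[of "\<lambda>x. \<bar>p s x - p t x\<bar>" a n b] n by (simp add: primitive_1)
    qed
  qed
qed

section \<open>Derivatives in the mean\<close>

text \<open>Functions instead of classes, over an arbitrary measure: pointwise inequalities can be
  integrated directly.\<close>

definition square_integrable :: "'a measure \<Rightarrow> ('a \<Rightarrow> real) \<Rightarrow> bool" where
  "square_integrable M f \<longleftrightarrow> f \<in> borel_measurable M \<and> integrable M (\<lambda>x. (f x)\<^sup>2)"

lemma square_integrable_mult:
  assumes "square_integrable M f" "square_integrable M g" shows "integrable M (\<lambda>x. f x * g x)"
proof (rule Bochner_Integration.integrable_bound)
  show "integrable M (\<lambda>x. (f x)\<^sup>2 + (g x)\<^sup>2)" using assms by (simp add: square_integrable_def)
  show "(\<lambda>x. f x * g x) \<in> borel_measurable M" using assms by (auto simp: square_integrable_def)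
  show "AE x in M. norm (f x * g x) \<le> norm ((f x)\<^sup>2 + (g x)\<^sup>2)"
  proof (rule AE_I2)
    fix x
    have "\<bar>f x\<bar> * \<bar>g x\<bar> \<le> (f x)\<^sup>2 + (g x)\<^sup>2"
      using sum_squares_bound[of "\<bar>f x\<bar>" "\<bar>g x\<bar>"] mult_nonneg_nonneg[of "\<bar>f x\<bar>" "\<bar>g x\<bar>"]
      unfolding mult.assoc power2_abs by linarith
    then show "norm (f x * g x) \<le> norm ((f x)\<^sup>2 + (g x)\<^sup>2)" by (simp add: abs_mult)
  qed
qed

lemma square_integrable_cmult: "square_integrable M f \<Longrightarrow> square_integrable M (\<lambda>x. c * f x)"
  by (auto simp: square_integrable_def power_mult_distrib)

lemma square_integrable_add:
  assumes "square_integrable M f" "square_integrable M g" shows "square_integrable M (\<lambda>x. f x + g x)"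
proof -
  have "(\<lambda>x. (f x + g x)\<^sup>2) = (\<lambda>x. (f x)\<^sup>2 + (g x)\<^sup>2 + 2 * (f x * g x))"
    by (simp add: fun_eq_iff power2_sum)
  then show ?thesis using assms square_integrable_mult[OF assms] by (auto simp: square_integrable_def)
qed

lemma square_integrable_diff: "square_integrable M f \<Longrightarrow> square_integrable M g \<Longrightarrow> square_integrable M (\<lambda>x. f x - g x)"
  using square_integrable_add[of M f "\<lambda>x. (-1) * g x"] square_integrable_cmult[of M g "-1"] by simp

lemma square_integrable_abs: "square_integrable M f \<Longrightarrow> square_integrable M (\<lambda>x. \<bar>f x\<bar>)"
  by (auto simp: square_integrable_def)

definition sqnorm :: "'a measure \<Rightarrow> ('a \<Rightarrow> real) \<Rightarrow> real" where
  "sqnorm M f = sqrt (\<integral>x. (f x)\<^sup>2 \<partial>M)"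

lemma sqnorm_nonneg [simp]: "sqnorm M f \<ge> 0" by (simp add: sqnorm_def)
lemma sqnorm_sq [simp]: "(sqnorm M f)\<^sup>2 = (\<integral>x. (f x)\<^sup>2 \<partial>M)" by (simp add: sqnorm_def)
lemma sqnorm_abs [simp]: "sqnorm M (\<lambda>x. \<bar>f x\<bar>) = sqnorm M f" by (simp add: sqnorm_def)

lemma integral_square_add:
  assumes "square_integrable M f" "square_integrable M g"
  shows "(\<integral>x. (f x + c * g x)\<^sup>2 \<partial>M) = (\<integral>x. (f x)\<^sup>2 \<partial>M) + 2 * c * (\<integral>x. f x * g x \<partial>M) + c\<^sup>2 * (\<integral>x. (g x)\<^sup>2 \<partial>M)"
proof -
  have "(\<lambda>x. (f x + c * g x)\<^sup>2) = (\<lambda>x. ((f x)\<^sup>2 + 2 * c * (f x * g x)) + c\<^sup>2 * (g x)\<^sup>2)"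
    by (simp add: fun_eq_iff power2_sum power_mult_distrib)
  then show ?thesis using assms square_integrable_mult[OF assms] by (simp add: square_integrable_def)
qed

text \<open>Discriminant argument for the nonnegative quadratic polynomial
  \<open>A + 2 * c * B + c\<^sup>2 * C\<close> in \<open>c\<close>.\<close>

lemma Cauchy_Schwarz_integral:
  assumes "square_integrable M f" "square_integrable M g"
  shows "\<bar>\<integral>x. f x * g x \<partial>M\<bar> \<le> sqnorm M f * sqnorm M g"
proof -
  define A B C where "A = (\<integral>x. (f x)\<^sup>2 \<partial>M)" "B = (\<integral>x. f x * g x \<partial>M)" "C = (\<integral>x. (g x)\<^sup>2 \<partial>M)"
  note ABC = this
  have q: "0 \<le> A + 2 * c * B + c\<^sup>2 * C" for c
    using integral_square_add[OF assms, of c] Bochner_Integration.integral_nonneg[of M "\<lambda>x. (f x + c * g x)\<^sup>2"]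
    unfolding ABC by simp
  have A0: "A \<ge> 0" "C \<ge> 0" unfolding ABC by simp_all
  have "B\<^sup>2 \<le> A * C"
  proof (cases "C = 0")
    case True
    \<comment> \<open>If \<open>B\<close> were nonzero, this \<open>c\<close> would give the
      polynomial, now linear, the value -1.\<close>
    then have "B = 0" using q[of "- (A + 1) / (2 * B)"] by (cases "B = 0") (auto simp: field_simps)
    then show ?thesis using True by simp
  next
    case False
    then have C: "C > 0" using A0 by simp
    have "0 \<le> C * (A + 2 * (- B / C) * B + (- B / C)\<^sup>2 * C)"
      \<comment> \<open>The minimiser of the quadratic.\<close>
      using q[of "- B / C"] C by simp
    also have "\<dots> = A * C - B\<^sup>2" using C by (simp add: field_simps power2_eq_square)
    finally show ?thesis by simp
  qed
  then have "sqrt (B\<^sup>2) \<le> sqrt (A * C)" by (rule real_sqrt_le_mono)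
  then show ?thesis by (simp add: ABC sqnorm_def real_sqrt_mult)
qed

context
  fixes M :: "'a measure" and X :: "real \<Rightarrow> 'a \<Rightarrow> real" and X' :: "'a \<Rightarrow> real" and t :: real
  assumes X: "\<And>s. s \<ge> 0 \<Longrightarrow> square_integrable M (X s)" and X': "square_integrable M X'" and t: "t \<ge> 0"
    and lim: "((\<lambda>s. sqnorm M (\<lambda>x. X s x - X t x - (s - t) * X' x) / \<bar>s - t\<bar>) \<longlongrightarrow> 0) (at t within {0..})"
begin

text \<open>Differentiability in the mean implies continuity in the mean: the increment is the
  remainder plus \<open>(s - t) * X'\<close>, and its square is expanded, with Cauchy-Schwarz for
  the cross term.\<close>

lemma sqnorm_tendsto: "((\<lambda>s. sqnorm M (\<lambda>x. X s x - X t x)) \<longlongrightarrow> 0) (at t within {0..})"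
proof -
  let ?r = "\<lambda>s. sqnorm M (\<lambda>x. X s x - X t x - (s - t) * X' x) / \<bar>s - t\<bar>"
  define n where "n = sqnorm M X'"
  have l1: "((\<lambda>s. \<bar>s - t\<bar>) \<longlongrightarrow> 0) (at t within {0..})"
    by (rule tendsto_eq_intros refl | simp)+
  \<comment> \<open>The norm of the remainder is written as \<open>\<bar>s - t\<bar> * ?r s\<close>
    so that the hypothesis on the quotient applies.\<close>
  have "((\<lambda>s. (\<bar>s - t\<bar> * ?r s)\<^sup>2 + 2 * \<bar>s - t\<bar> * ((\<bar>s - t\<bar> * ?r s) * n) + \<bar>s - t\<bar>\<^sup>2 * n\<^sup>2) \<longlongrightarrow> (0*0)\<^sup>2 + 2 * 0 * ((0 * 0) * n) + 0\<^sup>2 * n\<^sup>2) (at t within {0..})"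
    by (intro tendsto_intros lim l1)
  then have up: "((\<lambda>s. (\<bar>s - t\<bar> * ?r s)\<^sup>2 + 2 * \<bar>s - t\<bar> * ((\<bar>s - t\<bar> * ?r s) * n) + \<bar>s - t\<bar>\<^sup>2 * n\<^sup>2) \<longlongrightarrow> 0) (at t within {0..})" by simp
  have "((\<lambda>s. \<integral>x. (X s x - X t x)\<^sup>2 \<partial>M) \<longlongrightarrow> 0) (at t within {0..})"
  proof (rule real_tendsto_sandwich[OF _ _ tendsto_const up])
    show "\<forall>\<^sub>F s in at t within {0..}. (\<integral>x. (X s x - X t x)\<^sup>2 \<partial>M) \<le>
      (\<bar>s - t\<bar> * ?r s)\<^sup>2 + 2 * \<bar>s - t\<bar> * ((\<bar>s - t\<bar> * ?r s) * n) + \<bar>s - t\<bar>\<^sup>2 * n\<^sup>2"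
      unfolding eventually_at_filter
    proof (intro always_eventually allI impI)
      fix s assume s: "s \<noteq> t" "s \<in> {0..}"
      let ?R = "\<lambda>x. X s x - X t x - (s - t) * X' x"
      have R: "square_integrable M ?R" using s t by (intro square_integrable_diff square_integrable_cmult X X') auto
      have r: "\<bar>s - t\<bar> * ?r s = sqnorm M ?R" using s by simp
      have "(\<integral>x. (X s x - X t x)\<^sup>2 \<partial>M) = (\<integral>x. (?R x + (s - t) * X' x)\<^sup>2 \<partial>M)" by simp
      also have "\<dots> = (sqnorm M ?R)\<^sup>2 + 2 * (s - t) * (\<integral>x. ?R x * X' x \<partial>M) + (s - t)\<^sup>2 * n\<^sup>2"
        unfolding integral_square_add[OF R X'] by (simp add: n_def)
      also have "\<dots> \<le> (sqnorm M ?R)\<^sup>2 + 2 * \<bar>s - t\<bar> * (sqnorm M ?R * n) + \<bar>s - t\<bar>\<^sup>2 * n\<^sup>2"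
      proof -
        have "2 * (s - t) * (\<integral>x. ?R x * X' x \<partial>M) \<le> \<bar>2 * (s - t) * (\<integral>x. ?R x * X' x \<partial>M)\<bar>" by simp
        also have "\<dots> = 2 * \<bar>s - t\<bar> * \<bar>\<integral>x. ?R x * X' x \<partial>M\<bar>" by (simp only: abs_mult abs_numeral)
        also have "\<dots> \<le> 2 * \<bar>s - t\<bar> * (sqnorm M ?R * n)"
          unfolding n_def by (intro mult_left_mono Cauchy_Schwarz_integral R X') auto
        finally show ?thesis by simp
      qed
      finally show "(\<integral>x. (X s x - X t x)\<^sup>2 \<partial>M) \<le> (\<bar>s - t\<bar> * ?r s)\<^sup>2 + 2 * \<bar>s - t\<bar> * ((\<bar>s - t\<bar> * ?r s) * n) + \<bar>s - t\<bar>\<^sup>2 * n\<^sup>2"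
        unfolding r .
    qed
  qed simp
  then have "((\<lambda>s. sqrt (\<integral>x. (X s x - X t x)\<^sup>2 \<partial>M)) \<longlongrightarrow> sqrt 0) (at t within {0..})"
    by (rule tendsto_real_sqrt)
  then show ?thesis by (simp add: sqnorm_def)
qed

text \<open>With increment \<open>E\<close> and remainder \<open>R\<close>, the error in the
  difference of squared norms is \<open>2 <X t, R> + <E, R> + (s - t) <E, X'>\<close>. After
  division by \<open>s - t\<close>, Cauchy-Schwarz sends each term to 0.\<close>

lemma integral_square_DERIV:
  "((\<lambda>s. \<integral>x. (X s x)\<^sup>2 \<partial>M) has_real_derivative 2 * (\<integral>x. X t x * X' x \<partial>M)) (at t within {0..})"
proof -
  let ?r = "\<lambda>s. sqnorm M (\<lambda>x. X s x - X t x - (s - t) * X' x) / \<bar>s - t\<bar>"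
  let ?I = "\<lambda>s. \<integral>x. (X s x)\<^sup>2 \<partial>M" and ?D = "2 * (\<integral>x. X t x * X' x \<partial>M)"
  define n where "n = sqnorm M (X t)"
  have "((\<lambda>s. 2 * n * ?r s + sqnorm M (\<lambda>x. X s x - X t x) * ?r s + sqnorm M (\<lambda>x. X s x - X t x) * sqnorm M X') \<longlongrightarrow> 2 * n * 0 + 0 * 0 + 0 * sqnorm M X') (at t within {0..})"
    by (intro tendsto_intros lim sqnorm_tendsto)
  then have up: "((\<lambda>s. 2 * n * ?r s + sqnorm M (\<lambda>x. X s x - X t x) * ?r s + sqnorm M (\<lambda>x. X s x - X t x) * sqnorm M X') \<longlongrightarrow> 0) (at t within {0..})"
    by simp
  have "((\<lambda>s. (?I s - ?I t) / (s - t) - ?D) \<longlongrightarrow> 0) (at t within {0..})"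
  proof (rule Lim_null_comparison[OF _ up])
    show "\<forall>\<^sub>F s in at t within {0..}. norm ((?I s - ?I t) / (s - t) - ?D) \<le> 
      2 * n * ?r s + sqnorm M (\<lambda>x. X s x - X t x) * ?r s + sqnorm M (\<lambda>x. X s x - X t x) * sqnorm M X'"
      unfolding eventually_at_filter
    proof (intro always_eventually allI impI)
      fix s assume s: "s \<noteq> t" "s \<in> {0..}"
      let ?R = "\<lambda>x. X s x - X t x - (s - t) * X' x"
      let ?E = "\<lambda>x. X s x - X t x"
      have R: "square_integrable M ?R" using s t by (intro square_integrable_diff square_integrable_cmult X X') auto
      have E: "square_integrable M ?E" using s t by (intro square_integrable_diff X) auto
      have Xt: "square_integrable M (X t)" by (rule X[OF t])
      have XR: "(\<integral>x. X t x * ?R x \<partial>M) = (\<integral>x. X t x * ?E x \<partial>M) - (s - t) * (\<integral>x. X t x * X' x \<partial>M)"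
      proof -
        have "(\<lambda>x. X t x * ?R x) = (\<lambda>x. X t x * ?E x - (s - t) * (X t x * X' x))"
          by (simp add: fun_eq_iff algebra_simps)
        then show ?thesis using square_integrable_mult[OF Xt E] square_integrable_mult[OF Xt X'] by simp
      qed
      have ER: "(\<integral>x. ?E x * ?R x \<partial>M) = (\<integral>x. (?E x)\<^sup>2 \<partial>M) - (s - t) * (\<integral>x. ?E x * X' x \<partial>M)"
      proof -
        have "(\<lambda>x. ?E x * ?R x) = (\<lambda>x. (?E x)\<^sup>2 - (s - t) * (?E x * X' x))"
          by (simp add: fun_eq_iff power2_eq_square algebra_simps)
        then show ?thesis using E square_integrable_mult[OF E X'] by (simp add: square_integrable_def)
      qed
      have "?I s = (\<integral>x. (X t x + 1 * ?E x)\<^sup>2 \<partial>M)" by simp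
      also have "\<dots> = ?I t + 2 * (\<integral>x. X t x * ?E x \<partial>M) + (\<integral>x. (?E x)\<^sup>2 \<partial>M)"
        unfolding integral_square_add[OF Xt E] by simp
      finally have "?I s - ?I t - (s - t) * ?D = 2 * (\<integral>x. X t x * ?R x \<partial>M) + (\<integral>x. ?E x * ?R x \<partial>M) + (s - t) * (\<integral>x. ?E x * X' x \<partial>M)"
        unfolding XR ER by (simp add: algebra_simps)
      then have "\<bar>?I s - ?I t - (s - t) * ?D\<bar> \<le> 2 * \<bar>\<integral>x. X t x * ?R x \<partial>M\<bar> + \<bar>\<integral>x. ?E x * ?R x \<partial>M\<bar> + \<bar>s - t\<bar> * \<bar>\<integral>x. ?E x * X' x \<partial>M\<bar>"
        unfolding abs_mult[symmetric] by linarith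
      also have "\<dots> \<le> 2 * (n * sqnorm M ?R) + sqnorm M ?E * sqnorm M ?R + \<bar>s - t\<bar> * (sqnorm M ?E * sqnorm M X')"
        unfolding n_def by (intro add_mono mult_left_mono Cauchy_Schwarz_integral Xt R E X') auto
      finally have le: "\<bar>?I s - ?I t - (s - t) * ?D\<bar> / \<bar>s - t\<bar> \<le> (2 * (n * sqnorm M ?R) + sqnorm M ?E * sqnorm M ?R + \<bar>s - t\<bar> * (sqnorm M ?E * sqnorm M X')) / \<bar>s - t\<bar>"
        by (rule divide_right_mono) simp
      have "norm ((?I s - ?I t) / (s - t) - ?D) = \<bar>(?I s - ?I t - (s - t) * ?D) / (s - t)\<bar>"
        using s by (simp add: diff_divide_distrib)
      also have "\<dots> = \<bar>?I s - ?I t - (s - t) * ?D\<bar> / \<bar>s - t\<bar>" by (rule abs_divide)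
      also note le
      also have "(2 * (n * sqnorm M ?R) + sqnorm M ?E * sqnorm M ?R + \<bar>s - t\<bar> * (sqnorm M ?E * sqnorm M X')) / \<bar>s - t\<bar>
        = 2 * n * ?r s + sqnorm M ?E * ?r s + sqnorm M ?E * sqnorm M X'"
        using s by (simp add: add_divide_distrib)
      finally show "norm ((?I s - ?I t) / (s - t) - ?D) \<le> 2 * n * ?r s + sqnorm M ?E * ?r s + sqnorm M ?E * sqnorm M X'" .
    qed
  qed
  then show ?thesis unfolding has_field_derivative_iff by (simp add: LIM_zero_iff)
qed

end

text \<open>Expanding the product around time \<open>t\<close> leaves three terms, each with a
  factor that tends to 0 in mean square. This supplies the time continuity of the quadratic
  densities.\<close>

lemma L1_mult_tendsto:
  assumes X: "\<And>s. s \<ge> 0 \<Longrightarrow> square_integrable M (X s)" and Y: "\<And>s. s \<ge> 0 \<Longrightarrow> square_integrable M (Y s)" and t: "t \<ge> (0::real)"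
    and lX: "((\<lambda>s. sqnorm M (\<lambda>x. X s x - X t x)) \<longlongrightarrow> 0) (at t within {0..})"
    and lY: "((\<lambda>s. sqnorm M (\<lambda>x. Y s x - Y t x)) \<longlongrightarrow> 0) (at t within {0..})"
  shows "((\<lambda>s. \<integral>x. \<bar>X s x * Y s x - X t x * Y t x\<bar> \<partial>M) \<longlongrightarrow> 0) (at t within {0..})"
proof (rule real_tendsto_sandwich[OF _ _ tendsto_const])
  let ?dX = "\<lambda>s. sqnorm M (\<lambda>x. X s x - X t x)" and ?dY = "\<lambda>s. sqnorm M (\<lambda>x. Y s x - Y t x)"
  have "((\<lambda>s. ?dX s * ?dY s + ?dX s * sqnorm M (Y t) + sqnorm M (X t) * ?dY s) \<longlongrightarrow> 0 * 0 + 0 * sqnorm M (Y t) + sqnorm M (X t) * 0) (at t within {0..})"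
    by (intro tendsto_intros lX lY)
  then show "((\<lambda>s. ?dX s * ?dY s + ?dX s * sqnorm M (Y t) + sqnorm M (X t) * ?dY s) \<longlongrightarrow> 0) (at t within {0..})" by simp
  show "\<forall>\<^sub>F s in at t within {0..}. (\<integral>x. \<bar>X s x * Y s x - X t x * Y t x\<bar> \<partial>M) \<le> ?dX s * ?dY s + ?dX s * sqnorm M (Y t) + sqnorm M (X t) * ?dY s"
    using eventually_within_ge
  proof eventually_elim
    case (elim s)
    let ?E = "\<lambda>x. \<bar>X s x - X t x\<bar>" and ?F = "\<lambda>x. \<bar>Y s x - Y t x\<bar>"
    have sq: "square_integrable M ?E" "square_integrable M ?F" "square_integrable M (\<lambda>x. \<bar>X t x\<bar>)" "square_integrable M (\<lambda>x. \<bar>Y t x\<bar>)"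
      using elim t by (intro square_integrable_abs square_integrable_diff X Y; simp)+
    have i: "integrable M (\<lambda>x. ?E x * ?F x)" "integrable M (\<lambda>x. ?E x * \<bar>Y t x\<bar>)" "integrable M (\<lambda>x. \<bar>X t x\<bar> * ?F x)"
      by (intro square_integrable_mult sq)+
    have "(\<integral>x. \<bar>X s x * Y s x - X t x * Y t x\<bar> \<partial>M) \<le> (\<integral>x. ?E x * ?F x + ?E x * \<bar>Y t x\<bar> + \<bar>X t x\<bar> * ?F x \<partial>M)"
    proof (rule integral_mono)
      show "integrable M (\<lambda>x. \<bar>X s x * Y s x - X t x * Y t x\<bar>)"
        using elim t by (intro integrable_abs Bochner_Integration.integrable_diff square_integrable_mult X Y) auto
      show "integrable M (\<lambda>x. ?E x * ?F x + ?E x * \<bar>Y t x\<bar> + \<bar>X t x\<bar> * ?F x)" using i by simp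
      fix x
      have "X s x * Y s x - X t x * Y t x = (X s x - X t x) * (Y s x - Y t x) + (X s x - X t x) * Y t x + X t x * (Y s x - Y t x)"
        by (simp add: algebra_simps)
      then show "\<bar>X s x * Y s x - X t x * Y t x\<bar> \<le> ?E x * ?F x + ?E x * \<bar>Y t x\<bar> + \<bar>X t x\<bar> * ?F x"
        unfolding abs_mult[symmetric] by linarith
    qed
    also have "\<dots> = (\<integral>x. ?E x * ?F x \<partial>M) + (\<integral>x. ?E x * \<bar>Y t x\<bar> \<partial>M) + (\<integral>x. \<bar>X t x\<bar> * ?F x \<partial>M)"
      using i by simp
    also have "\<dots> \<le> ?dX s * ?dY s + ?dX s * sqnorm M (Y t) + sqnorm M (X t) * ?dY s"
      using Cauchy_Schwarz_integral[OF sq(1,2)] Cauchy_Schwarz_integral[OF sq(1,4)] Cauchy_Schwarz_integral[OF sq(3,2)]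
      by simp
    finally show ?case .
  qed
qed simp

section \<open>The nonlocal operators\<close>

lemma G_op_primitive:
  "G_op \<mu> \<rho> \<sigma> x = primitive (\<lambda>y. 2 * \<rho> y * \<sigma> y) x + \<mu> - primitive (\<lambda>y. primitive (\<lambda>z. 2 * \<rho> z * \<sigma> z) y * (\<rho> y)\<^sup>2) 1"
  by (simp add: G_op_def primitive_def one_ereal_def)

text \<open>Formally \<open>\<rho>\<close> squared is the Jacobian of the flow and
  \<open>2 * \<sigma>\<close> is \<open>u_x\<close> along the flow times \<open>\<rho>\<close>, so
  this is the Camassa-Holm source \<open>u^2 + u_x^2 / 2\<close> pulled back. The continuous factor
  is written first to fit \<open>Ck_density_mult\<close>.\<close>

definition energy_density :: "real \<Rightarrow> (real \<Rightarrow> real) \<Rightarrow> (real \<Rightarrow> real) \<Rightarrow> real \<Rightarrow> real" where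
  "energy_density \<mu> \<rho> \<sigma> x = (G_op \<mu> \<rho> \<sigma> x * G_op \<mu> \<rho> \<sigma> x) * (\<rho> x)\<^sup>2 + 2 * (\<sigma> x)\<^sup>2"

definition arc_length :: "(real \<Rightarrow> real) \<Rightarrow> real \<Rightarrow> real" where
  "arc_length \<rho> = primitive (\<lambda>x. (\<rho> x)\<^sup>2)"

text \<open>The addition theorem separates \<open>x\<close> from the integration variable in the
  kernel; these are the primitives that remain.\<close>

definition cosh_moment where "cosh_moment \<mu> \<rho> \<sigma> = primitive (\<lambda>y. cosh (arc_length \<rho> y) * energy_density \<mu> \<rho> \<sigma> y)"
definition sinh_moment where "sinh_moment \<mu> \<rho> \<sigma> = primitive (\<lambda>y. sinh (arc_length \<rho> y) * energy_density \<mu> \<rho> \<sigma> y)"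

text \<open>Splitting the kernel of \<^term>\<open>F_op\<close> at \<open>x\<close> and expanding the hyperbolic cosines removes the absolute
  value. Outside \<open>[0, 1]\<close> the operator \<^term>\<open>F_op\<close> is not periodic, but this closed form is.\<close>

definition F_closed :: "real \<Rightarrow> (real \<Rightarrow> real) \<Rightarrow> (real \<Rightarrow> real) \<Rightarrow> real \<Rightarrow> real" where
  "F_closed \<mu> \<rho> \<sigma> x = 1 / (2 * sinh (1/2)) *
    ((cosh (arc_length \<rho> x - 1/2) * cosh_moment \<mu> \<rho> \<sigma> x - sinh (arc_length \<rho> x - 1/2) * sinh_moment \<mu> \<rho> \<sigma> x)
   + (cosh (arc_length \<rho> x + 1/2) * (cosh_moment \<mu> \<rho> \<sigma> 1 - cosh_moment \<mu> \<rho> \<sigma> x) - sinh (arc_length \<rho> x + 1/2) * (sinh_moment \<mu> \<rho> \<sigma> 1 - sinh_moment \<mu> \<rho> \<sigma> x)))"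

text \<open>Built on the closed form, so that it is the right coefficient on the whole line and not
  only on \<open>{0..1}\<close>.\<close>

definition potential :: "real \<Rightarrow> (real \<Rightarrow> real) \<Rightarrow> (real \<Rightarrow> real) \<Rightarrow> real \<Rightarrow> real" where
  "potential \<mu> \<rho> \<sigma> x = 1/2 * (G_op \<mu> \<rho> \<sigma> x * G_op \<mu> \<rho> \<sigma> x - F_closed \<mu> \<rho> \<sigma> x)"

text \<open>Every operation keeps the index: a primitive of a level \<open>j\<close> density is
  \<open>jointly_Ck j\<close>, and multiplying a level \<open>j\<close> density by such a function
  stays at level \<open>j\<close>. The nesting depth of the integrals therefore costs
  nothing.\<close>

lemma
  assumes R2: "Ck_density j (\<lambda>t x. (\<rho> t x)\<^sup>2)" and RS: "Ck_density j (\<lambda>t x. \<rho> t x * \<sigma> t x)" and S2: "Ck_density j (\<lambda>t x. (\<sigma> t x)\<^sup>2)"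
  shows jointly_Ck_G_op: "jointly_Ck j (\<lambda>t x. G_op \<mu> (\<rho> t) (\<sigma> t) x)"
    and Ck_density_energy_density: "Ck_density j (\<lambda>t x. energy_density \<mu> (\<rho> t) (\<sigma> t) x)"
    and jointly_Ck_arc_length: "jointly_Ck j (\<lambda>t x. arc_length (\<rho> t) x)"
    and jointly_Ck_potential: "jointly_Ck j (\<lambda>t x. potential \<mu> (\<rho> t) (\<sigma> t) x)"
proof -
  have RS2: "Ck_density j (\<lambda>t x. 2 * \<rho> t x * \<sigma> t x)"
    using Ck_density_cmult[OF RS, of 2] by (simp add: mult.assoc)
  have P: "jointly_Ck j (\<lambda>t x. primitive (\<lambda>z. 2 * \<rho> t z * \<sigma> t z) x)" by (rule Ck_density_primitive[OF RS2])
  have c: "jointly_Ck j (\<lambda>t x. c)" for c :: real by (rule jointly_Ck_const) simp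
  show G: "jointly_Ck j (\<lambda>t x. G_op \<mu> (\<rho> t) (\<sigma> t) x)"
    unfolding G_op_primitive by (intro jointly_Ck_diff jointly_Ck_add P c jointly_Ck_at[OF Ck_density_primitive[where j = j]] Ck_density_mult R2)
  show h: "Ck_density j (\<lambda>t x. energy_density \<mu> (\<rho> t) (\<sigma> t) x)"
    unfolding energy_density_def by (intro Ck_density_add Ck_density_mult Ck_density_cmult jointly_Ck_mult G R2 S2)
  show r: "jointly_Ck j (\<lambda>t x. arc_length (\<rho> t) x)" unfolding arc_length_def by (rule Ck_density_primitive[OF R2])
  have A: "jointly_Ck j (\<lambda>t x. cosh_moment \<mu> (\<rho> t) (\<sigma> t) x)" and B: "jointly_Ck j (\<lambda>t x. sinh_moment \<mu> (\<rho> t) (\<sigma> t) x)"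
    unfolding cosh_moment_def sinh_moment_def by (intro Ck_density_primitive Ck_density_mult jointly_Ck_cosh jointly_Ck_sinh r h)+
  show "jointly_Ck j (\<lambda>t x. potential \<mu> (\<rho> t) (\<sigma> t) x)"
    unfolding potential_def F_closed_def
    by (intro jointly_Ck_cmult jointly_Ck_diff jointly_Ck_add jointly_Ck_mult jointly_Ck_cosh jointly_Ck_sinh G r A B c jointly_Ck_at[OF A] jointly_Ck_at[OF B])
qed

section \<open>The operators at a fixed time\<close>

context
  fixes \<mu> :: real and \<rho> \<sigma> :: "real \<Rightarrow> real"
  assumes R2: "loc_integrable (\<lambda>x. (\<rho> x)\<^sup>2)" and RS: "loc_integrable (\<lambda>x. \<rho> x * \<sigma> x)" and S2: "loc_integrable (\<lambda>x. (\<sigma> x)\<^sup>2)"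
begin

text \<open>Read as constant in time, a single pair of functions inherits continuity and
  integrability from the results on families at level 0.\<close>

lemma const_family:
  "Ck_density 0 (\<lambda>t :: real. \<lambda>x. (\<rho> x)\<^sup>2)" "Ck_density 0 (\<lambda>t :: real. \<lambda>x. \<rho> x * \<sigma> x)" "Ck_density 0 (\<lambda>t :: real. \<lambda>x. (\<sigma> x)\<^sup>2)"
  using R2 RS S2 by (auto simp: L1_cont_def)

lemma arc_length_cont: "continuous_on UNIV (arc_length \<rho>)"
  using jointly_cont_slice[OF jointly_Ck_jointly_cont[OF jointly_Ck_arc_length[OF const_family]], of 0] by simp

lemma potential_cont: "continuous_on UNIV (potential \<mu> \<rho> \<sigma>)"
  using jointly_cont_slice[OF jointly_Ck_jointly_cont[OF jointly_Ck_potential[OF const_family, of \<mu>]], of 0] by simp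

lemma energy_density_loc_integrable: "loc_integrable (energy_density \<mu> \<rho> \<sigma>)"
  using Ck_density_loc_integrable[OF Ck_density_energy_density[OF const_family, of \<mu>], of 0] by simp

lemma arc_length_mono: "x \<le> y \<Longrightarrow> arc_length \<rho> x \<le> arc_length \<rho> y"
  using primitive_diff_Icc[OF R2, of x y] loc_integrable_LINT_nonneg[of x y "\<lambda>x. (\<rho> x)\<^sup>2"] by (simp add: arc_length_def)

lemma energy_density_cosh_loc_integrable: "loc_integrable (\<lambda>y. cosh (arc_length \<rho> y) * energy_density \<mu> \<rho> \<sigma> y)" "loc_integrable (\<lambda>y. sinh (arc_length \<rho> y) * energy_density \<mu> \<rho> \<sigma> y)"
  by (intro loc_integrable_mult energy_density_loc_integrable; auto simp: cosh_def sinh_def intro!: continuous_intros arc_length_cont)+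

text \<open>Monotonicity of the arc length decides the absolute value on either side of
  \<open>x\<close>. To the right of \<open>x\<close> the argument of \<open>cosh\<close> is the
  negative of \<open>arc_length \<rho> x + 1/2 - arc_length \<rho> y\<close>, and evenness of
  \<open>cosh\<close> yields the same shape as on the left with \<open>+ 1/2\<close> in place of
  \<open>- 1/2\<close>.\<close>

lemma F_op_eq_F_closed:
  assumes x: "x \<in> {0..1}" shows "F_op \<mu> \<rho> \<sigma> x = F_closed \<mu> \<rho> \<sigma> x"
proof -
  let ?c = "1 / (2 * sinh (1/2)) :: real"
  define k where "k y = ?c * (cosh (\<bar>arc_length \<rho> x - arc_length \<rho> y\<bar> - 1/2) * energy_density \<mu> \<rho> \<sigma> y)" for y
  \<comment> \<open>The kernel without absolute value, already expanded; \<open>a\<close> will be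
    the arc length at \<open>x\<close> minus or plus 1/2.\<close>
  define k1 where "k1 a y = ?c * (cosh a * (cosh (arc_length \<rho> y) * energy_density \<mu> \<rho> \<sigma> y) - sinh a * (sinh (arc_length \<rho> y) * energy_density \<mu> \<rho> \<sigma> y))" for a y
  have k1: "k1 a y = ?c * (cosh (a - arc_length \<rho> y) * energy_density \<mu> \<rho> \<sigma> y)" for a y
    by (simp add: k1_def cosh_diff algebra_simps)
  have lk: "loc_integrable k" unfolding k_def
    by (intro loc_integrable_cmult loc_integrable_mult energy_density_loc_integrable) (auto simp: cosh_def intro!: continuous_intros arc_length_cont)
  have lk1: "loc_integrable (k1 a)" for a
    unfolding k1_def by (intro loc_integrable_cmult loc_integrable_diff energy_density_cosh_loc_integrable)
  have pk1: "primitive (k1 a) y = ?c * (cosh a * cosh_moment \<mu> \<rho> \<sigma> y - sinh a * sinh_moment \<mu> \<rho> \<sigma> y)" for a y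
    unfolding k1_def primitive_cmult cosh_moment_def sinh_moment_def
    by (subst primitive_sub) (simp_all add: loc_integrable_cmult energy_density_cosh_loc_integrable)
  have len: "(LBINT z=ereal y..ereal x. (\<rho> z)\<^sup>2) = arc_length \<rho> x - arc_length \<rho> y" for y
    by (simp add: arc_length_def primitive_diff[OF R2])
  have "F_op \<mu> \<rho> \<sigma> x = primitive k 1"
    unfolding F_op_def primitive_def one_ereal_def
    by (rule arg_cong[where f = "interval_lebesgue_integral lborel 0 (ereal 1)"])
      (simp add: fun_eq_iff k_def energy_density_def len power2_eq_square[of "G_op \<mu> \<rho> \<sigma> _"] mult.commute)
  also have "\<dots> = (primitive k x - primitive k 0) + (primitive k 1 - primitive k x)" by simp
  also have "primitive k x - primitive k 0 = primitive (k1 (arc_length \<rho> x - 1/2)) x - primitive (k1 (arc_length \<rho> x - 1/2)) 0"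
  proof -
    have "k y = k1 (arc_length \<rho> x - 1/2) y" if "y \<in> {0..x}" for y
      unfolding k_def k1 using arc_length_mono[of y x] that by (simp add: algebra_simps)
    then show ?thesis using x unfolding primitive_diff_Icc[OF lk, of 0 x, simplified] 
      by (subst (1 2) primitive_diff_Icc) (auto intro: lk lk1 set_lebesgue_integral_cong)
  qed
  also have "primitive k 1 - primitive k x = primitive (k1 (arc_length \<rho> x + 1/2)) 1 - primitive (k1 (arc_length \<rho> x + 1/2)) x"
  proof -
    have "k y = k1 (arc_length \<rho> x + 1/2) y" if "y \<in> {x..1}" for y
    proof -
      have "\<bar>arc_length \<rho> x - arc_length \<rho> y\<bar> - 1/2 = - (arc_length \<rho> x + 1/2 - arc_length \<rho> y)"
        using arc_length_mono[of x y] that by simp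
      then show ?thesis unfolding k_def k1 by (simp only: cosh_minus)
    qed
    then show ?thesis using x 
      by (subst (1 2) primitive_diff_Icc) (auto intro: lk lk1 set_lebesgue_integral_cong)
  qed
  finally show ?thesis unfolding pk1 by (simp add: F_closed_def cosh_moment_def sinh_moment_def algebra_simps)
qed

lemma f_op_eq:
  assumes "x \<in> {0..1}" shows "f_op \<mu> \<rho> \<sigma> x = potential \<mu> \<rho> \<sigma> x * \<rho> x"
  by (simp add: f_op_def potential_def F_op_eq_F_closed[OF assms] power2_eq_square)

text \<open>Over one period the arc length grows by exactly 1 and the primitive inside
  \<open>G_op\<close> by 0. The two moments then transform by the hyperbolic rotation of angle 1
  plus a constant vector, which the shift of the kernel arguments compensates.\<close>

lemma potential_periodic:
  assumes \<rho>: "periodic1 \<rho>" and \<sigma>: "periodic1 \<sigma>" and one: "primitive (\<lambda>x. (\<rho> x)\<^sup>2) 1 = 1" and zero: "primitive (\<lambda>x. \<rho> x * \<sigma> x) 1 = 0"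
  shows "potential \<mu> \<rho> \<sigma> (x + 1) = potential \<mu> \<rho> \<sigma> x"
proof -
  have per: "\<rho> (y + 1) = \<rho> y" "\<sigma> (y + 1) = \<sigma> y" for y using \<rho> \<sigma> by (auto simp: periodic1_def)
  have arc_length: "arc_length \<rho> (y + 1) = arc_length \<rho> y + 1" for y
    unfolding arc_length_def using primitive_periodic[OF _ R2, of y] one per by (simp add: periodic1_def)
  have "primitive (\<lambda>y. 2 * \<rho> y * \<sigma> y) y = 2 * primitive (\<lambda>y. \<rho> y * \<sigma> y) y" for y by (simp add: mult.assoc)
  then have G: "G_op \<mu> \<rho> \<sigma> (y + 1) = G_op \<mu> \<rho> \<sigma> y" for y
    unfolding G_op_primitive using primitive_periodic[OF _ RS, of y] zero per by (simp add: periodic1_def)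
  have h: "energy_density \<mu> \<rho> \<sigma> (y + 1) = energy_density \<mu> \<rho> \<sigma> y" for y by (simp add: energy_density_def G per)
  let ?A = "cosh_moment \<mu> \<rho> \<sigma>" and ?B = "sinh_moment \<mu> \<rho> \<sigma>" and ?h = "energy_density \<mu> \<rho> \<sigma>"
  have "cosh (arc_length \<rho> (y + 1)) * ?h (y + 1) = cosh 1 * (cosh (arc_length \<rho> y) * ?h y) + sinh 1 * (sinh (arc_length \<rho> y) * ?h y)" for y
    unfolding arc_length h cosh_add by (simp add: algebra_simps)
  then have A: "?A (x + 1) = ?A 1 + (cosh 1 * ?A x + sinh 1 * ?B x)"
    unfolding cosh_moment_def sinh_moment_def
    by (subst primitive_shift) (simp_all add: energy_density_cosh_loc_integrable loc_integrable_add loc_integrable_cmult primitive_add)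
  have "sinh (arc_length \<rho> (y + 1)) * ?h (y + 1) = sinh 1 * (cosh (arc_length \<rho> y) * ?h y) + cosh 1 * (sinh (arc_length \<rho> y) * ?h y)" for y
    unfolding arc_length h sinh_add by (simp add: algebra_simps)
  then have B: "?B (x + 1) = ?B 1 + (sinh 1 * ?A x + cosh 1 * ?B x)"
    unfolding cosh_moment_def sinh_moment_def
    by (subst primitive_shift) (simp_all add: energy_density_cosh_loc_integrable loc_integrable_add loc_integrable_cmult primitive_add)
  let ?r = "arc_length \<rho> x"
  have m: "cosh (?r - 1/2) = cosh (?r + 1/2) * cosh 1 - sinh (?r + 1/2) * sinh 1"
    "sinh (?r - 1/2) = sinh (?r + 1/2) * cosh 1 - cosh (?r + 1/2) * sinh 1"
    using cosh_diff[of "?r + 1/2" 1] sinh_diff[of "?r + 1/2" 1] by simp_all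
  have p: "cosh (?r + 1/2) = cosh (?r + 3/2) * cosh 1 - sinh (?r + 3/2) * sinh 1"
    "sinh (?r + 1/2) = sinh (?r + 3/2) * cosh 1 - cosh (?r + 3/2) * sinh 1"
    using cosh_diff[of "?r + 3/2" 1] sinh_diff[of "?r + 3/2" 1] by (simp_all add: add.commute)
  \<comment> \<open>After the shift the left part equals the old left part plus the contribution of
    a full period, and the right part becomes minus the contribution of \<open>{0..x}\<close>; their
    sum restores the old right part.\<close>
  have "cosh (?r + 1/2) * ?A (x + 1) - sinh (?r + 1/2) * ?B (x + 1)
     = (cosh (?r - 1/2) * ?A x - sinh (?r - 1/2) * ?B x) + (cosh (?r + 1/2) * ?A 1 - sinh (?r + 1/2) * ?B 1)"
    unfolding A B m by (simp add: algebra_simps)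
  moreover have "cosh (?r + 3/2) * (?A 1 - ?A (x + 1)) - sinh (?r + 3/2) * (?B 1 - ?B (x + 1))
     = - (cosh (?r + 1/2) * ?A x - sinh (?r + 1/2) * ?B x)"
    unfolding A B p by (simp add: algebra_simps)
  ultimately have "(cosh (?r + 1/2) * ?A (x + 1) - sinh (?r + 1/2) * ?B (x + 1))
      + (cosh (?r + 3/2) * (?A 1 - ?A (x + 1)) - sinh (?r + 3/2) * (?B 1 - ?B (x + 1)))
    = (cosh (?r - 1/2) * ?A x - sinh (?r - 1/2) * ?B x)
      + (cosh (?r + 1/2) * (?A 1 - ?A x) - sinh (?r + 1/2) * (?B 1 - ?B x))"
    unfolding right_diff_distrib by linarith
  moreover have "?r + 1 - 1/2 = ?r + 1/2" "?r + 1 + 1/2 = ?r + 3/2" by simp_all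
  ultimately have "F_closed \<mu> \<rho> \<sigma> (x + 1) = F_closed \<mu> \<rho> \<sigma> x"
    unfolding F_closed_def arc_length by (simp only:)
  then show ?thesis by (simp add: potential_def G)
qed

end

section \<open>Absolute continuity of primitives\<close>

lemma loc_integrable_min:
  assumes "loc_integrable p" shows "loc_integrable (\<lambda>x. min (p x) c)"
  unfolding loc_integrable_def
proof (intro allI)
  fix a b :: real
  have "integrable lborel (\<lambda>x. min (indicator {a..b} x *\<^sub>R p x) (indicator {a..b} x *\<^sub>R c))"
    using loc_integrableD[OF assms, of a b] loc_integrableD[OF loc_integrable_continuous[of "\<lambda>x. c"], of a b]
    by (intro integrable_min) (simp_all add: set_integrable_def)
  also have "(\<lambda>x. min (indicator {a..b} x *\<^sub>R p x) (indicator {a..b} x *\<^sub>R c)) = (\<lambda>x. indicator {a..b} x *\<^sub>R min (p x) c)"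
    by (auto simp: fun_eq_iff split: split_indicator)
  finally show "set_integrable lborel {a..b} (\<lambda>x. min (p x) c)" by (simp add: set_integrable_def)
qed

text \<open>Split \<open>p\<close> into \<open>min p N\<close> and the excess \<open>r N\<close>. By
  dominated convergence the excess has small integral over \<open>{a..b}\<close> for large
  \<open>N\<close>, and the bounded part contributes at most a multiple of the total length.\<close>

lemma primitive_abs_continuous:
  assumes p: "loc_integrable p" and pos: "\<And>x. p x \<ge> 0"
  shows "abs_continuous_on {a..b} (\<lambda>x. primitive p x + c)"
  unfolding abs_continuous_on_def
proof (intro allI impI)
  fix \<epsilon> :: real assume eps: "\<epsilon> > 0"
  define r where "r n x = p x - min (p x) (real n)" for n x
  have lr: "loc_integrable (r n)" for n unfolding r_def by (intro loc_integrable_diff loc_integrable_min p)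
  have r0: "r n x \<ge> 0" for n x by (simp add: r_def)
  have "(\<lambda>n. LINT x:{a..b}|lborel. r n x) \<longlonglongrightarrow> (LINT x:{a..b}|lborel. 0)"
    unfolding set_lebesgue_integral_def
  proof (rule integral_dominated_convergence[where w = "\<lambda>x. indicator {a..b} x *\<^sub>R p x"])
    show "integrable lborel (\<lambda>x. indicator {a..b} x *\<^sub>R p x)" using loc_integrableD[OF p] by (simp add: set_integrable_def)
    show "(\<lambda>x. indicator {a..b} x *\<^sub>R r n x) \<in> borel_measurable lborel" for n
      using loc_integrableD[OF lr, of a b n] by (auto simp: set_integrable_def)
    show "AE x in lborel. (\<lambda>n. indicator {a..b} x *\<^sub>R r n x) \<longlonglongrightarrow> indicator {a..b} x *\<^sub>R 0"
    proof (rule AE_I2)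
      fix x
      obtain N where N: "p x \<le> real N" using real_arch_simple by blast
      have "\<forall>\<^sub>F n in sequentially. indicator {a..b} x *\<^sub>R r n x = 0"
        using eventually_ge_at_top[of N] by eventually_elim (use N in \<open>auto simp: r_def\<close>)
      then show "(\<lambda>n. indicator {a..b} x *\<^sub>R r n x) \<longlonglongrightarrow> indicator {a..b} x *\<^sub>R 0"
        by (simp add: tendsto_eventually)
    qed
    show "AE x in lborel. norm (indicator {a..b} x *\<^sub>R r n x) \<le> indicator {a..b} x *\<^sub>R p x" for n
      by (rule AE_I2) (use pos r0 in \<open>auto simp: r_def split: split_indicator\<close>)
  qed simp
  then have "\<forall>\<^sub>F n in sequentially. (LINT x:{a..b}|lborel. r n x) < \<epsilon> / 2"
    using eps by (intro order_tendstoD(2)) auto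
  then obtain N where N: "(LINT x:{a..b}|lborel. r N x) < \<epsilon> / 2" by (auto simp: eventually_sequentially)
  show "\<exists>\<delta>>0. \<forall>(n :: nat) (l :: nat \<Rightarrow> real) u. (\<forall>i<n. l i \<le> u i \<and> {l i..u i} \<subseteq> {a..b}) \<and>
      (\<forall>i<n. \<forall>j<n. i \<noteq> j \<longrightarrow> {l i<..<u i} \<inter> {l j<..<u j} = {}) \<and> (\<Sum>i<n. u i - l i) < \<delta> \<longrightarrow>
      (\<Sum>i<n. \<bar>(primitive p (u i) + c) - (primitive p (l i) + c)\<bar>) < \<epsilon>"
  \<comment> \<open>Using \<open>N + 1\<close> as the height keeps the quotient valid when
    \<open>N = 0\<close>.\<close>
  proof (intro exI[of _ "\<epsilon> / (2 * (real N + 1))"] conjI allI impI)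
    show "0 < \<epsilon> / (2 * (real N + 1))" using eps by simp
    fix n :: nat and l u :: "nat \<Rightarrow> real"
    assume "(\<forall>i<n. l i \<le> u i \<and> {l i..u i} \<subseteq> {a..b}) \<and>
      (\<forall>i<n. \<forall>j<n. i \<noteq> j \<longrightarrow> {l i<..<u i} \<inter> {l j<..<u j} = {}) \<and> (\<Sum>i<n. u i - l i) < \<epsilon> / (2 * (real N + 1))"
    then have lu: "\<And>i. i < n \<Longrightarrow> l i \<le> u i" "\<And>i. i < n \<Longrightarrow> {l i..u i} \<subseteq> {a..b}"
      and disj: "\<And>i j. i < n \<Longrightarrow> j < n \<Longrightarrow> i \<noteq> j \<Longrightarrow> {l i<..<u i} \<inter> {l j<..<u j} = {}"
      and len: "(\<Sum>i<n. u i - l i) < \<epsilon> / (2 * (real N + 1))" by auto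
    have sr: "set_integrable lborel {l i<..<u i} (r N)" for i
      by (rule set_integrable_subset[OF loc_integrableD[OF lr, of "l i" "u i"]]) auto
    have piece: "\<bar>(primitive p (u i) + c) - (primitive p (l i) + c)\<bar> \<le> (LINT x:{l i<..<u i}|lborel. r N x) + (real N + 1) * (u i - l i)"
      if i: "i < n" for i
    proof -
      have "\<bar>(primitive p (u i) + c) - (primitive p (l i) + c)\<bar> = (LINT x:{l i..u i}|lborel. p x)"
        using primitive_diff_Icc[OF p lu(1)[OF i]] loc_integrable_LINT_nonneg[of "l i" "u i" p] pos by simp
      also have "\<dots> \<le> (LINT x:{l i..u i}|lborel. r N x + (real N + 1))"
        by (intro loc_integrable_LINT_mono p loc_integrable_add lr loc_integrable_continuous) (auto simp: r_def)
      also have "\<dots> = (LINT x:{l i..u i}|lborel. r N x) + (LINT x:{l i..u i}|lborel. real N + 1)"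
        by (intro set_integral_add loc_integrableD lr loc_integrable_continuous) auto
      also have "(LINT x:{l i..u i}|lborel. real N + 1) = (real N + 1) * (u i - l i)"
        using lu(1)[OF i] by (simp add: set_lebesgue_integral_def)
      \<comment> \<open>The given intervals may share endpoints; only the open ones are disjoint,
        and the endpoints are a null set.\<close>
      also have "(LINT x:{l i..u i}|lborel. r N x) = (LINT x:{l i<..<u i}|lborel. r N x)"
        by (rule set_integral_discrete_difference[of "{l i, u i}"]) auto
      finally show ?thesis .
    qed
    have "(\<Sum>i<n. \<bar>(primitive p (u i) + c) - (primitive p (l i) + c)\<bar>)
      \<le> (\<Sum>i<n. (LINT x:{l i<..<u i}|lborel. r N x) + (real N + 1) * (u i - l i))"
      by (intro sum_mono piece) auto
    also have "\<dots> = (\<Sum>i<n. LINT x:{l i<..<u i}|lborel. r N x) + (real N + 1) * (\<Sum>i<n. u i - l i)"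
      by (simp only: sum.distrib sum_distrib_left)
    also have "(\<Sum>i<n. LINT x:{l i<..<u i}|lborel. r N x) = (LINT x:(\<Union>i\<in>{..<n}. {l i<..<u i})|lborel. r N x)"
      using disj by (intro set_integral_finite_Union[symmetric] sr) (auto simp: disjoint_family_on_def)
    also have "\<dots> \<le> (LINT x:{a..b}|lborel. r N x)"
      unfolding set_lebesgue_integral_def
    proof (rule integral_mono)
      have "set_integrable lborel (\<Union>i\<in>{..<n}. {l i<..<u i}) (r N)" by (intro set_integrable_UN sr) auto
      then show "integrable lborel (\<lambda>x. indicator (\<Union>i\<in>{..<n}. {l i<..<u i}) x *\<^sub>R r N x)" by (simp add: set_integrable_def)
      show "integrable lborel (\<lambda>x. indicator {a..b} x *\<^sub>R r N x)" using loc_integrableD[OF lr] by (simp add: set_integrable_def)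
      fix x
      have "x \<in> {a..b}" if "x \<in> (\<Union>i\<in>{..<n}. {l i<..<u i})" using that lu(2) by force
      then show "indicator (\<Union>i\<in>{..<n}. {l i<..<u i}) x *\<^sub>R r N x \<le> indicator {a..b} x *\<^sub>R r N x"
        using r0[of N x] by (auto split: split_indicator)
    qed
    also have "(LINT x:{a..b}|lborel. r N x) + (real N + 1) * (\<Sum>i<n. u i - l i) < \<epsilon> / 2 + (real N + 1) * (\<epsilon> / (2 * (real N + 1)))"
      using N len by (intro add_strict_mono mult_strict_left_mono) auto
    also have "\<dots> = \<epsilon>" by (simp add: field_simps)
    finally show "(\<Sum>i<n. \<bar>(primitive p (u i) + c) - (primitive p (l i) + c)\<bar>) < \<epsilon>" by simp
  qed
qed

section \<open>The unit interval with Lebesgue measure\<close>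

text \<open>Restricting the space, not only the integrand, lets the lemmas on a general measure
  apply while pointwise facts need hold only on \<open>{0..1}\<close>.\<close>

definition M01 :: "real measure" where "M01 = restrict_space lborel {0..1}"

lemma space_M01 [simp]: "space M01 = {0..1}" by (simp add: M01_def space_restrict_space)

lemma M01_integral: "(\<integral>x. f x \<partial>M01) = (LINT x:{0..1}|lborel. f x :: real)"
  unfolding M01_def set_lebesgue_integral_def by (rule integral_restrict_space) simp

lemma M01_integrable: "integrable M01 f \<longleftrightarrow> set_integrable lborel {0..1} (f :: real \<Rightarrow> real)"
  unfolding M01_def set_integrable_def by (rule integrable_restrict_space) simp

lemma L2_01_square_integrable: "L2_01 g \<Longrightarrow> square_integrable M01 g"
  unfolding L2_01_def square_integrable_def M01_integrable set_borel_measurable_def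
  by (simp add: M01_def borel_measurable_restrict_space_iff)

lemma L2dist01_sqnorm: "L2dist01 f g = sqnorm M01 (\<lambda>x. f x - g x)"
  by (simp add: L2dist01_def sqnorm_def M01_integral)

lemma M01_borel: "f \<in> borel_measurable borel \<Longrightarrow> f \<in> borel_measurable M01"
  by (simp add: M01_def measurable_restrict_space1)

lemma square_integrable_continuous:
  assumes "continuous_on UNIV g" shows "square_integrable M01 g"
  unfolding square_integrable_def M01_integrable
  using assms by (intro conjI M01_borel borel_measurable_continuous_onI loc_integrableD loc_integrable_continuous continuous_intros)

lemma square_integrable_continuous_mult:
  assumes g: "continuous_on UNIV g" and f: "square_integrable M01 f" shows "square_integrable M01 (\<lambda>x. g x * f x)"
proof -
  have "compact (g ` {0..1})" by (intro compact_continuous_image continuous_on_subset[OF g]) auto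
  then obtain C where C: "\<And>x. x \<in> {0..1} \<Longrightarrow> \<bar>g x\<bar> \<le> C"
    by (metis bounded_iff compact_imp_bounded imageI real_norm_def)
  have m: "(\<lambda>x. g x * f x) \<in> borel_measurable M01"
    using f M01_borel[OF borel_measurable_continuous_onI[OF g]] by (auto simp: square_integrable_def)
  moreover have "integrable M01 (\<lambda>x. (g x * f x)\<^sup>2)"
  proof (rule Bochner_Integration.integrable_bound)
    show "integrable M01 (\<lambda>x. C\<^sup>2 * (f x)\<^sup>2)" using f by (simp add: square_integrable_def)
    show "AE x in M01. norm ((g x * f x)\<^sup>2) \<le> norm (C\<^sup>2 * (f x)\<^sup>2)"
    proof (rule AE_I2)
      fix x assume "x \<in> space M01"
      then have "\<bar>g x\<bar>\<^sup>2 \<le> C\<^sup>2" using C[of x] by (intro power_mono) auto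
      then show "norm ((g x * f x)\<^sup>2) \<le> norm (C\<^sup>2 * (f x)\<^sup>2)" by (simp add: power_mult_distrib mult_right_mono)
    qed
  qed (use m in measurable)
  ultimately show ?thesis by (simp add: square_integrable_def)
qed

lemma square_integrable_cong: "(\<And>x. x \<in> space M \<Longrightarrow> f x = g x) \<Longrightarrow> square_integrable M f \<longleftrightarrow> square_integrable M g"
  unfolding square_integrable_def by (intro conj_cong measurable_cong Bochner_Integration.integrable_cong) auto

lemma sqnorm_diff_le:
  assumes "square_integrable M f" "square_integrable M g"
  shows "sqnorm M (\<lambda>x. f x - g x) \<le> sqnorm M f + sqnorm M g"
proof -
  have "(sqnorm M (\<lambda>x. f x - g x))\<^sup>2 = (sqnorm M f)\<^sup>2 - 2 * (\<integral>x. f x * g x \<partial>M) + (sqnorm M g)\<^sup>2"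
    using integral_square_add[OF assms, of "-1"] by simp
  also have "\<dots> \<le> (sqnorm M f)\<^sup>2 + 2 * (sqnorm M f * sqnorm M g) + (sqnorm M g)\<^sup>2"
    using Cauchy_Schwarz_integral[OF assms] by linarith
  also have "\<dots> = (sqnorm M f + sqnorm M g)\<^sup>2" by (simp add: power2_sum)
  finally show ?thesis by (rule power2_le_imp_le) simp
qed

lemma sqnorm_le_const:
  assumes "square_integrable M01 f" "\<And>x. x \<in> {0..1} \<Longrightarrow> \<bar>f x\<bar> \<le> c" "c \<ge> 0"
  shows "sqnorm M01 f \<le> c"
proof -
  have "(\<integral>x. (f x)\<^sup>2 \<partial>M01) \<le> (LINT x:{0..1::real}|lborel. c\<^sup>2)"
    unfolding M01_integral
  proof (rule set_integral_mono)
    show "set_integrable lborel {0..1} (\<lambda>x. (f x)\<^sup>2)" using assms(1) by (simp add: square_integrable_def M01_integrable)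
    show "set_integrable lborel {0..1} (\<lambda>x :: real. c\<^sup>2)" by (intro loc_integrableD loc_integrable_continuous) auto
    fix x :: real assume "x \<in> {0..1}"
    from power_mono[OF assms(2)[OF this], of 2] show "(f x)\<^sup>2 \<le> c\<^sup>2" by simp
  qed
  also have "\<dots> = c\<^sup>2" by (simp add: set_lebesgue_integral_def)
  finally have "sqrt (\<integral>x. (f x)\<^sup>2 \<partial>M01) \<le> sqrt (c\<^sup>2)" by (rule real_sqrt_le_mono)
  then show ?thesis using assms(3) by (simp add: sqnorm_def)
qed

section \<open>Mean-square derivatives of families on the unit interval\<close>

lemma L2_derivative_diff:
  assumes X: "\<And>s. s \<ge> 0 \<Longrightarrow> square_integrable M (X s)" "square_integrable M X'" and Z: "\<And>s. s \<ge> 0 \<Longrightarrow> square_integrable M (Z s)" "square_integrable M Z'" and t: "t \<ge> 0"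
    and limX: "((\<lambda>s. sqnorm M (\<lambda>x. X s x - X t x - (s - t) * X' x) / \<bar>s - t\<bar>) \<longlongrightarrow> 0) (at t within {0..})"
    and limZ: "((\<lambda>s. sqnorm M (\<lambda>x. Z s x - Z t x - (s - t) * Z' x) / \<bar>s - t\<bar>) \<longlongrightarrow> 0) (at t within {0..})"
  shows "((\<lambda>s. sqnorm M (\<lambda>x. (X s x - Z s x) - (X t x - Z t x) - (s - t) * (X' x - Z' x)) / \<bar>s - t\<bar>) \<longlongrightarrow> 0) (at t within {0..})"
proof (rule real_tendsto_sandwich[OF _ _ tendsto_const])
  let ?X = "\<lambda>s x. X s x - X t x - (s - t) * X' x" and ?Z = "\<lambda>s x. Z s x - Z t x - (s - t) * Z' x"
  show "((\<lambda>s. sqnorm M (?X s) / \<bar>s - t\<bar> + sqnorm M (?Z s) / \<bar>s - t\<bar>) \<longlongrightarrow> 0) (at t within {0..})"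
    using tendsto_add[OF limX limZ] by simp
  show "\<forall>\<^sub>F s in at t within {0..}. sqnorm M (\<lambda>x. (X s x - Z s x) - (X t x - Z t x) - (s - t) * (X' x - Z' x)) / \<bar>s - t\<bar>
    \<le> sqnorm M (?X s) / \<bar>s - t\<bar> + sqnorm M (?Z s) / \<bar>s - t\<bar>"
    using eventually_within_ge
  proof eventually_elim
    case (elim s)
    have "(\<lambda>x. (X s x - Z s x) - (X t x - Z t x) - (s - t) * (X' x - Z' x)) = (\<lambda>x. ?X s x - ?Z s x)"
      by (simp add: fun_eq_iff algebra_simps)
    moreover have "square_integrable M (?X s)" "square_integrable M (?Z s)"
      using elim t X Z by (auto intro!: square_integrable_diff square_integrable_cmult)
    ultimately show ?case using sqnorm_diff_le[of M "?X s" "?Z s"]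
      by (simp add: divide_right_mono flip: add_divide_distrib)
  qed
qed simp

lemma time_MVT:
  assumes f: "\<And>t. t \<ge> 0 \<Longrightarrow> (f has_real_derivative f' t) (at t within {0..})" and "s \<ge> 0" "t \<ge> 0"
  obtains \<xi> where "\<xi> \<ge> 0" "\<bar>\<xi> - t\<bar> \<le> \<bar>s - t\<bar>" "f s - f t = (s - t) * f' \<xi>"
proof -
  have *: "\<exists>\<xi>. a < \<xi> \<and> \<xi> < b \<and> f b - f a = (b - a) * f' \<xi>" if "0 \<le> a" "a < b" for a b
  proof -
    have "\<exists>x\<in>{a<..<b}. f b - f a = (\<lambda>h. f' x * h) (b - a)"
    proof (rule mvt_simple[OF that(2)])
      fix x assume "a \<le> x" "x \<le> b"
      then have "(f has_real_derivative f' x) (at x within {a..b})"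
        using that by (intro has_field_derivative_subset[OF f]) auto
      then show "(f has_derivative (\<lambda>h. f' x * h)) (at x within {a..b})" by (simp add: has_field_derivative_def)
    qed
    then show ?thesis by (auto simp: mult.commute)
  qed
  show thesis
  proof (cases s t rule: linorder_cases)
    case less
    then obtain \<xi> where "s < \<xi>" "\<xi> < t" "f t - f s = (t - s) * f' \<xi>" using *[of s t] assms by auto
    then show ?thesis using assms by (intro that[of \<xi>]) (auto simp: algebra_simps)
  next
    case greater
    then obtain \<xi> where "t < \<xi>" "\<xi> < s" "f s - f t = (s - t) * f' \<xi>" using *[of t s] assms by auto
    then show ?thesis using assms by (intro that[of \<xi>]) auto
  qed (use that[of t] assms in auto)
qed

text \<open>The mean value theorem in time and uniform continuity of \<open>v\<close> bound the
  remainder uniformly on \<open>{0..1}\<close>, and a uniform bound dominates the norm there. This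
  places \<open>z\<close> in the same setting as \<open>\<rho>\<close>.\<close>

lemma L2_derivative_C1:
  assumes z: "\<And>t x. t \<ge> 0 \<Longrightarrow> ((\<lambda>t. z t x) has_real_derivative v t x) (at t within {0..})"
    and "jointly_cont z" "jointly_cont v" and t: "t \<ge> 0"
  shows "((\<lambda>s. sqnorm M01 (\<lambda>x. z s x - z t x - (s - t) * v t x) / \<bar>s - t\<bar>) \<longlongrightarrow> 0) (at t within {0..})"
  unfolding tendsto_iff
proof (intro allI impI)
  fix e :: real assume e: "e > 0"
  obtain d where d: "d > 0" "\<And>s r x y. s \<in> {0..t+1} \<Longrightarrow> r \<in> {0..t+1} \<Longrightarrow> x \<in> {0..1} \<Longrightarrow> y \<in> {0..1} \<Longrightarrow>
    \<bar>s - r\<bar> < d \<Longrightarrow> \<bar>x - y\<bar> < d \<Longrightarrow> \<bar>v s x - v r y\<bar> < e / 2"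
    using jointly_cont_uniform[OF assms(3), of "e/2"] e by (metis half_gt_zero)
  show "\<forall>\<^sub>F s in at t within {0..}. dist (sqnorm M01 (\<lambda>x. z s x - z t x - (s - t) * v t x) / \<bar>s - t\<bar>) 0 < e"
    unfolding eventually_at
  proof (intro exI[of _ "min d 1"] conjI ballI impI)
    fix s assume "s \<in> {0..}" "s \<noteq> t \<and> dist s t < min d 1"
    then have s: "s \<ge> 0" "s \<noteq> t" "\<bar>s - t\<bar> < d" "\<bar>s - t\<bar> < 1" by (auto simp: dist_real_def)
    have "sqnorm M01 (\<lambda>x. z s x - z t x - (s - t) * v t x) \<le> \<bar>s - t\<bar> * (e / 2)"
    proof (rule sqnorm_le_const)
      show "square_integrable M01 (\<lambda>x. z s x - z t x - (s - t) * v t x)"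
        using s t assms by (intro square_integrable_continuous continuous_intros jointly_cont_slice) auto
      fix x :: real assume x: "x \<in> {0..1}"
      obtain \<xi> where \<xi>: "\<xi> \<ge> 0" "\<bar>\<xi> - t\<bar> \<le> \<bar>s - t\<bar>" "z s x - z t x = (s - t) * v \<xi> x"
        using time_MVT[OF z s(1) t] by metis
      have "\<bar>v \<xi> x - v t x\<bar> < e / 2" using d(2)[of \<xi> t x x] \<xi> s t x d(1) by auto
      moreover have "z s x - z t x - (s - t) * v t x = (s - t) * (v \<xi> x - v t x)" using \<xi>(3) by (simp add: algebra_simps)
      ultimately show "\<bar>z s x - z t x - (s - t) * v t x\<bar> \<le> \<bar>s - t\<bar> * (e / 2)"
        by (simp only: abs_mult) (intro mult_left_mono; simp)
    qed (use e in auto)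
    then have "sqnorm M01 (\<lambda>x. z s x - z t x - (s - t) * v t x) / \<bar>s - t\<bar> \<le> e / 2"
      using s by (simp add: pos_divide_le_eq mult.commute)
    then show "dist (sqnorm M01 (\<lambda>x. z s x - z t x - (s - t) * v t x) / \<bar>s - t\<bar>) 0 < e"
      using e unfolding dist_real_def by (smt (verit) divide_nonneg_nonneg sqnorm_nonneg abs_ge_zero field_sum_of_halves)
  qed (use d in auto)
qed

section \<open>Regularity of the flow\<close>

text \<open>The filter is nontrivial even at 0, where only approach from the right remains.\<close>

lemma within_deriv_unique:
  assumes "(f has_real_derivative a) (at t within {0..})" "(f has_real_derivative b) (at t within {0..})" "t \<ge> (0::real)"
  shows "a = b"
proof -
  have "at_right t \<le> at t within {0..}" using assms(3) by (intro at_le) auto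
  then have "at t within {0..} \<noteq> bot" using trivial_limit_at_right_real[of t] by (metis bot.extremum_uniqueI)
  then show ?thesis using assms unfolding has_field_derivative_iff by (metis tendsto_unique)
qed

locale ch_solution =
  fixes u0 u0d :: "real \<Rightarrow> real" and \<rho> \<rho>t :: "real \<Rightarrow> real \<Rightarrow> real"
  assumes H1: "H1_S1 u0 u0d"
    and sol: "is_global_solution u0 u0d \<rho> \<rho>t"
    and one: "\<forall>t\<ge>0. (LBINT x=0..1. (\<rho> t x)^2) = 1"
begin

definition \<mu> where "\<mu> = (LBINT x=0..1. u0 x)"

abbreviation q where "q t x \<equiv> potential \<mu> (\<rho> t) (\<rho>t t) x"

lemma solution_square_integrable: "t \<ge> 0 \<Longrightarrow> square_integrable M01 (\<rho> t)" "t \<ge> 0 \<Longrightarrow> square_integrable M01 (\<rho>t t)"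
  using sol by (auto simp: is_global_solution_def intro: L2_01_square_integrable)

lemma solution_periodic: "t \<ge> 0 \<Longrightarrow> periodic1 (\<rho> t)" "t \<ge> 0 \<Longrightarrow> periodic1 (\<rho>t t)"
  using sol by (auto simp: is_global_solution_def)

lemma solution_shift: "t \<ge> 0 \<Longrightarrow> \<rho> t (x + 1) = \<rho> t x" "t \<ge> 0 \<Longrightarrow> \<rho>t t (x + 1) = \<rho>t t x"
  using solution_periodic by (auto simp: periodic1_def)

lemma squares_set_integrable:
  assumes "t \<ge> 0"
  shows "set_integrable lborel {0..1} (\<lambda>x. (\<rho> t x)\<^sup>2)" "set_integrable lborel {0..1} (\<lambda>x. \<rho> t x * \<rho>t t x)"
    "set_integrable lborel {0..1} (\<lambda>x. (\<rho>t t x)\<^sup>2)"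
  using solution_square_integrable[OF assms] square_integrable_mult[OF solution_square_integrable[OF assms]] by (auto simp: M01_integrable square_integrable_def)

lemma squares_loc_integrable:
  assumes "t \<ge> 0"
  shows "loc_integrable (\<lambda>x. (\<rho> t x)\<^sup>2)" "loc_integrable (\<lambda>x. \<rho> t x * \<rho>t t x)" "loc_integrable (\<lambda>x. (\<rho>t t x)\<^sup>2)"
  by (intro periodic_loc_integrable squares_set_integrable assms; simp add: periodic1_def solution_shift assms)+

lemma q_cont: "t \<ge> 0 \<Longrightarrow> continuous_on UNIV (q t)"
  by (intro potential_cont squares_loc_integrable)

lemma f_op_eq_q: "t \<ge> 0 \<Longrightarrow> x \<in> {0..1} \<Longrightarrow> f_op \<mu> (\<rho> t) (\<rho>t t) x = q t x * \<rho> t x"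
  by (intro f_op_eq squares_loc_integrable)

lemma f_op_square_integrable: 
  assumes "t \<ge> 0" shows "square_integrable M01 (f_op \<mu> (\<rho> t) (\<rho>t t))"
proof -
  have "square_integrable M01 (f_op \<mu> (\<rho> t) (\<rho>t t)) \<longleftrightarrow> square_integrable M01 (\<lambda>x. q t x * \<rho> t x)"
    by (rule square_integrable_cong) (use f_op_eq_q assms in auto)
  then show ?thesis using square_integrable_continuous_mult[OF q_cont solution_square_integrable(1)] assms by simp
qed

lemma solution_L2_deriv:
  assumes "t \<ge> 0"
  shows "((\<lambda>s. sqnorm M01 (\<lambda>x. \<rho> s x - \<rho> t x - (s - t) * \<rho>t t x) / \<bar>s - t\<bar>) \<longlongrightarrow> 0) (at t within {0..})"
    "((\<lambda>s. sqnorm M01 (\<lambda>x. \<rho>t s x - \<rho>t t x - (s - t) * f_op \<mu> (\<rho> t) (\<rho>t t) x) / \<bar>s - t\<bar>) \<longlongrightarrow> 0) (at t within {0..})"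
  using sol assms unfolding is_global_solution_def L2_deriv_at_def L2dist01_sqnorm \<mu>_def by simp_all

lemma solution_L2_cont:
  assumes "t \<ge> 0"
  shows "((\<lambda>s. sqnorm M01 (\<lambda>x. \<rho> s x - \<rho> t x)) \<longlongrightarrow> 0) (at t within {0..})"
    "((\<lambda>s. sqnorm M01 (\<lambda>x. \<rho>t s x - \<rho>t t x)) \<longlongrightarrow> 0) (at t within {0..})"
  using sqnorm_tendsto[OF solution_square_integrable(1) solution_square_integrable(2)[OF assms] assms solution_L2_deriv(1)[OF assms]]
    sqnorm_tendsto[OF solution_square_integrable(2) f_op_square_integrable[OF assms] assms solution_L2_deriv(2)[OF assms]] by simp_all

lemma squares_L1_cont:
  "L1_cont (\<lambda>t x. (\<rho> t x)\<^sup>2)" "L1_cont (\<lambda>t x. \<rho> t x * \<rho>t t x)" "L1_cont (\<lambda>t x. (\<rho>t t x)\<^sup>2)"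
proof -
  show "L1_cont (\<lambda>t x. (\<rho> t x)\<^sup>2)"
    by (rule periodic_L1_cont)
      (use squares_set_integrable L1_mult_tendsto[OF solution_square_integrable(1) solution_square_integrable(1) _ solution_L2_cont(1) solution_L2_cont(1)] in
        \<open>auto simp: periodic1_def solution_shift M01_integral power2_eq_square\<close>)
  show "L1_cont (\<lambda>t x. \<rho> t x * \<rho>t t x)"
    by (rule periodic_L1_cont)
      (use squares_set_integrable L1_mult_tendsto[OF solution_square_integrable _ solution_L2_cont] in
        \<open>auto simp: periodic1_def solution_shift M01_integral\<close>)
  show "L1_cont (\<lambda>t x. (\<rho>t t x)\<^sup>2)"
    by (rule periodic_L1_cont)
      (use squares_set_integrable L1_mult_tendsto[OF solution_square_integrable(2) solution_square_integrable(2) _ solution_L2_cont(2) solution_L2_cont(2)] in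
        \<open>auto simp: periodic1_def solution_shift M01_integral power2_eq_square\<close>)
qed

lemma primitive_one: "t \<ge> 0 \<Longrightarrow> primitive (\<lambda>x. (\<rho> t x)\<^sup>2) 1 = 1"
  using one by (simp add: primitive_def one_ereal_def)

lemma primitive_zero:
  assumes t: "t \<ge> 0" shows "primitive (\<lambda>x. \<rho> t x * \<rho>t t x) 1 = 0"
proof -
  have "((\<lambda>s. \<integral>x. (\<rho> s x)\<^sup>2 \<partial>M01) has_real_derivative 2 * (\<integral>x. \<rho> t x * \<rho>t t x \<partial>M01)) (at t within {0..})"
    by (rule integral_square_DERIV[OF solution_square_integrable(1) solution_square_integrable(2)[OF t] t solution_L2_deriv(1)[OF t]])
  moreover have "(\<integral>x. (\<rho> s x)\<^sup>2 \<partial>M01) = 1" if "s \<ge> 0" for s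
    using primitive_one[OF that] by (simp add: primitive_1 M01_integral)
  ultimately have "((\<lambda>s. 1) has_real_derivative 2 * (\<integral>x. \<rho> t x * \<rho>t t x \<partial>M01)) (at t within {0..})"
    using t by (elim has_field_derivative_transform_within[of _ _ _ _ 1]) auto
  from within_deriv_unique[OF this DERIV_const t] show ?thesis by (simp add: primitive_1 M01_integral)
qed

lemma q_periodic: "t \<ge> 0 \<Longrightarrow> q t (x + 1) = q t x"
  by (intro potential_periodic squares_loc_integrable solution_periodic primitive_one primitive_zero)

lemma q_jointly_cont: "jointly_cont q"
  using jointly_Ck_potential[of 0 \<rho> \<rho>t \<mu>] squares_L1_cont by simp

lemma u0d_loc_integrable: "loc_integrable u0d"
proof (rule periodic_loc_integrable)
  show "periodic1 u0d" using H1 unfolding H1_S1_def by blast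
  have "square_integrable M01 u0d" using H1 L2_01_square_integrable unfolding H1_S1_def by blast
  from square_integrable_mult[OF this square_integrable_continuous[of "\<lambda>x. 1"]] show "set_integrable lborel {0..1} u0d"
    by (simp add: M01_integrable)
qed

lemma primitive_u0d: "primitive u0d x = u0 x - u0 0"
proof -
  have "u0 x = u0 0 + primitive u0d x" using H1 unfolding H1_S1_def primitive_def by blast
  then show ?thesis by simp
qed

section \<open>The pointwise representative of the solution\<close>

context
  fixes D1 :: "real \<Rightarrow> real" and z v :: "real \<Rightarrow> real \<Rightarrow> real"
  assumes D1: "\<And>x. (u0 has_real_derivative D1 x) (at x)" "continuous_on UNIV D1"
    and ode: "linear_ode q (\<lambda>t x. 0) z v" and z0: "z 0 = (\<lambda>x. 1)" and v0: "v 0 = (\<lambda>x. 1/2 * D1 x)"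
begin

lemma D1_periodic: "D1 (x + 1) = D1 x"
proof -
  have "(\<lambda>x. u0 (x + 1)) = u0" using H1 unfolding H1_S1_def periodic1_def by blast
  moreover have "((\<lambda>x. u0 (x + 1)) has_real_derivative D1 (x + 1)) (at x)"
    using D1(1)[of "x + 1"] DERIV_shift by blast
  ultimately show ?thesis using D1(1)[of x] DERIV_unique by metis
qed

text \<open>The given \<open>u0d\<close> is only a weak derivative; it has the same primitive as the
  classical derivative \<open>D1\<close>, so they differ on a null set.\<close>

lemma u0d_AE: "AE x in lborel. u0d x = D1 x"
proof -
  have l: "loc_integrable D1" by (intro loc_integrable_continuous D1)
  have "((\<lambda>x. primitive D1 x - u0 x) has_real_derivative 0) (at x)" for x
    using DERIV_diff[OF primitive_DERIV[OF D1(2), of x] D1(1)[of x]] by simp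
  then have eq: "primitive D1 x - u0 x = primitive D1 0 - u0 0" for x
    using DERIV_isconst_all[of "\<lambda>x. primitive D1 x - u0 x"] by blast
  have "u0 x - u0 0 - primitive D1 x = 0" for x
    using eq[of x] primitive_0[of D1] by linarith
  then have "primitive (\<lambda>x. u0d x - D1 x) x = 0" for x
    by (simp add: primitive_sub[OF u0d_loc_integrable l] primitive_u0d)
  from loc_integrable_AE_0[OF loc_integrable_diff[OF u0d_loc_integrable l] this] show ?thesis by simp
qed

lemma zv_jointly_cont: "jointly_cont z" "jointly_cont v"
proof -
  have "continuous_on UNIV (z 0)" "continuous_on UNIV (v 0)"
    unfolding z0 v0 by (intro continuous_intros D1(2))+
  then show "jointly_cont z" "jointly_cont v" using linear_ode_jointly_cont[OF ode q_jointly_cont jointly_cont_const] by simp_all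
qed

text \<open>Uniqueness for the linear equation: by periodicity of \<open>q\<close> and of the data
  the solutions at \<open>x + 1\<close> and \<open>x\<close> solve the same problem. The stability
  estimate is used with all errors 0.\<close>

lemma zv_periodic:
  assumes t: "t \<ge> 0" shows "z t (x + 1) = z t x" "v t (x + 1) = v t x"
proof -
  obtain Q where Q: "\<And>s. s \<in> {0..t} \<Longrightarrow> \<bar>q s x\<bar> \<le> Q"
    using time_bound[OF jointly_cont_time[OF q_jointly_cont]] by metis
  have "\<bar>z t (x + 1) - z t x\<bar> \<le> stability_const Q t * 0 \<and> \<bar>v t (x + 1) - v t x\<bar> \<le> stability_const Q t * 0"
  proof (rule linear_ode_stability[where e = "\<lambda>t. z t (x + 1) - z t x" and v = "\<lambda>t. v t (x + 1) - v t x" and q = "\<lambda>t. q t x" and h = "\<lambda>t. 0"])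
    fix s :: real
    show "((\<lambda>t. z t (x + 1) - z t x) has_real_derivative v s (x + 1) - v s x) (at s within {0..})" if "s \<ge> 0"
      using that by (intro DERIV_diff linear_odeD[OF ode])
    show "((\<lambda>t. v t (x + 1) - v t x) has_real_derivative q s x * (z s (x + 1) - z s x) + 0) (at s within {0..})" if s: "s \<ge> 0"
      by (rule DERIV_cong[OF DERIV_diff[OF linear_odeD(2)[OF ode s, of "x + 1"] linear_odeD(2)[OF ode s, of x]]])
        (simp only: q_periodic[OF s], simp add: algebra_simps)
  qed (use Q t z0 v0 D1_periodic in auto)
  then show "z t (x + 1) = z t x" "v t (x + 1) = v t x" by auto
qed

text \<open>Both pairs obey the equation with the same \<open>q\<close>, computed from the solution
  itself, so on \<open>{0..1}\<close> their difference satisfies a linear homogeneous system. Its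
  energy \<open>N\<close> obeys \<open>N' \<le> (1 + Q) * N\<close> and starts at 0.\<close>

lemma L2_uniqueness:
  assumes t: "t \<ge> 0"
  shows "(\<integral>x. (\<rho> t x - z t x)\<^sup>2 \<partial>M01) = 0" "(\<integral>x. (\<rho>t t x - v t x)\<^sup>2 \<partial>M01) = 0"
proof -
  define X where "X s x = \<rho> s x - z s x" for s x
  define V where "V s x = \<rho>t s x - v s x" for s x
  \<comment> \<open>Left in terms of \<open>f_op\<close>, for which the mean-square derivative is
    given; the form \<open>q s x * X s x\<close> is substituted only under the integral, where
    \<open>x\<close> lies in \<open>{0..1}\<close>.\<close>
  define W where "W s x = f_op \<mu> (\<rho> s) (\<rho>t s) x - q s x * z s x" for s x
  have zsq: "square_integrable M01 (z s)" "square_integrable M01 (v s)" "square_integrable M01 (\<lambda>x. q s x * z s x)" if "s \<ge> 0" for s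
    using zv_jointly_cont that by (auto intro!: square_integrable_continuous jointly_cont_slice jointly_cont_mult[OF q_jointly_cont] continuous_intros q_cont)
  have sqX: "square_integrable M01 (X s)" and sqV: "square_integrable M01 (V s)" and sqW: "square_integrable M01 (W s)" if "s \<ge> 0" for s
    unfolding X_def V_def W_def using that by (intro square_integrable_diff solution_square_integrable zsq f_op_square_integrable; simp)+
  have z': "((\<lambda>t. z t x) has_real_derivative v s x) (at s within {0..})"
    and v': "((\<lambda>t. v t x) has_real_derivative q s x * z s x) (at s within {0..})" if "s \<ge> 0" for s x
    using linear_odeD[OF ode that, of x] by simp_all
  define N where "N s = (\<integral>x. (X s x)\<^sup>2 \<partial>M01) + (\<integral>x. (V s x)\<^sup>2 \<partial>M01)" for s
  obtain Q where Q: "Q > 0" "\<And>s x. s \<in> {0..t} \<Longrightarrow> x \<in> {0..1} \<Longrightarrow> \<bar>q s x\<bar> \<le> Q"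
    using jointly_cont_bound[OF q_jointly_cont] by metis
  have "N t \<le> (N 0 + 0 * t) * exp ((1 + Q) * t)"
  proof (rule gronwall)
    fix s assume s: "s \<in> {0..t}"
    then have s0: "s \<ge> 0" by simp
    have dX: "((\<lambda>s. \<integral>x. (X s x)\<^sup>2 \<partial>M01) has_real_derivative 2 * (\<integral>x. X s x * V s x \<partial>M01)) (at s within {0..})"
    proof (rule integral_square_DERIV[OF sqX sqV[OF s0] s0])
      show "((\<lambda>r. sqnorm M01 (\<lambda>x. X r x - X s x - (r - s) * V s x) / \<bar>r - s\<bar>) \<longlongrightarrow> 0) (at s within {0..})"
        unfolding X_def V_def
        by (rule L2_derivative_diff[OF solution_square_integrable(1) solution_square_integrable(2)[OF s0] zsq(1) zsq(2)[OF s0] s0 solution_L2_deriv(1)[OF s0] L2_derivative_C1[OF z' zv_jointly_cont s0]])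
    qed
    have dV: "((\<lambda>s. \<integral>x. (V s x)\<^sup>2 \<partial>M01) has_real_derivative 2 * (\<integral>x. V s x * W s x \<partial>M01)) (at s within {0..})"
    proof (rule integral_square_DERIV[OF sqV sqW[OF s0] s0])
      show "((\<lambda>r. sqnorm M01 (\<lambda>x. V r x - V s x - (r - s) * W s x) / \<bar>r - s\<bar>) \<longlongrightarrow> 0) (at s within {0..})"
        unfolding V_def W_def
        by (rule L2_derivative_diff[OF solution_square_integrable(2) f_op_square_integrable[OF s0] zsq(2) zsq(3)[OF s0] s0 solution_L2_deriv(2)[OF s0]
              L2_derivative_C1[OF v' zv_jointly_cont(2) jointly_cont_mult[OF q_jointly_cont zv_jointly_cont(1)] s0]])
    qed
    show "(N has_real_derivative 2 * (\<integral>x. X s x * V s x \<partial>M01) + 2 * (\<integral>x. V s x * W s x \<partial>M01)) (at s within {0..})"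
      unfolding N_def by (rule DERIV_add[OF dX dV])
    have iXV: "integrable M01 (\<lambda>x. (X s x)\<^sup>2)" "integrable M01 (\<lambda>x. (V s x)\<^sup>2)"
      "integrable M01 (\<lambda>x. X s x * V s x)" "integrable M01 (\<lambda>x. V s x * W s x)"
      using sqX[OF s0] sqV[OF s0] sqW[OF s0] by (auto simp: square_integrable_def intro: square_integrable_mult)
    have "2 * (\<integral>x. X s x * V s x \<partial>M01) + 2 * (\<integral>x. V s x * W s x \<partial>M01) = (\<integral>x. 2 * (X s x * V s x) + 2 * (V s x * W s x) \<partial>M01)"
      using iXV by simp
    also have "\<dots> \<le> (\<integral>x. (1 + Q) * ((X s x)\<^sup>2 + (V s x)\<^sup>2) \<partial>M01)"
    proof (rule integral_mono)
      show "integrable M01 (\<lambda>x. 2 * (X s x * V s x) + 2 * (V s x * W s x))"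
        "integrable M01 (\<lambda>x. (1 + Q) * ((X s x)\<^sup>2 + (V s x)\<^sup>2))" using iXV by simp_all
      fix x assume "x \<in> space M01"
      then have x: "x \<in> {0..1}" by simp
      have 1: "2 * \<bar>X s x * V s x\<bar> \<le> (X s x)\<^sup>2 + (V s x)\<^sup>2"
        using sum_squares_bound[of "\<bar>X s x\<bar>" "\<bar>V s x\<bar>"] by (simp add: abs_mult)
      have "2 * (V s x * W s x) = q s x * (2 * (X s x * V s x))"
        unfolding W_def f_op_eq_q[OF s0 x] X_def by (simp add: algebra_simps)
      also have "\<dots> \<le> \<bar>q s x\<bar> * (2 * \<bar>X s x * V s x\<bar>)"
        using abs_ge_self[of "q s x * (2 * (X s x * V s x))"] by (simp add: abs_mult)
      also have "\<dots> \<le> Q * ((X s x)\<^sup>2 + (V s x)\<^sup>2)"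
        using 1 Q(2)[OF s x] Q(1) by (intro mult_mono) auto
      finally show "2 * (X s x * V s x) + 2 * (V s x * W s x) \<le> (1 + Q) * ((X s x)\<^sup>2 + (V s x)\<^sup>2)"
        using 1 abs_ge_self[of "X s x * V s x"] unfolding distrib_right[of 1 Q] mult_1 by linarith
    qed
    also have "\<dots> = (1 + Q) * N s + 0" unfolding N_def using iXV by simp
    finally show "2 * (\<integral>x. X s x * V s x \<partial>M01) + 2 * (\<integral>x. V s x * W s x \<partial>M01) \<le> (1 + Q) * N s + 0" .
  qed (use t Q in auto)
  moreover have "N 0 = 0"
  proof -
    have "(\<integral>x. (X 0 x)\<^sup>2 \<partial>M01) = 0"
      using sol by (simp add: is_global_solution_def L2dist01_sqnorm sqnorm_def X_def z0)
    \<comment> \<open>The initial condition speaks of \<open>u0d\<close> and the scalar problem of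
      \<open>D1\<close>, hence the comparison almost everywhere.\<close>
    moreover have "(\<integral>x. (V 0 x)\<^sup>2 \<partial>M01) = (\<integral>x. (\<rho>t 0 x - u0d x / 2)\<^sup>2 \<partial>M01)"
    proof (rule integral_cong_AE)
      have "AE x in M01. u0d x = D1 x"
        unfolding M01_def using u0d_AE by (subst AE_restrict_space_iff) (auto elim: eventually_mono)
      then show "AE x in M01. (V 0 x)\<^sup>2 = (\<rho>t 0 x - u0d x / 2)\<^sup>2"
        by eventually_elim (simp add: V_def v0)
      show "(\<lambda>x. (V 0 x)\<^sup>2) \<in> borel_measurable M01" using sqV[of 0] by (auto simp: square_integrable_def)
      have "u0d \<in> borel_measurable M01" using H1 L2_01_square_integrable unfolding H1_S1_def square_integrable_def by blast
      then show "(\<lambda>x. (\<rho>t 0 x - u0d x / 2)\<^sup>2) \<in> borel_measurable M01" using solution_square_integrable(2)[of 0] by (auto simp: square_integrable_def)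
    qed
    moreover have "(\<integral>x. (\<rho>t 0 x - u0d x / 2)\<^sup>2 \<partial>M01) = 0"
      using sol by (simp add: is_global_solution_def L2dist01_sqnorm sqnorm_def)
    ultimately show ?thesis by (simp add: N_def)
  qed
  ultimately have "(\<integral>x. (X t x)\<^sup>2 \<partial>M01) + (\<integral>x. (V t x)\<^sup>2 \<partial>M01) \<le> 0" by (simp add: N_def)
  moreover have "(\<integral>x. (X t x)\<^sup>2 \<partial>M01) \<ge> 0" "(\<integral>x. (V t x)\<^sup>2 \<partial>M01) \<ge> 0" by simp_all
  ultimately have "(\<integral>x. (X t x)\<^sup>2 \<partial>M01) = 0" "(\<integral>x. (V t x)\<^sup>2 \<partial>M01) = 0" by linarith+
  then show "(\<integral>x. (\<rho> t x - z t x)\<^sup>2 \<partial>M01) = 0" "(\<integral>x. (\<rho>t t x - v t x)\<^sup>2 \<partial>M01) = 0"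
    by (simp_all add: X_def V_def)
qed

text \<open>Equality in mean square on one period extends to the line because both functions are
  periodic.\<close>

lemma solution_AE_eq:
  assumes t: "t \<ge> 0"
  shows "AE x in lborel. \<rho> t x = z t x" "AE x in lborel. \<rho>t t x = v t x"
proof -
  have zsq: "square_integrable M01 (\<lambda>x. \<rho> t x - z t x)" "square_integrable M01 (\<lambda>x. \<rho>t t x - v t x)"
    using t by (intro square_integrable_diff solution_square_integrable square_integrable_continuous jointly_cont_slice[OF zv_jointly_cont(1)] jointly_cont_slice[OF zv_jointly_cont(2)]; simp)+
  have p: "periodic1 (\<lambda>x. (\<rho> t x - z t x)\<^sup>2)" "periodic1 (\<lambda>x. (\<rho>t t x - v t x)\<^sup>2)"
    by (simp_all add: periodic1_def solution_shift[OF t] zv_periodic[OF t])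
  have l: "loc_integrable (\<lambda>x. (\<rho> t x - z t x)\<^sup>2)" "loc_integrable (\<lambda>x. (\<rho>t t x - v t x)\<^sup>2)"
    using zsq by (auto intro!: periodic_loc_integrable p simp: square_integrable_def M01_integrable)
  have "AE x in lborel. (\<rho> t x - z t x)\<^sup>2 = 0" "AE x in lborel. (\<rho>t t x - v t x)\<^sup>2 = 0"
    using L2_uniqueness[OF t] by (intro periodic_AE_0 p l; simp add: primitive_1 M01_integral)+
  then show "AE x in lborel. \<rho> t x = z t x" "AE x in lborel. \<rho>t t x = v t x" by simp_all
qed

text \<open>The step at which an order is gained: \<open>j\<close> derivatives of the
  representatives make densities of level \<open>Suc j\<close>.\<close>

lemma Ck_density_squares:
  assumes "jointly_Ck j z" "jointly_Ck j v"
  shows "Ck_density (Suc j) (\<lambda>t x. (\<rho> t x)\<^sup>2)" "Ck_density (Suc j) (\<lambda>t x. \<rho> t x * \<rho>t t x)" "Ck_density (Suc j) (\<lambda>t x. (\<rho>t t x)\<^sup>2)"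
proof -
  have "jointly_Ck j (\<lambda>t x. (z t x)\<^sup>2)" "jointly_Ck j (\<lambda>t x. z t x * v t x)" "jointly_Ck j (\<lambda>t x. (v t x)\<^sup>2)"
    unfolding power2_eq_square by (intro jointly_Ck_mult assms)+
  moreover have "AE x in lborel. (\<rho> t x)\<^sup>2 = (z t x)\<^sup>2" "AE x in lborel. \<rho> t x * \<rho>t t x = z t x * v t x"
    "AE x in lborel. (\<rho>t t x)\<^sup>2 = (v t x)\<^sup>2" if "t \<ge> 0" for t
    using solution_AE_eq[OF that] by (eventually_elim, simp)+
  ultimately show "Ck_density (Suc j) (\<lambda>t x. (\<rho> t x)\<^sup>2)" "Ck_density (Suc j) (\<lambda>t x. \<rho> t x * \<rho>t t x)" "Ck_density (Suc j) (\<lambda>t x. (\<rho>t t x)\<^sup>2)"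
    using squares_loc_integrable by auto
qed

text \<open>Each round raises \<open>q\<close> by one order through the densities and then
  \<open>z\<close>, \<open>v\<close> through the linear equation. The only obstruction is the
  initial velocity, half of \<open>D1\<close>, which stops the climb at \<open>n\<close>.\<close>

lemma jointly_Ck_bootstrap:
  assumes "jointly_Ck n (\<lambda>_. D1)" "j \<le> n" shows "jointly_Ck j z \<and> jointly_Ck j v"
  using assms(2)
proof (induction j)
  case 0
  then show ?case using zv_jointly_cont by simp
next
  case (Suc j)
  then have "jointly_Ck j z" "jointly_Ck j v" by auto
  from Ck_density_squares[OF this] have "jointly_Ck (Suc j) q" by (rule jointly_Ck_potential)
  then show ?case
  proof (rule linear_ode_jointly_Ck[OF _ _ _ _ ode])
    show "jointly_Ck (Suc j) (\<lambda>t x. 0)" "jointly_Ck (Suc j) (\<lambda>_. z 0)" unfolding z0 by (intro jointly_Ck_const continuous_intros)+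
    show "jointly_Ck (Suc j) (\<lambda>_. v 0)" unfolding v0 by (intro jointly_Ck_cmult jointly_Ck_mono[OF Suc.prems assms(1)])
  qed
qed

end

lemma eta_eq: "\<exists>c. eta u0 \<rho> \<rho>t t = (\<lambda>x. primitive (\<lambda>y. (\<rho> t y)\<^sup>2) x + c)"
  by (rule exI[of _ "t * u0 0 - (LBINT \<tau>=0..t. (LBINT s=0..\<tau>. H_op \<mu> (\<rho> s) (\<rho>t s) 0))"])
    (simp add: eta_def primitive_def \<mu>_def fun_eq_iff)

lemma eta_abs_continuous: "t \<ge> 0 \<Longrightarrow> abs_continuous_on {a..b} (eta u0 \<rho> \<rho>t t)"
  using eta_eq[of t] primitive_abs_continuous[OF squares_loc_integrable(1)[of t], of a b] by auto

lemma eta_Ck: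
  assumes "k \<ge> 1" "Ck k u0" "t \<ge> 0" shows "Ck k (eta u0 \<rho> \<rho>t t)"
proof -
  obtain D where D: "D 0 = u0" "\<And>j. j < k \<Longrightarrow> \<forall>x. (D j has_real_derivative D (Suc j) x) (at x)" "continuous_on UNIV (D k)"
    using assms(2) unfolding Ck_def by blast
  \<comment> \<open>The derivative of \<open>u0\<close> has order \<open>n\<close>, and so do
    \<open>z\<close> and \<open>v\<close>; the missing order of the flow comes from the final
    integration in \<open>x\<close>.\<close>
  obtain n where n: "k = Suc n" using assms(1) by (cases k) auto
  have "jointly_Ck n (\<lambda>t. D 1)" by (rule jointly_Ck_derivative_sequence[OF D(2,3)]) (use n in auto)
  then have D1: "jointly_Ck n (\<lambda>_. D 1)" .
  have cont: "continuous_on UNIV (D 1)" using jointly_cont_slice[OF jointly_Ck_jointly_cont[OF D1], of 0] by simp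
  have der: "(u0 has_real_derivative D 1 x) (at x)" for x using D(1) D(2)[of 0] n by simp
  obtain z v where zv: "linear_ode q (\<lambda>t x. 0) z v" "z 0 = (\<lambda>x. 1)" "v 0 = (\<lambda>x. 1/2 * D 1 x)"
    using linear_ode_family_exists[OF q_jointly_cont jointly_cont_const[of "\<lambda>t. 0", OF continuous_on_const]] by blast
  have "jointly_Ck n z" "jointly_Ck n v" using jointly_Ck_bootstrap[OF der cont zv D1 order_refl] by auto
  from Ck_density_squares(1)[OF der cont zv this] have "jointly_Ck k (\<lambda>t x. primitive (\<lambda>y. (\<rho> t y)\<^sup>2) x)"
    unfolding n by (rule Ck_density_primitive)
  moreover obtain c where c: "eta u0 \<rho> \<rho>t t = (\<lambda>x. primitive (\<lambda>y. (\<rho> t y)\<^sup>2) x + c)" using eta_eq by blast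
  ultimately have "jointly_Ck k (\<lambda>t x. primitive (\<lambda>y. (\<rho> t y)\<^sup>2) x + c)" by (intro jointly_Ck_add jointly_Ck_const) auto
  from jointly_Ck_Ck[OF this assms(3)] show ?thesis by (simp add: c)
qed

end

theorem theorem2:
  fixes u0 u0d :: "real \<Rightarrow> real"
    and \<rho> \<rho>t :: "real \<Rightarrow> real \<Rightarrow> real"
  assumes "H1_S1 u0 u0d"
    and "is_global_solution u0 u0d \<rho> \<rho>t"
    and "\<forall>t\<ge>0. (LBINT x=0..1. (\<rho> t x)^2) = 1"
  shows "(\<forall>t\<ge>0. \<forall>a b. abs_continuous_on {a..b} (eta u0 \<rho> \<rho>t t))
       \<and> (\<forall>k\<ge>1. Ck k u0 \<longrightarrow> (\<forall>t\<ge>0. Ck k (eta u0 \<rho> \<rho>t t)))"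
proof -
  interpret ch_solution u0 u0d \<rho> \<rho>t by unfold_locales (fact assms)+
  show ?thesis using eta_abs_continuous eta_Ck by blast
qed

end
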